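(* Let $G$ be a discrete subgroup of a semi-simple Lie group $\mathbf{G}$. Let $\mathbf{B}\le\mathbf{G}$ be a Borel subgroup and consider the flag space $X=\mathbf{G}/\mathbf{B}$ with the action of $G$ by left translation. Then for every finitely supported, generating probability measure $\lambda$ on $G$ and every convex function $f:(0,\infty)\to\mathbb{R}$ with $f(1)=0$, we have $$I^{top}_{\lambda,f}(X)=I_{\lambda,f}(G).$$
   Context: A probability measure $\lambda$ on $G$ is generating if its support generates $G$. For probability measures $P,Q$ on a Borel space, choose a measure $R$ with $P,Q\ll R$, put $p=\frac{dP}{dR}$, $q=\frac{dQ}{dR}$, $f'(\infty)=\lim_{t\to\infty}f(t)/t$, $f(0)=f(0^+)$, and define (independently of $R$, with $0\cdot\infty=0$) $$D_f(P\|Q)=\int_{\{q>0\}}f\Big(\frac pq\Big)q\,dR+P(\{q=0\})f'(\infty)\in[0,\infty].$$ For a probability measure $\nu$ on a Borel $G$-space $X$, $h_{\lambda,f}(X,\nu)=\sum_{g\in G}\lambda(g)D_f(g\nu\|\nu)$, where $g\nu$ is the push-forward of $\nu$ by $g$. For a topological $G$-space $X$ (continuous action), $I^{top}_{\lambda,f}(X)=\inf_\nu h_{\lambda,f}(X,\nu)$ over all Borel probability measures $\nu$ on $X$. The number $I_{\lambda,f}(G)$ is the infimum of $h_{\lambda,f}(G,\omega)$ over all probability measures $\omega$ on $G$ with $\omega(g)>0$ for every $g\in G$, where $G$ acts on itself by left translation. *)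

theory Defs
  imports "HOL-Probability.Probability" "HOL-Algebra.Solvable_Groups"
begin

section \<open>Lie groups\<close>

primrec Ck_on :: "nat \<Rightarrow> 'a::real_normed_vector set \<Rightarrow> ('a \<Rightarrow> 'b::real_normed_vector) \<Rightarrow> bool" where
  "Ck_on 0 S f \<longleftrightarrow> continuous_on S f"
| "Ck_on (Suc k) S f \<longleftrightarrow>
     (\<exists>f'. (\<forall>x\<in>S. (f has_derivative f' x) (at x)) \<and> (\<forall>v. Ck_on k S (\<lambda>x. f' x v)))"

text \<open>Only used for open \<open>S\<close>.\<close>

definition smooth_on :: "'a::real_normed_vector set \<Rightarrow> ('a \<Rightarrow> 'b::real_normed_vector) \<Rightarrow> bool" where
  "smooth_on S f \<longleftrightarrow> (\<forall>k. Ck_on k S f)"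

text \<open>A chart is a pair of its domain and its coordinate map; \<open>inv_into U \<phi>\<close> is the inverse
  of the chart \<open>(U, \<phi>)\<close>. An atlas need not be maximal.\<close>

type_synonym ('g, 'e) chart = "'g set \<times> ('g \<Rightarrow> 'e)"

locale smooth_manifold =
  fixes T :: "'g topology" and A :: "('g, 'e::euclidean_space) chart set"
  assumes Hausdorff: "Hausdorff_space T"
    and second_countable: "second_countable T"
    and chart_open: "\<And>U \<phi>. (U, \<phi>) \<in> A \<Longrightarrow> openin T U \<and> open (\<phi> ` U)"
    and chart_homeomorphic:
      "\<And>U \<phi>. (U, \<phi>) \<in> A \<Longrightarrow> homeomorphic_map (subtopology T U) (top_of_set (\<phi> ` U)) \<phi>"
    and charts_cover: "(\<Union>(U, \<phi>)\<in>A. U) = topspace T"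
    and charts_compatible:
      "\<And>U \<phi> V \<psi>. (U, \<phi>) \<in> A \<Longrightarrow> (V, \<psi>) \<in> A \<Longrightarrow> smooth_on (\<phi> ` (U \<inter> V)) (\<lambda>x. \<psi> (inv_into U \<phi> x))"

locale lie_group = group G + smooth_manifold T A
  for G :: "('g, 'm) monoid_scheme" (structure)
    and T :: "'g topology" and A :: "('g, 'e::euclidean_space) chart set" +
  assumes topspace_eq: "topspace T = carrier G"
    and mult_continuous: "continuous_map (prod_topology T T) T (\<lambda>(x, y). x \<otimes> y)"
    and inv_continuous: "continuous_map T T (\<lambda>x. inv x)"
    and mult_smooth:
      "\<And>U \<phi> V \<psi> W \<theta>. (U, \<phi>) \<in> A \<Longrightarrow> (V, \<psi>) \<in> A \<Longrightarrow> (W, \<theta>) \<in> A \<Longrightarrow>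
        smooth_on {(x, y). x \<in> \<phi> ` U \<and> y \<in> \<psi> ` V \<and> inv_into U \<phi> x \<otimes> inv_into V \<psi> y \<in> W}
          (\<lambda>(x, y). \<theta> (inv_into U \<phi> x \<otimes> inv_into V \<psi> y))"
    and inv_smooth:
      "\<And>U \<phi> V \<psi>. (U, \<phi>) \<in> A \<Longrightarrow> (V, \<psi>) \<in> A \<Longrightarrow>
        smooth_on {x. x \<in> \<phi> ` U \<and> inv (inv_into U \<phi> x) \<in> V} (\<lambda>x. \<psi> (inv (inv_into U \<phi> x)))"

section \<open>The Lie algebra\<close>

text \<open>The tangent space at the identity is identified with the model space \<open>'e\<close> through some chart
  around the identity; another chart gives an isomorphic Lie algebra.\<close>

definition identity_chart :: "('g, 'm) monoid_scheme \<Rightarrow> ('g, 'e) chart set \<Rightarrow> ('g, 'e) chart" where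
  "identity_chart G A = (SOME c. c \<in> A \<and> \<one>\<^bsub>G\<^esub> \<in> fst c)"

definition coord_curve ::
  "('g, 'm) monoid_scheme \<Rightarrow> ('g, 'e::real_normed_vector) chart \<Rightarrow> 'e \<Rightarrow> real \<Rightarrow> 'g" where
  "coord_curve G c u t = inv_into (fst c) (snd c) (snd c \<one>\<^bsub>G\<^esub> + t *\<^sub>R u)"

text \<open>\<open>[u, v] = d/dt Ad(a t) v\<close> at \<open>t = 0\<close>, where \<open>a\<close> is any curve through the identity with velocity
  \<open>u\<close>, and \<open>Ad g v = d/ds (g (b s) g\<inverse>)\<close> at \<open>s = 0\<close>, where \<open>b\<close> is any curve through the identity
  with velocity \<open>v\<close>.\<close>

definition lie_bracket ::
  "('g, 'm) monoid_scheme \<Rightarrow> ('g, 'e::euclidean_space) chart set \<Rightarrow> 'e \<Rightarrow> 'e \<Rightarrow> 'e" where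
  "lie_bracket G A u v =
    (let c = identity_chart G A; a = coord_curve G c u; b = coord_curve G c v in
      vector_derivative
        (\<lambda>t. vector_derivative (\<lambda>s. snd c (a t \<otimes>\<^bsub>G\<^esub> b s \<otimes>\<^bsub>G\<^esub> inv\<^bsub>G\<^esub> (a t))) (at 0))
        (at 0))"

text \<open>The Lie algebra of a closed subgroup: the velocities of its one-parameter subgroups.\<close>

definition lie_algebra_of ::
  "('g, 'm) monoid_scheme \<Rightarrow> 'g topology \<Rightarrow> ('g, 'e::euclidean_space) chart set \<Rightarrow> 'g set \<Rightarrow> 'e set"
  where
  "lie_algebra_of G T A H =
    {v. \<exists>\<gamma>. continuous_map euclideanreal T \<gamma> \<and> (\<forall>t. \<gamma> t \<in> H) \<and>
            (\<forall>s t. \<gamma> (s + t) = \<gamma> s \<otimes>\<^bsub>G\<^esub> \<gamma> t) \<and>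
            ((\<lambda>t. snd (identity_chart G A) (\<gamma> t)) has_vector_derivative v) (at 0)}"

definition lie_subalgebra :: "('e::real_vector \<Rightarrow> 'e \<Rightarrow> 'e) \<Rightarrow> 'e set \<Rightarrow> bool" where
  "lie_subalgebra br S \<longleftrightarrow> subspace S \<and> (\<forall>x\<in>S. \<forall>y\<in>S. br x y \<in> S)"

definition lie_ideal :: "('e::real_vector \<Rightarrow> 'e \<Rightarrow> 'e) \<Rightarrow> 'e set \<Rightarrow> bool" where
  "lie_ideal br I \<longleftrightarrow> subspace I \<and> (\<forall>x. \<forall>y\<in>I. br x y \<in> I)"

definition lie_derived :: "('e::real_vector \<Rightarrow> 'e \<Rightarrow> 'e) \<Rightarrow> 'e set \<Rightarrow> 'e set" where
  "lie_derived br S = span {br x y | x y. x \<in> S \<and> y \<in> S}"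

definition lie_solvable :: "('e::real_vector \<Rightarrow> 'e \<Rightarrow> 'e) \<Rightarrow> 'e set \<Rightarrow> bool" where
  "lie_solvable br S \<longleftrightarrow> (\<exists>n. (lie_derived br ^^ n) S = {0})"

definition lie_semisimple :: "('e::real_vector \<Rightarrow> 'e \<Rightarrow> 'e) \<Rightarrow> bool" where
  "lie_semisimple br \<longleftrightarrow> (\<forall>I. lie_ideal br I \<and> lie_solvable br I \<longrightarrow> I = {0})"

definition semisimple_lie_group ::
  "('g, 'm) monoid_scheme \<Rightarrow> 'g topology \<Rightarrow> ('g, 'e::euclidean_space) chart set \<Rightarrow> bool" where
  "semisimple_lie_group G T A \<longleftrightarrow> lie_group G T A \<and> lie_semisimple (lie_bracket G A)"

section \<open>Borel subgroups\<close>

text \<open>The complexification is modelled on pairs, \<open>(x, y)\<close> standing for \<open>x + i y\<close>.\<close>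

definition complexified_bracket ::
  "('e::real_vector \<Rightarrow> 'e \<Rightarrow> 'e) \<Rightarrow> 'e \<times> 'e \<Rightarrow> 'e \<times> 'e \<Rightarrow> 'e \<times> 'e" where
  "complexified_bracket br = (\<lambda>(a, b) (c, d). (br a c - br b d, br a d + br b c))"

definition complex_solvable_subalgebra ::
  "('e::real_vector \<Rightarrow> 'e \<Rightarrow> 'e) \<Rightarrow> ('e \<times> 'e) set \<Rightarrow> bool" where
  "complex_solvable_subalgebra br S \<longleftrightarrow>
    lie_subalgebra (complexified_bracket br) S \<and> (\<forall>(x, y)\<in>S. (- y, x) \<in> S) \<and>
    lie_solvable (complexified_bracket br) S"

text \<open>A real subalgebra is Borel if its complexification is a maximal solvable subalgebra of the
  complexified Lie algebra. Maximality among real solvable subalgebras would not be enough: it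
  would admit the rotation subalgebra of the real \<open>sl\<^sub>2\<close>.\<close>

definition borel_subalgebra :: "('e::real_vector \<Rightarrow> 'e \<Rightarrow> 'e) \<Rightarrow> 'e set \<Rightarrow> bool" where
  "borel_subalgebra br S \<longleftrightarrow> complex_solvable_subalgebra br (S \<times> S) \<and>
    (\<forall>S'. complex_solvable_subalgebra br S' \<and> S \<times> S \<subseteq> S' \<longrightarrow> S' = S \<times> S)"

text \<open>A Borel subgroup is a closed, maximal solvable subgroup whose Lie algebra is Borel. In a connected
  complex semisimple group these are the maximal connected solvable subgroups. In the real points of a
  connected semisimple algebraic group they are the real points of the Borel subgroups defined
  over the reals, which need not be connected in the Lie group topology: in \<open>SL\<^sub>n\<close> over the reals
  they are the conjugates of the full group of upper triangular matrices.\<close>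

definition borel_subgroup ::
  "('g, 'm) monoid_scheme \<Rightarrow> 'g topology \<Rightarrow> ('g, 'e::euclidean_space) chart set \<Rightarrow> 'g set \<Rightarrow> bool"
  where
  "borel_subgroup G T A B \<longleftrightarrow>
    subgroup B G \<and> closedin T B \<and> solvable (G\<lparr>carrier := B\<rparr>) \<and>
    borel_subalgebra (lie_bracket G A) (lie_algebra_of G T A B) \<and>
    (\<forall>H. subgroup H G \<and> solvable (G\<lparr>carrier := H\<rparr>) \<and> B \<subseteq> H \<longrightarrow> H = B)"

definition discrete_subgroup :: "('g, 'm) monoid_scheme \<Rightarrow> 'g topology \<Rightarrow> 'g set \<Rightarrow> bool" where
  "discrete_subgroup G T H \<longleftrightarrow> subgroup H G \<and> subtopology T H = discrete_topology H"

definition quotient_topology :: "'a topology \<Rightarrow> ('a \<Rightarrow> 'b) \<Rightarrow> 'b topology" where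
  "quotient_topology T q =
    topology (\<lambda>U. U \<subseteq> q ` topspace T \<and> openin T {x \<in> topspace T. q x \<in> U})"

lemma openin_quotient_topology:
  "openin (quotient_topology T q) U \<longleftrightarrow>
    U \<subseteq> q ` topspace T \<and> openin T {x \<in> topspace T. q x \<in> U}"
proof -
  have "istopology (\<lambda>U. U \<subseteq> q ` topspace T \<and> openin T {x \<in> topspace T. q x \<in> U})"
    unfolding istopology_def
  proof (intro conjI allI impI)
    fix U V
    assume U: "U \<subseteq> q ` topspace T \<and> openin T {x \<in> topspace T. q x \<in> U}"
      and V: "V \<subseteq> q ` topspace T \<and> openin T {x \<in> topspace T. q x \<in> V}"
    show "U \<inter> V \<subseteq> q ` topspace T" using U by blast
    have "{x \<in> topspace T. q x \<in> U \<inter> V} = {x \<in> topspace T. q x \<in> U} \<inter> {x \<in> topspace T. q x \<in> V}"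
      by blast
    then show "openin T {x \<in> topspace T. q x \<in> U \<inter> V}" using U V by (simp only: openin_Int)
  next
    fix K
    assume K: "\<forall>U\<in>K. U \<subseteq> q ` topspace T \<and> openin T {x \<in> topspace T. q x \<in> U}"
    show "\<Union>K \<subseteq> q ` topspace T" using K by blast
    have "{x \<in> topspace T. q x \<in> \<Union>K} = (\<Union>U\<in>K. {x \<in> topspace T. q x \<in> U})" by blast
    then show "openin T {x \<in> topspace T. q x \<in> \<Union>K}" using K by (simp only:) blast
  qed
  then show ?thesis by (simp add: quotient_topology_def topology_inverse')
qed

definition flag_space :: "('g, 'm) monoid_scheme \<Rightarrow> 'g topology \<Rightarrow> 'g set \<Rightarrow> 'g set topology" where
  "flag_space G T B = quotient_topology T (\<lambda>x. x <#\<^bsub>G\<^esub> B)"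

section \<open>Divergence and entropy\<close>

text \<open>The dominating measure \<open>R = P + Q\<close>.\<close>

definition sum_measure :: "'a measure \<Rightarrow> 'a measure \<Rightarrow> 'a measure" where
  "sum_measure P Q = measure_of (space P) (sets P) (\<lambda>E. emeasure P E + emeasure Q E)"

definition extended_at_zero :: "(real \<Rightarrow> real) \<Rightarrow> real \<Rightarrow> ereal" where
  "extended_at_zero f t = (if t = 0 then Lim (at_right 0) (\<lambda>s. ereal (f s)) else ereal (f t))"

definition slope_at_infinity :: "(real \<Rightarrow> real) \<Rightarrow> ereal" where
  "slope_at_infinity f = Lim at_top (\<lambda>t. ereal (f t / t))"

definition ereal_integral :: "'a measure \<Rightarrow> ('a \<Rightarrow> ereal) \<Rightarrow> ereal" where
  "ereal_integral M F =
    enn2ereal (\<integral>\<^sup>+x. e2ennreal (F x) \<partial>M) - enn2ereal (\<integral>\<^sup>+x. e2ennreal (- F x) \<partial>M)"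

text \<open>\<open>e2ennreal\<close> only changes the type of the value in \<open>[0, \<infinity>]\<close>: for convex \<open>f\<close> with \<open>f 1 = 0\<close> it is
  applied to a nonnegative number.\<close>

definition f_divergence :: "(real \<Rightarrow> real) \<Rightarrow> 'a measure \<Rightarrow> 'a measure \<Rightarrow> ennreal" where
  "f_divergence f P Q =
    (let R = sum_measure P Q;
         p = (\<lambda>x. enn2real (RN_deriv R P x));
         q = (\<lambda>x. enn2real (RN_deriv R Q x))
     in e2ennreal
          (ereal_integral R (\<lambda>x. if q x > 0 then extended_at_zero f (p x / q x) * ereal (q x) else 0)
           + ereal (measure P {x \<in> space P. q x = 0}) * slope_at_infinity f))"

definition entropy ::
  "'g set \<Rightarrow> 'g pmf \<Rightarrow> (real \<Rightarrow> real) \<Rightarrow> ('g \<Rightarrow> 'x \<Rightarrow> 'x) \<Rightarrow> 'x measure \<Rightarrow> ennreal" where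
  "entropy \<Gamma> l f act \<nu> =
    (\<Sum>\<^sub>\<infinity>g\<in>\<Gamma>. ennreal (pmf l g) * f_divergence f (distr \<nu> \<nu> (act g)) \<nu>)"

definition borel_probabilities :: "'x topology \<Rightarrow> 'x measure set" where
  "borel_probabilities X =
    {\<nu>. prob_space \<nu> \<and> sets \<nu> = sets (sigma (topspace X) {U. openin X U})}"

definition I_top ::
  "'g set \<Rightarrow> 'g pmf \<Rightarrow> (real \<Rightarrow> real) \<Rightarrow> ('g \<Rightarrow> 'x \<Rightarrow> 'x) \<Rightarrow> 'x topology \<Rightarrow> ennreal" where
  "I_top \<Gamma> l f act X = (INF \<nu>\<in>borel_probabilities X. entropy \<Gamma> l f act \<nu>)"

definition I_group ::
  "('g, 'm) monoid_scheme \<Rightarrow> 'g set \<Rightarrow> 'g pmf \<Rightarrow> (real \<Rightarrow> real) \<Rightarrow> ennreal" where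
  "I_group G \<Gamma> l f =
    (INF \<omega>\<in>{\<omega>. prob_space \<omega> \<and> sets \<omega> = sets (count_space \<Gamma>) \<and> (\<forall>g\<in>\<Gamma>. emeasure \<omega> {g} > 0)}.
      entropy \<Gamma> l f (\<lambda>g x. g \<otimes>\<^bsub>G\<^esub> x) \<omega>)"

end

theory Submission
  imports Defs
begin

text \<open>
  Both inequalities are instances of data processing: pushing two probability measures forward by
  the same map does not increase their divergence. An orbit map from \<open>\<Gamma>\<close> to the flag space
  intertwines the two actions, so it carries every measure on \<open>\<Gamma>\<close> to a Borel measure of at most
  the same entropy, and \<open>I_top \<le> I_group\<close> follows (\<open>I_top_le_I_group\<close>).

  For the converse (\<open>I_group_le_I_top\<close>), a Borel probability \<open>\<nu>\<close> on the flag space has to be imitated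
  by a fully supported measure on \<open>\<Gamma>\<close> whose entropy is hardly larger. The reason why this is possible
  is that the action is amenable: \<open>B\<close> is solvable, and \<open>\<Gamma>\<close>, being discrete, acts properly on \<open>G\<close>.
  Concretely, for every finite \<open>S \<subseteq> \<Gamma>\<close> there is a map \<open>m\<close> from the flag space to finitely supported
  probability measures on \<open>\<Gamma>\<close>, with finitely many values, such that \<open>s \<cdot> m(x)\<close> is close to \<open>m(s \<cdot> x)\<close>
  in total variation for \<open>s \<in> S\<close> and all \<open>x\<close> outside a set of small measure
  (\<open>approximately_equivariant_kernels\<close>). Let \<open>\<omega>'\<close> be the average of \<open>m\<close> over \<open>\<nu>\<close>.

  Since \<open>f\<close> is arbitrary, closeness in total variation does not control the divergence of \<open>s \<cdot> \<omega>'\<close>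
  from \<open>\<omega>'\<close>, which may even be infinite. Therefore \<open>\<omega>'\<close> is mixed with a small multiple \<open>\<eta>\<close> of a random
  walk average \<open>\<kappa>\<close> of itself. The mixture \<open>\<omega>\<close> has full support, and the ratio of \<open>s \<cdot> \<omega>\<close> to \<open>\<omega>\<close> lies in
  \<open>[1/C, C]\<close> with \<open>C\<close> depending on \<open>\<eta>\<close> and the generators, but not on \<open>m\<close>. Replacing \<open>f\<close> by its tangent at the ratio,
  point by point, turns the divergence of \<open>s \<cdot> \<omega>\<close> from \<open>\<omega>\<close> into a linear functional
  \<open>\<integral>\<alpha> d(s \<cdot> \<omega>) + \<integral>\<beta> d\<omega>\<close>, whose coefficients have a bound \<open>L\<close> that does not depend on \<open>m\<close> either and satisfy
  \<open>\<alpha>(\<gamma>) t + \<beta>(\<gamma>) \<le> f t\<close> for all \<open>t > 0\<close> (\<open>smoothed_approximation\<close>). On the \<open>\<kappa>\<close>-part the functional is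
  bounded by a constant independent of \<open>\<eta>\<close>. On the \<open>\<omega>'\<close>-part it is stable under small changes in total
  variation, so almost equivariance rewrites it, up to \<open>L\<close> times the error, as a sum
  \<open>\<Sum>i. A i * \<nu> (s\<inverse> E i) + B i * \<nu> (E i)\<close>, where the \<open>E i\<close> are the level sets of \<open>m\<close> and \<open>(A i, B i)\<close> is
  the average of \<open>(\<alpha>, \<beta>)\<close> over the value of \<open>m\<close> on \<open>E i\<close>. Averages of affine minorants of \<open>f\<close> are affine minorants,
  so this sum is at most the divergence of \<open>s \<cdot> \<nu>\<close> from \<open>\<nu>\<close> (\<open>divergence_transfer\<close>). First \<open>\<eta>\<close> and then the
  error are chosen small.

  The divergence is accessible because it is the supremum of \<open>\<Sum>i. a i * P (E i) + b i * Q (E i)\<close> over all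
  finite measurable partitions \<open>E\<close> and affine minorants \<open>(a i, b i)\<close> of \<open>f\<close>
  (\<open>minorant_sum_le_f_divergence\<close> and \<open>f_divergence_leI\<close>). Data processing is immediate from this description.

  Amenability of \<open>B\<close> is used in the following form (\<open>boundedly_amenable\<close>): for a compact
  \<open>K \<subseteq> B\<close> and \<open>e > 0\<close> there is one compact \<open>K' \<subseteq> B\<close> that supports, for every finite \<open>E \<subseteq> K\<close>, a finitely supported
  probability measure moved by at most \<open>e\<close> in total variation under every element of \<open>E\<close>. The point is that \<open>K'\<close>
  does not depend on \<open>E\<close>: a finite net of \<open>K\<close> may be chosen after \<open>K'\<close>, so that finitely supported measures can do
  the work of Haar measure on \<open>B\<close>. For closed solvable subgroups of a locally compact group the property is proved along the
  closures of the derived series (\<open>boundedly_amenable_solvable\<close>). An abelian step is exhausted by adjoining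
  one element \<open>f\<close> after the other to a closed normal subgroup \<open>L\<close>: either the powers of \<open>f\<close> leave every
  compact set modulo \<open>L\<close>, and uniform measures on \<open>1, f, \<dots>, f^(n-1)\<close> do, or they stay in one compact set
  modulo \<open>L\<close> (\<open>cyclic_discrete_or_cocompact\<close>), and the almost invariant measures that exist without any
  control of supports can be folded back into a compact set (\<open>boundedly_amenable_cocompact\<close>).
\<close>

(* Below, closure_of and <# denote topological closures and left cosets. *)
no_notation eq_closure_of ("closure'_of\<index>")
no_notation subset_mset (infix "<#" 50)

section \<open>Closeness of probability mass functions in total variation\<close>

lemma integrable_pmf_bounded:
  fixes \<phi> :: "'a \<Rightarrow> real"
  assumes "\<And>x. \<bar>\<phi> x\<bar> \<le> c"
  shows "integrable (measure_pmf P) \<phi>"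
  by (rule measure_pmf.integrable_const_bound[where B = c]) (auto simp: assms)

lemma expectation_pmf_bounded:
  fixes \<phi> :: "'a \<Rightarrow> real"
  assumes "\<And>x. \<bar>\<phi> x\<bar> \<le> c"
  shows "\<bar>measure_pmf.expectation P \<phi>\<bar> \<le> c"
proof -
  have "measure_pmf.expectation P \<phi> \<le> c"
    by (rule measure_pmf.integral_le_const)
      (auto intro: integrable_pmf_bounded[OF assms] abs_le_D1[OF assms])
  moreover have "measure_pmf.expectation P \<phi> \<ge> - c"
    by (rule measure_pmf.integral_ge_const)
      (use assms in \<open>auto simp: abs_le_iff minus_le_iff intro!: integrable_pmf_bounded[where c = c]\<close>)
  ultimately show ?thesis by auto
qed

lemma expectation_bind_pmf:
  fixes \<phi> :: "'a \<Rightarrow> real"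
  assumes \<phi>: "\<And>x. \<bar>\<phi> x\<bar> \<le> c"
  shows "measure_pmf.expectation (bind_pmf P K) \<phi> =
    measure_pmf.expectation P (\<lambda>x. measure_pmf.expectation (K x) \<phi>)"
proof -
  let ?\<psi> = "\<lambda>x. \<phi> x + c"
  have nn: "0 \<le> ?\<psi> x" for x using \<phi>[of x] by auto
  have int: "integrable (measure_pmf R) ?\<psi>" for R :: "'a pmf"
    using integrable_pmf_bounded[of \<phi>, OF \<phi>] by simp
  have E: "measure_pmf.expectation R ?\<psi> = measure_pmf.expectation R \<phi> + c" for R :: "'a pmf"
    using integrable_pmf_bounded[of \<phi>, OF \<phi>] by simp
  have Enn: "0 \<le> measure_pmf.expectation R ?\<psi>" for R :: "'a pmf"
    by (rule integral_nonneg_AE) (simp add: nn)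
  have intE: "integrable (measure_pmf P) (\<lambda>x. measure_pmf.expectation (K x) ?\<psi>)"
    using expectation_pmf_bounded[of \<phi>, OF \<phi>]
    by (intro integrable_pmf_bounded[where c = "2 * c"]) (simp add: E abs_le_iff, smt (verit) expectation_pmf_bounded[of \<phi>, OF \<phi>])
  have "ennreal (measure_pmf.expectation (bind_pmf P K) ?\<psi>) = (\<integral>\<^sup>+x. ennreal (?\<psi> x) \<partial>bind_pmf P K)"
    using nn_integral_eq_integral[OF int] nn by simp
  also have "\<dots> = (\<integral>\<^sup>+x. (\<integral>\<^sup>+y. ennreal (?\<psi> y) \<partial>K x) \<partial>P)" by simp
  also have "\<dots> = (\<integral>\<^sup>+x. ennreal (measure_pmf.expectation (K x) ?\<psi>) \<partial>P)"
    using nn_integral_eq_integral[OF int] nn by simp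
  also have "\<dots> = ennreal (measure_pmf.expectation P (\<lambda>x. measure_pmf.expectation (K x) ?\<psi>))"
    using nn_integral_eq_integral[OF intE] Enn by simp
  finally have "measure_pmf.expectation (bind_pmf P K) ?\<psi> =
      measure_pmf.expectation P (\<lambda>x. measure_pmf.expectation (K x) ?\<psi>)"
    using Enn by (subst (asm) ennreal_inj) (auto intro!: integral_nonneg_AE)
  also have "\<dots> = measure_pmf.expectation P (\<lambda>x. measure_pmf.expectation (K x) \<phi>) + c"
    using integrable_pmf_bounded[of "\<lambda>x. measure_pmf.expectation (K x) \<phi>", OF expectation_pmf_bounded[of \<phi>, OF \<phi>]]
    by (simp add: E)
  finally show ?thesis by (simp add: E)
qed

text \<open>Testing against bounded functions makes push-forwards and mixtures transparent: both act on the
  test function alone.\<close>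

definition tv_close :: "real \<Rightarrow> 'a pmf \<Rightarrow> 'a pmf \<Rightarrow> bool" where
  "tv_close e P Q \<longleftrightarrow> (\<forall>\<phi>. (\<forall>x. \<bar>\<phi> x\<bar> \<le> 1) \<longrightarrow>
     \<bar>measure_pmf.expectation P \<phi> - measure_pmf.expectation Q \<phi>\<bar> \<le> e)"

lemma tv_closeD:
  assumes "tv_close e P Q" and \<phi>: "\<And>x. \<bar>\<phi> x\<bar> \<le> c" and c: "0 < c"
  shows "\<bar>measure_pmf.expectation P \<phi> - measure_pmf.expectation Q \<phi>\<bar> \<le> c * e"
proof -
  have "\<bar>measure_pmf.expectation P (\<lambda>x. \<phi> x / c) - measure_pmf.expectation Q (\<lambda>x. \<phi> x / c)\<bar> \<le> e"
    using assms by (auto simp: tv_close_def simp del: integral_divide_zero Bochner_Integration.integral_divide)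
  then have "\<bar>measure_pmf.expectation P \<phi> - measure_pmf.expectation Q \<phi>\<bar> / c \<le> e"
    using c by (simp add: abs_divide flip: diff_divide_distrib)
  then show ?thesis using c by (simp add: field_simps)
qed

lemma tv_close_refl: "0 \<le> e \<Longrightarrow> tv_close e P P"
  by (simp add: tv_close_def)

lemma tv_close_trans:
  assumes "tv_close d P Q" "tv_close e Q R"
  shows "tv_close (d + e) P R"
  unfolding tv_close_def
proof (intro allI impI)
  fix \<phi> :: "'a \<Rightarrow> real" assume "\<forall>x. \<bar>\<phi> x\<bar> \<le> 1"
  then have "\<bar>measure_pmf.expectation P \<phi> - measure_pmf.expectation Q \<phi>\<bar> \<le> d"
    "\<bar>measure_pmf.expectation Q \<phi> - measure_pmf.expectation R \<phi>\<bar> \<le> e"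
    using assms by (auto simp: tv_close_def)
  then show "\<bar>measure_pmf.expectation P \<phi> - measure_pmf.expectation R \<phi>\<bar> \<le> d + e"
    by linarith
qed

lemma tv_close_mono: "tv_close d P Q \<Longrightarrow> d \<le> e \<Longrightarrow> tv_close e P Q"
  unfolding tv_close_def by (meson order_trans)

lemma tv_close_map: "tv_close e P Q \<Longrightarrow> tv_close e (map_pmf f P) (map_pmf f Q)"
  by (auto simp: tv_close_def)

lemma tv_close_bind:
  assumes "tv_close e P Q"
  shows "tv_close e (bind_pmf P K) (bind_pmf Q K)"
  unfolding tv_close_def
proof (intro allI impI)
  fix \<phi> :: "'b \<Rightarrow> real" assume \<phi>: "\<forall>x. \<bar>\<phi> x\<bar> \<le> 1"
  have "\<forall>x. \<bar>measure_pmf.expectation (K x) \<phi>\<bar> \<le> 1"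
    using \<phi> by (auto intro: expectation_pmf_bounded)
  then show "\<bar>measure_pmf.expectation (bind_pmf P K) \<phi> - measure_pmf.expectation (bind_pmf Q K) \<phi>\<bar> \<le> e"
    using assms \<phi> by (simp add: tv_close_def expectation_bind_pmf[where c = 1])
qed

lemma tv_close_bind_kernel:
  assumes "\<And>x. x \<in> set_pmf P \<Longrightarrow> tv_close e (K x) (K' x)"
  shows "tv_close e (bind_pmf P K) (bind_pmf P K')"
  unfolding tv_close_def
proof (intro allI impI)
  fix \<phi> :: "'b \<Rightarrow> real" assume \<phi>: "\<forall>x. \<bar>\<phi> x\<bar> \<le> 1"
  let ?E = "\<lambda>K x. measure_pmf.expectation (K x) \<phi>"
  have int: "integrable (measure_pmf P) (?E K)" for K
    by (rule integrable_pmf_bounded[where c = 1]) (use \<phi> in \<open>simp add: expectation_pmf_bounded\<close>)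
  have "\<bar>measure_pmf.expectation P (\<lambda>x. ?E K x - ?E K' x)\<bar> \<le>
      measure_pmf.expectation P (\<lambda>x. \<bar>?E K x - ?E K' x\<bar>)"
    by (rule integral_abs_bound)
  also have "\<dots> \<le> e"
    by (rule measure_pmf.integral_le_const)
      (use assms \<phi> int in \<open>auto simp: tv_close_def AE_measure_pmf_iff\<close>)
  finally show "\<bar>measure_pmf.expectation (bind_pmf P K) \<phi> - measure_pmf.expectation (bind_pmf P K') \<phi>\<bar> \<le> e"
    using \<phi> int by (simp add: expectation_bind_pmf[where c = 1] Bochner_Integration.integral_diff)
qed

text \<open>Two intervals of length \<open>n\<close> that are shifted by \<open>i\<close> differ in at most \<open>2 \<bar>i\<bar>\<close> points.\<close>

lemma tv_close_uniform_shift: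
  fixes n :: nat and i :: int
  assumes "0 < n"
  shows "tv_close (2 * \<bar>real_of_int i\<bar> / n)
    (map_pmf (\<lambda>j. h (i + int j)) (pmf_of_set {..<n})) (map_pmf (\<lambda>j. h (int j)) (pmf_of_set {..<n}))"
  unfolding tv_close_def
proof (intro allI impI)
  fix \<phi> :: "'a \<Rightarrow> real" assume \<phi>: "\<forall>x. \<bar>\<phi> x\<bar> \<le> 1"
  define F where "F = (\<lambda>j. \<phi> (h j))"
  have F: "\<bar>F j\<bar> \<le> 1" for j using \<phi> by (simp add: F_def)
  have sh: "(\<Sum>j<n. F (i + int j)) = (\<Sum>j\<in>{i..<i+int n}. F j)" for i :: int
    by (rule sum.reindex_bij_witness[of _ "\<lambda>j. nat (j - i)" "\<lambda>j. i + int j"]) auto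
  have step: "\<bar>(\<Sum>j\<in>{i..<i+int n}. F j) - (\<Sum>j\<in>{i+1..<i+1+int n}. F j)\<bar> \<le> 2" for i :: int
  proof -
    have "{i..<i+int n} = insert i {i+1..<i+int n}" "{i+1..<i+1+int n} = insert (i+int n) {i+1..<i+int n}"
      using assms by auto
    then show ?thesis using F[of i] F[of "i + int n"] by simp
  qed
  have k: "\<bar>(\<Sum>j\<in>{i..<i+int n}. F j) - (\<Sum>j\<in>{i+int k..<i+int k+int n}. F j)\<bar> \<le> 2 * k" for i :: int and k :: nat
  proof (induction k)
    case (Suc k)
    then show ?case using step[of "i + int k"] by (simp add: algebra_simps)
  qed simp
  have "\<bar>(\<Sum>j\<in>{i..<i+int n}. F j) - (\<Sum>j\<in>{0..<int n}. F j)\<bar> \<le> 2 * \<bar>real_of_int i\<bar>"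
  proof (cases "i \<ge> 0")
    case True
    then show ?thesis using k[of 0 "nat i"] by (simp add: abs_minus_commute)
  next
    case False
    then show ?thesis using k[of i "nat (- i)"] by simp
  qed
  then have "\<bar>(\<Sum>j<n. F (i + int j)) - (\<Sum>j<n. F (int j))\<bar> / n \<le> 2 * \<bar>real_of_int i\<bar> / n"
    using sh[of i] sh[of 0] by (simp add: divide_right_mono)
  then show "\<bar>measure_pmf.expectation (map_pmf (\<lambda>j. h (i + int j)) (pmf_of_set {..<n})) \<phi>
      - measure_pmf.expectation (map_pmf (\<lambda>j. h (int j)) (pmf_of_set {..<n})) \<phi>\<bar> \<le> 2 * \<bar>real_of_int i\<bar> / n"
    using assms by (simp add: F_def integral_pmf_of_set abs_divide lessThan_empty_iff flip: diff_divide_distrib)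
qed

section \<open>Topological groups\<close>

locale topological_group = group G for G :: "('g, 'm) monoid_scheme" (structure) +
  fixes T :: "'g topology"
  assumes topspace_eq: "topspace T = carrier G"
    and mult_continuous: "continuous_map (prod_topology T T) T (\<lambda>(x, y). x \<otimes> y)"
    and inv_continuous: "continuous_map T T (\<lambda>x. inv x)"
begin

lemma continuous_map_mult:
  assumes "continuous_map X T f" "continuous_map X T g"
  shows "continuous_map X T (\<lambda>x. f x \<otimes> g x)"
  using continuous_map_compose[OF continuous_map_pairedI[OF assms] mult_continuous]
  by (simp add: o_def)

lemma continuous_map_inv:
  assumes "continuous_map X T f"
  shows "continuous_map X T (\<lambda>x. inv (f x))"
  using continuous_map_compose[OF assms inv_continuous] by (simp add: o_def)

lemma compact_subset_carrier: "compactin T K \<Longrightarrow> K \<subseteq> carrier G"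
  using compactin_subset_topspace topspace_eq by blast

lemma open_subset_carrier: "openin T U \<Longrightarrow> U \<subseteq> carrier G"
  using openin_subset topspace_eq by blast

lemma set_mult_memI: "a \<in> A \<Longrightarrow> b \<in> B \<Longrightarrow> a \<otimes> b \<in> A <#> B"
  by (auto simp: set_mult_def)

lemma compactin_set_mult:
  assumes "compactin T A" "compactin T B"
  shows "compactin T (A <#> B)"
proof -
  have "A <#> B = (\<lambda>(x, y). x \<otimes> y) ` (A \<times> B)" by (auto simp: set_mult_def)
  then show ?thesis
    using image_compactin[OF _ mult_continuous, of "A \<times> B"] assms by (simp add: compactin_Times)
qed

lemma compactin_inv_image: "compactin T A \<Longrightarrow> compactin T (m_inv G ` A)"
  by (rule image_compactin[OF _ inv_continuous])

lemma l_coset_eq_preimage: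
  assumes "x \<in> carrier G" "U \<subseteq> carrier G"
  shows "x <# U = {y \<in> carrier G. inv x \<otimes> y \<in> U}"
proof (intro equalityI subsetI)
  fix y assume "y \<in> {y \<in> carrier G. inv x \<otimes> y \<in> U}"
  moreover from this have "y = x \<otimes> (inv x \<otimes> y)" using assms by (simp add: m_assoc[symmetric])
  ultimately show "y \<in> x <# U" unfolding l_coset_def by blast
qed (use assms in \<open>auto simp: l_coset_def m_assoc[symmetric]\<close>)

lemma r_coset_eq_preimage:
  assumes "x \<in> carrier G" "U \<subseteq> carrier G"
  shows "U #> x = {y \<in> carrier G. y \<otimes> inv x \<in> U}"
proof (intro equalityI subsetI)
  fix y assume "y \<in> {y \<in> carrier G. y \<otimes> inv x \<in> U}"
  moreover from this have "y = (y \<otimes> inv x) \<otimes> x" using assms by (simp add: m_assoc)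
  ultimately show "y \<in> U #> x" unfolding r_coset_def by blast
qed (use assms in \<open>auto simp: r_coset_def m_assoc\<close>)

lemma openin_l_coset:
  assumes "x \<in> carrier G" "openin T U" shows "openin T (x <# U)"
proof -
  have "continuous_map T T (\<lambda>y. inv x \<otimes> y)"
    by (rule continuous_map_mult) (use assms topspace_eq in \<open>auto simp: continuous_map_id[unfolded id_def]\<close>)
  then show ?thesis
    using openin_continuous_map_preimage[of T T _ U] assms open_subset_carrier[of U]
    by (simp add: l_coset_eq_preimage topspace_eq)
qed

lemma openin_r_coset:
  assumes "x \<in> carrier G" "openin T U" shows "openin T (U #> x)"
proof -
  have "continuous_map T T (\<lambda>y. y \<otimes> inv x)"
    by (rule continuous_map_mult) (use assms topspace_eq in \<open>auto simp: continuous_map_id[unfolded id_def]\<close>)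
  then show ?thesis
    using openin_continuous_map_preimage[of T T _ U] assms open_subset_carrier[of U]
    by (simp add: r_coset_eq_preimage topspace_eq)
qed

lemma closedin_l_coset:
  assumes "x \<in> carrier G" "closedin T U" shows "closedin T (x <# U)"
proof -
  have "continuous_map T T (\<lambda>y. inv x \<otimes> y)"
    by (rule continuous_map_mult) (use assms topspace_eq in \<open>auto simp: continuous_map_id[unfolded id_def]\<close>)
  then show ?thesis
    using closedin_continuous_map_preimage[of T T _ U] assms closedin_subset[of T U]
    by (simp add: l_coset_eq_preimage topspace_eq)
qed

lemma openin_set_mult_left:
  assumes "openin T U" "A \<subseteq> carrier G" shows "openin T (U <#> A)"
proof -
  have "U <#> A = (\<Union>a\<in>A. U #> a)" by (auto simp: set_mult_def r_coset_def)
  then show ?thesis using assms openin_r_coset by (auto intro!: openin_Union)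
qed

lemma openin_set_mult_right:
  assumes "openin T U" "A \<subseteq> carrier G" shows "openin T (A <#> U)"
proof -
  have "A <#> U = (\<Union>a\<in>A. a <# U)" by (auto simp: set_mult_def l_coset_def)
  then show ?thesis using assms openin_l_coset by (auto intro!: openin_Union)
qed

lemma openin_inv_image:
  assumes "openin T U" shows "openin T (m_inv G ` U)"
proof -
  have "m_inv G ` U = {x \<in> carrier G. inv x \<in> U}"
  proof (intro equalityI subsetI)
    fix x assume "x \<in> {x \<in> carrier G. inv x \<in> U}"
    then have "x = inv (inv x)" "inv x \<in> U" by auto
    then show "x \<in> m_inv G ` U" by (rule image_eqI)
  qed (use open_subset_carrier[OF assms] in auto)
  then show ?thesis using openin_continuous_map_preimage[OF inv_continuous assms] by (simp add: topspace_eq)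
qed

lemma symmetric_square_root_neighbourhood:
  assumes "openin T U" "\<one> \<in> U"
  obtains V where "openin T V" "\<one> \<in> V" "m_inv G ` V = V" "V <#> V \<subseteq> U" "V \<subseteq> U"
proof -
  let ?W = "{p \<in> topspace (prod_topology T T). (case p of (x, y) \<Rightarrow> x \<otimes> y) \<in> U}"
  have "openin (prod_topology T T) ?W"
    by (rule openin_continuous_map_preimage[OF mult_continuous assms(1)])
  moreover have "(\<one>, \<one>) \<in> ?W" using assms by (simp add: topspace_eq)
  ultimately obtain V1 V2 where V: "openin T V1" "openin T V2" "\<one> \<in> V1" "\<one> \<in> V2" "V1 \<times> V2 \<subseteq> ?W"
    unfolding openin_prod_topology_alt by meson
  define V0 where "V0 = V1 \<inter> V2"
  define V where "V = V0 \<inter> m_inv G ` V0"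
  have V0: "openin T V0" "\<one> \<in> V0" "V0 \<subseteq> carrier G"
    using V open_subset_carrier[of V1] by (auto simp: V0_def)
  have 1: "openin T V" using V0 openin_inv_image by (simp add: V_def openin_Int)
  have 2: "\<one> \<in> V" using V0 inv_one by (metis IntI V_def image_eqI)
  have carrier: "V \<subseteq> carrier G" using V0 by (auto simp: V_def)
  have inv_mem: "inv x \<in> V" if x: "x \<in> V" for x
  proof -
    obtain y where y: "y \<in> V0" "x = inv y" using x by (auto simp: V_def)
    then have "inv x = y" using V0(3) by auto
    moreover have "x \<in> V0" using x by (simp add: V_def)
    ultimately show ?thesis using y(1) by (auto simp: V_def)
  qed
  have 3: "m_inv G ` V = V"
  proof (intro equalityI subsetI)
    fix x assume "x \<in> V"
    then have "x = inv (inv x)" "inv x \<in> V" using inv_mem carrier by auto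
    then show "x \<in> m_inv G ` V" by (rule image_eqI)
  qed (use inv_mem in auto)
  have 4: "V <#> V \<subseteq> U"
  proof
    fix z assume "z \<in> V <#> V"
    then obtain x y where xy: "x \<in> V" "y \<in> V" "z = x \<otimes> y" by (auto simp: set_mult_def)
    then have "(x, y) \<in> ?W" using V(5) by (auto simp: V_def V0_def)
    then show "z \<in> U" using xy by simp
  qed
  moreover have "V \<subseteq> V <#> V"
  proof
    fix x assume "x \<in> V"
    then show "x \<in> V <#> V" using set_mult_memI[OF _ 2, of x V] carrier by auto
  qed
  ultimately show thesis using that[OF 1 2 3] by blast
qed

lemma compact_finite_translates:
  assumes "compactin T K" "openin T U" "\<one> \<in> U"
  obtains F where "finite F" "F \<subseteq> K" "K \<subseteq> F <#> U"
proof -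
  have "K \<subseteq> \<Union>((\<lambda>x. x <# U) ` K)"
  proof
    fix x assume "x \<in> K"
    then have "x = x \<otimes> \<one>" using compact_subset_carrier[OF assms(1)] by auto
    then show "x \<in> \<Union>((\<lambda>x. x <# U) ` K)" using \<open>x \<in> K\<close> assms(3) by (auto simp: l_coset_def)
  qed
  moreover have "\<forall>V \<in> (\<lambda>x. x <# U) ` K. openin T V"
    using assms openin_l_coset compact_subset_carrier by blast
  ultimately obtain \<F> where "finite \<F>" "\<F> \<subseteq> (\<lambda>x. x <# U) ` K" "K \<subseteq> \<Union>\<F>"
    using assms(1) unfolding compactin_def by meson
  then obtain F where "finite F" "F \<subseteq> K" "\<F> = (\<lambda>x. x <# U) ` F"
    by (meson finite_subset_image)
  then show thesis using that[of F] \<open>K \<subseteq> \<Union>\<F>\<close> by (auto simp: set_mult_def l_coset_def)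
qed

lemma subgroup_closure_of:
  assumes "subgroup H G" shows "subgroup (T closure_of H) G"
proof
  have H: "H \<subseteq> T closure_of H"
    using assms by (simp add: closure_of_subset topspace_eq subgroup.subset)
  show "T closure_of H \<subseteq> carrier G" using closure_of_subset_topspace topspace_eq by metis
  show "\<one> \<in> T closure_of H" using H subgroup.one_closed[OF assms] by blast
  have "(\<lambda>(x, y). x \<otimes> y) ` (prod_topology T T closure_of (H \<times> H)) \<subseteq> T closure_of ((\<lambda>(x, y). x \<otimes> y) ` (H \<times> H))"
    by (rule continuous_map_image_closure_subset[OF mult_continuous])
  moreover have "(\<lambda>(x, y). x \<otimes> y) ` (H \<times> H) \<subseteq> H"
    using subgroup.m_closed[OF assms] by auto
  ultimately show "x \<otimes> y \<in> T closure_of H" if "x \<in> T closure_of H" "y \<in> T closure_of H" for x y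
    using that closure_of_mono[of "(\<lambda>(x, y). x \<otimes> y) ` (H \<times> H)" H T] by (force simp: closure_of_Times)
  have "m_inv G ` (T closure_of H) \<subseteq> T closure_of (m_inv G ` H)"
    by (rule continuous_map_image_closure_subset[OF inv_continuous])
  moreover have "m_inv G ` H \<subseteq> H"
    using subgroup.m_inv_closed[OF assms] by auto
  ultimately show "inv x \<in> T closure_of H" if "x \<in> T closure_of H" for x
    using that closure_of_mono[of "m_inv G ` H" H T] by blast
qed


text \<open>A conjugate of \<open>l \<in> L\<close> is a commutator times \<open>l\<close>.\<close>

lemma normal_of_derived_subset:
  assumes "subgroup L G" "derived G (carrier G) \<subseteq> L"
  shows "L \<lhd> G"
proof (rule normalI[OF assms(1)], intro ballI)
  have conj: "x \<otimes> h \<otimes> inv x \<in> L" if "x \<in> carrier G" "h \<in> L" for x h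
  proof -
    have h: "h \<in> carrier G" using that subgroup.subset[OF assms(1)] by blast
    have "x \<otimes> h \<otimes> inv x \<otimes> inv h \<in> derived G (carrier G)"
      unfolding derived_def using that h by (intro generate.incl) blast
    then have "(x \<otimes> h \<otimes> inv x \<otimes> inv h) \<otimes> h \<in> L"
      using assms that by (meson subgroup.m_closed subsetD)
    then show ?thesis using that h by (simp add: m_assoc)
  qed
  fix x assume "x \<in> carrier G"
  then show "L #> x = x <# L"
    using conj assms(1) normal_inv_iff by (metis normal.coset_eq)
qed

text \<open>Commutators depend continuously on their entries. This keeps the closures of the derived series
  a series with abelian quotients.\<close>

lemma derived_closure_of_subset:
  assumes "H \<subseteq> carrier G"
  shows "derived G (T closure_of H) \<subseteq> T closure_of (derived G H)"
proof -
  have cl: "T closure_of H \<subseteq> carrier G" by (metis closure_of_subset_topspace topspace_eq)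
  let ?c = "\<lambda>(x, y). x \<otimes> y \<otimes> inv x \<otimes> inv y"
  have "continuous_map (prod_topology T T) T (\<lambda>p. fst p \<otimes> snd p \<otimes> inv (fst p) \<otimes> inv (snd p))"
    by (intro continuous_map_mult continuous_map_inv continuous_map_fst continuous_map_snd)
  then have "?c ` (prod_topology T T closure_of (H \<times> H)) \<subseteq> T closure_of (?c ` (H \<times> H))"
    by (intro continuous_map_image_closure_subset) (simp add: case_prod_unfold)
  moreover have "?c ` (H \<times> H) \<subseteq> derived G H"
    unfolding derived_def by (auto intro!: generate.incl)
  ultimately have "?c ` ((T closure_of H) \<times> (T closure_of H)) \<subseteq> T closure_of (derived G H)"
    using closure_of_mono[of "?c ` (H \<times> H)" "derived G H" T] by (auto simp: closure_of_Times)
  then have "derived_set G (T closure_of H) \<subseteq> T closure_of (derived G H)" by auto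
  then show ?thesis
    unfolding derived_def[of G "T closure_of H"]
    by (rule generate_subgroup_incl[OF _ subgroup_closure_of[OF derived_is_subgroup[OF assms]]])
qed

lemma topological_group_subgroup:
  assumes "subgroup H G"
  shows "topological_group (G\<lparr>carrier := H\<rparr>) (subtopology T H)"
proof -
  have sub: "H \<subseteq> carrier G" by (rule subgroup.subset[OF assms])
  interpret H: group "G\<lparr>carrier := H\<rparr>" by (rule subgroup_imp_group[OF assms])
  have inv: "inv\<^bsub>G\<lparr>carrier := H\<rparr>\<^esub> x = inv x" if "x \<in> H" for x
    by (rule m_inv_consistent[OF assms that])
  show ?thesis
  proof
    show "topspace (subtopology T H) = carrier (G\<lparr>carrier := H\<rparr>)" using sub topspace_eq by auto
    show "continuous_map (prod_topology (subtopology T H) (subtopology T H)) (subtopology T H)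
       (\<lambda>(x, y). x \<otimes>\<^bsub>G\<lparr>carrier := H\<rparr>\<^esub> y)"
      using continuous_map_from_subtopology[OF mult_continuous, of "H \<times> H"] subgroup.m_closed[OF assms]
      by (auto simp: continuous_map_in_subtopology subtopology_Times[symmetric])
    have "continuous_map (subtopology T H) T (\<lambda>x. inv\<^bsub>G\<lparr>carrier := H\<rparr>\<^esub> x)"
      by (rule continuous_map_eq[OF continuous_map_from_subtopology[OF inv_continuous]]) (simp add: inv)
    then show "continuous_map (subtopology T H) (subtopology T H) (\<lambda>x. inv\<^bsub>G\<lparr>carrier := H\<rparr>\<^esub> x)"
      using subgroup.m_inv_closed[OF assms] by (auto simp: continuous_map_in_subtopology inv)
  qed
qed

lemma topological_group_discrete: "topological_group G (discrete_topology (carrier G))"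
  by standard (auto simp flip: prod_topology_discrete_topology)

end

section \<open>Almost invariant measures with controlled supports\<close>

abbreviation almost_invariant_in ::
  "('g, 'm) monoid_scheme \<Rightarrow> 'g set \<Rightarrow> real \<Rightarrow> 'g set \<Rightarrow> 'g pmf \<Rightarrow> bool" where
  "almost_invariant_in G K e E \<beta> \<equiv> finite (set_pmf \<beta>) \<and> set_pmf \<beta> \<subseteq> K \<and>
    (\<forall>x\<in>E. tv_close e (map_pmf (\<lambda>y. x \<otimes>\<^bsub>G\<^esub> y) \<beta>) \<beta>)"

text \<open>The quantifier over \<open>E\<close> comes after the choice of \<open>K'\<close>. For the discrete topology compact sets are
  finite, and the property is Reiter's condition for the abstract group.\<close>

definition boundedly_amenable ::
  "('g, 'm) monoid_scheme \<Rightarrow> 'g topology \<Rightarrow> 'g set \<Rightarrow> bool" where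
  "boundedly_amenable G T H \<longleftrightarrow>
    (\<forall>K e. compactin T K \<and> K \<subseteq> H \<and> 0 < e \<longrightarrow>
      (\<exists>K'. compactin T K' \<and> K' \<subseteq> H \<and>
        (\<forall>E. finite E \<and> E \<subseteq> K \<longrightarrow>
          (\<exists>\<beta>. almost_invariant_in G K' e E \<beta>))))"

lemma boundedly_amenableI:
  assumes "\<And>K e. compactin T K \<Longrightarrow> K \<subseteq> H \<Longrightarrow> 0 < e \<Longrightarrow>
    \<exists>K'. compactin T K' \<and> K' \<subseteq> H \<and> (\<forall>E. finite E \<and> E \<subseteq> K \<longrightarrow>
      (\<exists>\<beta>. almost_invariant_in G K' e E \<beta>))"
  shows "boundedly_amenable G T H"
  using assms unfolding boundedly_amenable_def by blast

lemma boundedly_amenableE: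
  assumes "boundedly_amenable G T H" "compactin T K" "K \<subseteq> H" "0 < e"
  obtains K' where "compactin T K'" "K' \<subseteq> H"
    "\<And>E. finite E \<Longrightarrow> E \<subseteq> K \<Longrightarrow>
      \<exists>\<beta>. almost_invariant_in G K' e E \<beta>"
  using assms unfolding boundedly_amenable_def by meson

text \<open>The property depends on the multiplication and on the compact subsets of \<open>H\<close> only, so it may be
  checked in any subgroup containing \<open>H\<close>.\<close>

lemma boundedly_amenable_subtopology:
  assumes "H \<subseteq> S"
  shows "boundedly_amenable (G\<lparr>carrier := C\<rparr>) (subtopology T S) H \<longleftrightarrow> boundedly_amenable G T H"
proof -
  have "compactin (subtopology T S) K \<and> K \<subseteq> H \<longleftrightarrow> compactin T K \<and> K \<subseteq> H" for K
    using assms by (auto simp: compactin_subtopology)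
  then show ?thesis by (simp add: boundedly_amenable_def flip: conj_assoc)
qed

context topological_group
begin

lemma cancel_inv:
  assumes "x \<in> carrier G" "y \<in> carrier G"
  shows "x \<otimes> (inv x \<otimes> y) = y" "inv x \<otimes> (x \<otimes> y) = y"
  using assms by (simp_all add: m_assoc[symmetric])

abbreviation discretely_amenable :: "'g set \<Rightarrow> bool" where
  "discretely_amenable H \<equiv> boundedly_amenable G (discrete_topology (carrier G)) H"

lemma boundedly_amenable_trivial: "boundedly_amenable G T {\<one>}"
proof (rule boundedly_amenableI)
  fix K :: "'g set" and e :: real assume K: "K \<subseteq> {\<one>}" "0 < e"
  show "\<exists>K'. compactin T K' \<and> K' \<subseteq> {\<one>} \<and> (\<forall>E. finite E \<and> E \<subseteq> K \<longrightarrow>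
      (\<exists>\<beta>. almost_invariant_in G K' e E \<beta>))"
  proof (intro exI[of _ "{\<one>}"] conjI allI impI)
    fix E assume "finite E \<and> E \<subseteq> K"
    then show "\<exists>\<beta>. almost_invariant_in G {\<one>} e E \<beta>"
      using K by (intro exI[of _ "return_pmf \<one>"]) (auto simp: tv_close_refl)
  qed (auto simp: topspace_eq)
qed

text \<open>The index type \<open>'i\<close> stands for a set of cosets of \<open>L\<close> with representatives \<open>r i \<in> C\<close>; \<open>t\<close> is the action of
  \<open>x\<close> on the cosets. Thus \<open>\<alpha>\<close> is an almost invariant measure on the cosets; membership in \<open>L\<close> says
  that \<open>x\<close> maps the coset of \<open>r i\<close> to the coset of \<open>r (t i)\<close>.\<close>

abbreviation almost_invariant_modulo ::
  "'g set \<Rightarrow> 'g set \<Rightarrow> real \<Rightarrow> 'g set \<Rightarrow> 'i pmf \<Rightarrow> ('i \<Rightarrow> 'g) \<Rightarrow> bool" where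
  "almost_invariant_modulo L C e E \<alpha> r \<equiv> finite (set_pmf \<alpha>) \<and>
    (\<forall>x\<in>E. \<exists>t. tv_close e (map_pmf t \<alpha>) \<alpha> \<and>
      (\<forall>i\<in>set_pmf \<alpha>. r i \<in> C \<and> r (t i) \<in> C \<and> inv (r (t i)) \<otimes> x \<otimes> r i \<in> L)) \<and>
    r ` set_pmf \<alpha> \<subseteq> C"

text \<open>Almost invariant measures on the cosets and on \<open>L\<close> combine: choose a coset representative \<open>r i\<close> at
  random and multiply it by a random element of \<open>L\<close>. Translation by \<open>x\<close> moves \<open>r i\<close> to \<open>r (t i)\<close> times an element
  \<open>c x i\<close> of \<open>L\<close>. These elements stay in the compact set \<open>M\<close>, which is known before the finite set \<open>E\<close>
  is, and this is what keeps the supports under control.\<close>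

lemma boundedly_amenable_extension:
  fixes H L :: "'g set"
  assumes L: "closedin T L" "L \<subseteq> H" "boundedly_amenable G T L"
    and H: "subgroup H G"
    and quotient: "\<And>K e. compactin T K \<Longrightarrow> K \<subseteq> H \<Longrightarrow> 0 < e \<Longrightarrow>
      \<exists>C. compactin T C \<and> C \<subseteq> H \<and> (\<forall>E. finite E \<longrightarrow> E \<subseteq> K \<longrightarrow>
        (\<exists>(\<alpha> :: 'i pmf) r. almost_invariant_modulo L C e E \<alpha> r))"
  shows "boundedly_amenable G T H"
proof (rule boundedly_amenableI)
  fix K e assume K: "compactin T K" "K \<subseteq> H" and e: "0 < (e :: real)"
  then obtain C where C: "compactin T C" "C \<subseteq> H"
    and \<alpha>_ex: "\<And>E. finite E \<Longrightarrow> E \<subseteq> K \<Longrightarrow> \<exists>(\<alpha> :: 'i pmf) r. almost_invariant_modulo L C (e / 2) E \<alpha> r"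
    using quotient[of K "e / 2"] by auto
  define M where "M = L \<inter> (m_inv G ` C <#> K <#> C)"
  have "compactin T (m_inv G ` C <#> K <#> C)"
    using C K by (intro compactin_set_mult compactin_inv_image)
  then have "compactin T M" unfolding M_def by (rule closed_Int_compactin[OF L(1)])
  moreover have "M \<subseteq> L" by (auto simp: M_def)
  ultimately obtain M' where M': "compactin T M'" "M' \<subseteq> L"
    and \<beta>_ex: "\<And>E. finite E \<Longrightarrow> E \<subseteq> M \<Longrightarrow> \<exists>\<beta>. almost_invariant_in G M' (e / 2) E \<beta>"
    using boundedly_amenableE[OF L(3), of M "e / 2"] e by (metis half_gt_zero)
  have "C <#> M' \<subseteq> H"
  proof
    fix z assume "z \<in> C <#> M'"
    then obtain a b where "a \<in> C" "b \<in> M'" "z = a \<otimes> b" by (auto simp: set_mult_def)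
    then show "z \<in> H" using C(2) M'(2) L(2) subgroup.m_closed[OF H] by blast
  qed
  moreover have "\<exists>\<beta>. almost_invariant_in G (C <#> M') e E \<beta>" if E: "finite E" "E \<subseteq> K" for E
  proof -
    obtain \<alpha> :: "'i pmf" and r where \<alpha>: "finite (set_pmf \<alpha>)" "r ` set_pmf \<alpha> \<subseteq> C"
      and t_ex: "\<forall>x\<in>E. \<exists>t. tv_close (e / 2) (map_pmf t \<alpha>) \<alpha> \<and>
        (\<forall>i\<in>set_pmf \<alpha>. r i \<in> C \<and> r (t i) \<in> C \<and> inv (r (t i)) \<otimes> x \<otimes> r i \<in> L)"
      using \<alpha>_ex[OF E] by blast
    obtain t where t: "\<And>x. x \<in> E \<Longrightarrow> tv_close (e / 2) (map_pmf (t x) \<alpha>) \<alpha>"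
      and tC: "\<And>x i. x \<in> E \<Longrightarrow> i \<in> set_pmf \<alpha> \<Longrightarrow> r i \<in> C \<and> r (t x i) \<in> C \<and> inv (r (t x i)) \<otimes> x \<otimes> r i \<in> L"
      using bchoice[OF t_ex] by blast
    \<comment> \<open>The cocycle of the action on the cosets, relative to the representatives \<open>r\<close>.\<close>
    define c where "c = (\<lambda>x i. inv (r (t x i)) \<otimes> x \<otimes> r i)"
    have cM: "c x i \<in> M" if "x \<in> E" "i \<in> set_pmf \<alpha>" for x i
      using tC[OF that] that(1) E(2) unfolding c_def M_def by (auto intro!: set_mult_memI)
    have "finite ((\<lambda>(x, i). c x i) ` (E \<times> set_pmf \<alpha>))" using E \<alpha> by simp
    moreover have "(\<lambda>(x, i). c x i) ` (E \<times> set_pmf \<alpha>) \<subseteq> M" using cM by auto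
    ultimately obtain \<beta> where \<beta>: "finite (set_pmf \<beta>)" "set_pmf \<beta> \<subseteq> M'"
      and \<beta>c: "\<And>x i. x \<in> E \<Longrightarrow> i \<in> set_pmf \<alpha> \<Longrightarrow> tv_close (e / 2) (map_pmf (\<lambda>y. c x i \<otimes> y) \<beta>) \<beta>"
      using \<beta>_ex[of "(\<lambda>(x, i). c x i) ` (E \<times> set_pmf \<alpha>)"] by fastforce
    have carr: "C \<subseteq> carrier G" "M' \<subseteq> carrier G" "M \<subseteq> carrier G" "K \<subseteq> carrier G"
      using C M' K \<open>compactin T M\<close> compact_subset_carrier by auto
    let ?\<gamma> = "bind_pmf \<alpha> (\<lambda>i. map_pmf (\<lambda>y. r i \<otimes> y) \<beta>)"
    have "tv_close e (map_pmf (\<lambda>y. x \<otimes> y) ?\<gamma>) ?\<gamma>" if x: "x \<in> E" for x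
    proof -
      have "map_pmf (\<lambda>y. x \<otimes> y) ?\<gamma> =
          bind_pmf \<alpha> (\<lambda>i. map_pmf (\<lambda>y. r (t x i) \<otimes> y) (map_pmf (\<lambda>y. c x i \<otimes> y) \<beta>))"
        unfolding map_bind_pmf
      proof (rule bind_pmf_cong[OF refl])
        fix i assume i: "i \<in> set_pmf \<alpha>"
        have *: "r i \<in> carrier G" "r (t x i) \<in> carrier G" "x \<in> carrier G"
          using tC[OF x i] carr x E by auto
        have "x \<otimes> (r i \<otimes> y) = r (t x i) \<otimes> (c x i \<otimes> y)" if "y \<in> set_pmf \<beta>" for y
        proof -
          have "y \<in> carrier G" using that \<beta> carr by blast
          then show ?thesis using * by (simp add: c_def m_assoc cancel_inv)
        qed
        then show "map_pmf (\<lambda>y. x \<otimes> y) (map_pmf (\<lambda>y. r i \<otimes> y) \<beta>) =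
            map_pmf (\<lambda>y. r (t x i) \<otimes> y) (map_pmf (\<lambda>y. c x i \<otimes> y) \<beta>)"
          by (auto simp: pmf.map_comp o_def intro!: map_pmf_cong)
      qed
      moreover have "tv_close (e / 2) \<dots> (bind_pmf \<alpha> (\<lambda>i. map_pmf (\<lambda>y. r (t x i) \<otimes> y) \<beta>))"
        by (intro tv_close_bind_kernel tv_close_map \<beta>c x)
      moreover have "bind_pmf \<alpha> (\<lambda>i. map_pmf (\<lambda>y. r (t x i) \<otimes> y) \<beta>) =
          bind_pmf (map_pmf (t x) \<alpha>) (\<lambda>i. map_pmf (\<lambda>y. r i \<otimes> y) \<beta>)"
        by (simp add: bind_map_pmf)
      moreover have "tv_close (e / 2) \<dots> ?\<gamma>" by (intro tv_close_bind t x)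
      ultimately show ?thesis using tv_close_trans[of "e / 2" _ _ "e / 2"] by simp
    qed
    moreover have "finite (set_pmf ?\<gamma>)" using \<alpha> \<beta> by auto
    moreover have "set_pmf ?\<gamma> \<subseteq> C <#> M'"
      using \<alpha> \<beta> by (auto intro!: set_mult_memI)
    ultimately show ?thesis by blast
  qed
  moreover have "compactin T (C <#> M')" using C M' compactin_set_mult by blast
  ultimately show "\<exists>K'. compactin T K' \<and> K' \<subseteq> H \<and> (\<forall>E. finite E \<and> E \<subseteq> K \<longrightarrow>
      (\<exists>\<beta>. almost_invariant_in G K' e E \<beta>))" by blast
qed

text \<open>Folding back: almost invariant measures on \<open>H\<close> itself, with supports anywhere, serve on the
  cosets of \<open>L\<close>, because every coset has a representative \<open>c z\<close> in the compact set \<open>C\<close>.\<close>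

lemma boundedly_amenable_cocompact:
  assumes L: "subgroup L G" "closedin T L" "L \<subseteq> H" "boundedly_amenable G T L"
    and H: "subgroup H G" "discretely_amenable H"
    and C: "compactin T C" "C \<subseteq> H" "H \<subseteq> C <#> L"
  shows "boundedly_amenable G T H"
proof (rule boundedly_amenable_extension[where 'i = 'g, OF L(2,3,4) H(1)])
  fix K :: "'g set" and e :: real assume K: "compactin T K" "K \<subseteq> H" and e: "0 < e"
  have sub: "H \<subseteq> carrier G" by (rule subgroup.subset[OF H(1)])
  have "\<exists>c. c \<in> C \<and> inv c \<otimes> z \<in> L" if z: "z \<in> H" for z
  proof -
    obtain c l where cl: "c \<in> C" "l \<in> L" "z = c \<otimes> l" using z C(3) by (auto simp: set_mult_def)
    then have "c \<in> carrier G" "l \<in> carrier G" using C(2) L(3) sub by auto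
    then have "inv c \<otimes> z = l" using cl by (simp add: m_assoc[symmetric])
    then show ?thesis using cl by auto
  qed
  then obtain c where c: "\<And>z. z \<in> H \<Longrightarrow> c z \<in> C" "\<And>z. z \<in> H \<Longrightarrow> inv (c z) \<otimes> z \<in> L"
    by metis
  have cocycle: "inv (c (x \<otimes> z)) \<otimes> x \<otimes> c z \<in> L" if "x \<in> H" "z \<in> H" for x z
  proof -
    have xz: "x \<otimes> z \<in> H" using that subgroup.m_closed[OF H(1)] by blast
    have carr: "x \<in> carrier G" "z \<in> carrier G" "c z \<in> carrier G" "c (x \<otimes> z) \<in> carrier G"
      using that xz c(1) C(2) sub by blast+
    have "(inv (c (x \<otimes> z)) \<otimes> (x \<otimes> z)) \<otimes> inv (inv (c z) \<otimes> z) \<in> L"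
      using c(2)[OF xz] c(2)[OF that(2)] L(1) by (simp add: subgroup.m_closed subgroup.m_inv_closed)
    moreover have "(inv (c (x \<otimes> z)) \<otimes> (x \<otimes> z)) \<otimes> inv (inv (c z) \<otimes> z) = inv (c (x \<otimes> z)) \<otimes> x \<otimes> c z"
      using carr by (simp add: inv_mult_group m_assoc cancel_inv)
    ultimately show ?thesis by simp
  qed
  have "\<exists>(\<alpha> :: 'g pmf) r. almost_invariant_modulo L C e E \<alpha> r"
    if E: "finite E" "E \<subseteq> K" for E
  proof -
    have E': "compactin (discrete_topology (carrier G)) E" "E \<subseteq> H"
      using E K sub by (auto simp: compactin_discrete_topology)
    obtain M where M: "M \<subseteq> H" and M_ex: "\<And>E'. finite E' \<Longrightarrow> E' \<subseteq> E \<Longrightarrow>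
      \<exists>\<beta>. almost_invariant_in G M e E' \<beta>"
      by (rule boundedly_amenableE[OF H(2) E' e]) blast
    obtain \<alpha> where \<alpha>0: "finite (set_pmf \<alpha>)" "set_pmf \<alpha> \<subseteq> M"
        "\<forall>x\<in>E. tv_close e (map_pmf (\<lambda>y. x \<otimes> y) \<alpha>) \<alpha>"
      using M_ex[OF E(1) order_refl] by (elim exE conjE)
    note \<alpha> = \<alpha>0(1) order_trans[OF \<alpha>0(2) M] \<alpha>0(3)
    show ?thesis
    proof (rule exI[of _ \<alpha>], rule exI[of _ c], intro conjI ballI)
      fix x assume x: "x \<in> E"
      have xH: "x \<in> H" using x E' by blast
      show "\<exists>t. tv_close e (map_pmf t \<alpha>) \<alpha> \<and>
          (\<forall>i\<in>set_pmf \<alpha>. c i \<in> C \<and> c (t i) \<in> C \<and> inv (c (t i)) \<otimes> x \<otimes> c i \<in> L)"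
        using \<alpha>(2,3) x xH cocycle c(1) subgroup.m_closed[OF H(1)]
        by (intro exI[of _ "\<lambda>y. x \<otimes> y"]) (auto simp: subset_iff)
    qed (use \<alpha>(1,2) c(1) in \<open>auto simp: subset_iff\<close>)
  qed
  with C(1,2) show "\<exists>C. compactin T C \<and> C \<subseteq> H \<and> (\<forall>E. finite E \<longrightarrow> E \<subseteq> K \<longrightarrow>
        (\<exists>(\<alpha> :: 'g pmf) r. almost_invariant_modulo L C e E \<alpha> r))"
    by (intro exI[of _ C]) simp
qed

definition adjoin :: "'g \<Rightarrow> 'g set \<Rightarrow> 'g set" where
  "adjoin f L = (\<Union>i::int. (f [^] i) <# L)"

lemma adjoin_iff:
  "x \<in> adjoin f L \<longleftrightarrow> (\<exists>i::int. \<exists>l\<in>L. x = f [^] i \<otimes> l)"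
  by (auto simp: adjoin_def l_coset_def)

lemma conj_normal:
  assumes "L \<lhd> G" "x \<in> carrier G" "l \<in> L"
  shows "inv x \<otimes> l \<otimes> x \<in> L"
  using normal.inv_op_closed1[OF assms(1,2,3)] .

lemma subgroup_adjoin:
  assumes L: "L \<lhd> G" and f: "f \<in> carrier G"
  shows "subgroup (adjoin f L) G" "L \<subseteq> adjoin f L" "f \<in> adjoin f L"
proof -
  interpret L: normal L G by (rule L)
  show sub: "L \<subseteq> adjoin f L"
  proof
    fix x assume "x \<in> L"
    moreover have "x = f [^] (0::int) \<otimes> x" using \<open>x \<in> L\<close> L.subset by auto
    ultimately show "x \<in> adjoin f L" unfolding adjoin_iff by blast
  qed
  have "f = f [^] (1::int) \<otimes> \<one>" using f by (simp add: int_pow_1)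
  then show "f \<in> adjoin f L" unfolding adjoin_iff using L.one_closed by blast
  show "subgroup (adjoin f L) G"
  proof
    show "adjoin f L \<subseteq> carrier G" using f L.subset by (auto simp: adjoin_iff)
    show "\<one> \<in> adjoin f L" using sub L.one_closed by blast
  next
    fix x y assume "x \<in> adjoin f L" "y \<in> adjoin f L"
    then obtain i j :: int and l k where *: "l \<in> L" "k \<in> L" "x = f [^] i \<otimes> l" "y = f [^] j \<otimes> k"
      unfolding adjoin_iff by blast
    have c: "l \<in> carrier G" "k \<in> carrier G" using * L.subset by auto
    have "x \<otimes> y = f [^] (i + j) \<otimes> ((inv (f [^] j) \<otimes> l \<otimes> f [^] j) \<otimes> k)"
      using * c f by (simp add: int_pow_mult m_assoc cancel_inv)
    moreover have "(inv (f [^] j) \<otimes> l \<otimes> f [^] j) \<otimes> k \<in> L"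
      using conj_normal[OF L, of "f [^] j" l] * f L.m_closed by simp
    ultimately show "x \<otimes> y \<in> adjoin f L" unfolding adjoin_iff by blast
  next
    fix x assume "x \<in> adjoin f L"
    then obtain i :: int and l where *: "l \<in> L" "x = f [^] i \<otimes> l" unfolding adjoin_iff by blast
    have c: "l \<in> carrier G" using * L.subset by auto
    have "inv x = f [^] (- i) \<otimes> (f [^] i \<otimes> inv l \<otimes> inv (f [^] i))"
      using * c f by (simp add: inv_mult_group int_pow_neg m_assoc cancel_inv)
    moreover have "f [^] i \<otimes> inv l \<otimes> inv (f [^] i) \<in> L"
      using L.inv_op_closed2[of "f [^] i" "inv l"] * f L.m_inv_closed by simp
    ultimately show "inv x \<in> adjoin f L" unfolding adjoin_iff by blast
  qed
qed

text \<open>On the cosets \<open>f^j L\<close> with \<open>0 \<le> j < n\<close> the uniform measure is almost invariant. The integer \<open>n\<close>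
  depends only on the largest shift \<open>m\<close> that occurs in \<open>K\<close>, and not on \<open>E\<close>.\<close>

lemma boundedly_amenable_adjoin:
  assumes L: "L \<lhd> G" "closedin T L" "boundedly_amenable G T L" and f: "f \<in> carrier G"
    and discrete: "\<And>K. compactin T K \<Longrightarrow> K \<subseteq> adjoin f L \<Longrightarrow> \<exists>m::nat. \<forall>x\<in>K. \<exists>i::int. \<bar>i\<bar> \<le> int m \<and> x \<in> f [^] i <# L"
  shows "boundedly_amenable G T (adjoin f L)"
proof (rule boundedly_amenable_extension[where 'i = int, OF L(2) _ L(3)])
  interpret L: normal L G by (rule L(1))
  show "L \<subseteq> adjoin f L" "subgroup (adjoin f L) G" using subgroup_adjoin[OF L(1) f] by auto
  have pow: "f [^] (i::int) \<in> adjoin f L" for i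
  proof -
    have "f [^] i = f [^] i \<otimes> \<one>" using f by simp
    then show ?thesis unfolding adjoin_iff using L.one_closed by blast
  qed
  fix K :: "'g set" and e :: real assume K: "compactin T K" "K \<subseteq> adjoin f L" and e: "0 < e"
  then obtain m :: nat where m: "\<forall>x\<in>K. \<exists>i::int. \<bar>i\<bar> \<le> int m \<and> x \<in> f [^] i <# L"
    using discrete by blast
  then obtain i :: "'g \<Rightarrow> int" where i: "\<And>x. x \<in> K \<Longrightarrow> \<bar>i x\<bar> \<le> int m" "\<And>x. x \<in> K \<Longrightarrow> x \<in> f [^] i x <# L"
    by metis
  obtain n :: nat where n: "2 * real m / e < n" using reals_Archimedean2 by blast
  then have n0: "0 < n" using e by (cases n) (auto simp: field_simps not_less)
  have ne: "2 * real m / n \<le> e" using n n0 e by (simp add: field_simps)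
  define C where "C = (\<lambda>j::int. f [^] j) ` {- int (m + n)..int (m + n)}"
  define \<alpha> where "\<alpha> = map_pmf int (pmf_of_set {..<n})"
  have set\<alpha>: "set_pmf \<alpha> = int ` {..<n}" using n0 by (simp add: \<alpha>_def lessThan_empty_iff)
  have C: "f [^] j \<in> C" if "\<bar>j\<bar> \<le> int (m + n)" for j :: int
    using that by (auto simp: C_def abs_le_iff)
  have close: "tv_close e (map_pmf (\<lambda>j. i x + j) \<alpha>) \<alpha>" if x: "x \<in> K" for x
  proof -
    have "2 * \<bar>real_of_int (i x)\<bar> / n \<le> 2 * real m / n"
      using i(1)[OF x] by (intro divide_right_mono) (auto simp flip: of_int_abs)
    then show ?thesis
      using tv_close_mono[OF tv_close_uniform_shift[OF n0, of "i x" id]] ne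
      by (simp add: \<alpha>_def pmf.map_comp o_def)
  qed
  have mem: "inv (f [^] (i x + j)) \<otimes> x \<otimes> f [^] j \<in> L" if x: "x \<in> K" for x and j :: int
  proof -
    obtain l where l: "l \<in> L" "x = f [^] i x \<otimes> l" using i(2)[OF x] by (auto simp: l_coset_def)
    have "l \<in> carrier G" using l L.subset by auto
    then have "inv (f [^] (i x + j)) \<otimes> (f [^] i x \<otimes> l) \<otimes> f [^] j = inv (f [^] j) \<otimes> l \<otimes> f [^] j"
      using f by (simp add: int_pow_mult inv_mult_group m_assoc cancel_inv)
    moreover have "\<dots> \<in> L" using conj_normal[OF L(1) _ l(1)] f by simp
    ultimately show ?thesis using l by simp
  qed
  have "\<exists>(\<alpha> :: int pmf) r. almost_invariant_modulo L C e E \<alpha> r"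
    if E: "finite E" "E \<subseteq> K" for E
  proof (intro exI[of _ \<alpha>] exI[of _ "\<lambda>j. f [^] j"] conjI ballI)
    fix x assume "x \<in> E"
    then have x: "x \<in> K" using E by blast
    show "\<exists>t. tv_close e (map_pmf t \<alpha>) \<alpha> \<and>
          (\<forall>j\<in>set_pmf \<alpha>. f [^] j \<in> C \<and> f [^] (t j) \<in> C \<and> inv (f [^] (t j)) \<otimes> x \<otimes> f [^] j \<in> L)"
      using i(1)[OF x] by (intro exI[of _ "\<lambda>j. i x + j"] conjI close x ballI mem C) (auto simp: set\<alpha>)
  qed (auto simp: set\<alpha> intro!: C)
  moreover have "compactin T C"
    by (rule finite_imp_compactin) (use f in \<open>auto simp: C_def topspace_eq\<close>)
  moreover have "C \<subseteq> adjoin f L" using pow by (auto simp: C_def)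
  ultimately show "\<exists>C. compactin T C \<and> C \<subseteq> adjoin f L \<and> (\<forall>E. finite E \<longrightarrow> E \<subseteq> K \<longrightarrow>
        (\<exists>(\<alpha> :: int pmf) r. almost_invariant_modulo L C e E \<alpha> r))"
    by blast
qed

end

section \<open>Solvable groups without topology, and locally compact groups\<close>

context topological_group
begin

text \<open>Without topology the finitely many elements of \<open>E\<close> can be adjoined to \<open>L\<close> one at a time.\<close>

lemma discretely_amenable_abelian_extension:
  assumes H: "subgroup H G" and L: "subgroup L G" "L \<subseteq> H" "derived G H \<subseteq> L" "discretely_amenable L"
  shows "discretely_amenable H"
proof -
  let ?G = "G\<lparr>carrier := H\<rparr>" and ?D = "discrete_topology H"
  interpret D: topological_group G "discrete_topology (carrier G)" by (rule topological_group_discrete)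
  have sub: "H \<subseteq> carrier G" by (rule subgroup.subset[OF H])
  have top: "subtopology (discrete_topology (carrier G)) H = ?D"
    using sub by (simp add: subtopology_discrete_topology Int_absorb1)
  interpret H: topological_group ?G ?D
    using D.topological_group_subgroup[OF H] unfolding top .
  have amen_iff: "boundedly_amenable ?G ?D M \<longleftrightarrow> discretely_amenable M" if "M \<subseteq> H" for M
    using boundedly_amenable_subtopology[OF that, where G = G and C = H and T = "discrete_topology (carrier G)"]
    unfolding top .
  have L': "subgroup L ?G" "derived ?G (carrier ?G) \<subseteq> L"
    using subgroup_incl[OF L(1) H L(2)] derived_consistent[OF order_refl H] L by simp_all
  have "\<exists>M. subgroup M ?G \<and> L \<subseteq> M \<and> F \<subseteq> M \<and> boundedly_amenable ?G ?D M" if "finite F" "F \<subseteq> H" for F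
    using that
  proof (induction F rule: finite_induct)
    case empty
    then show ?case using L' L amen_iff by blast
  next
    case (insert f F)
    then obtain M where M: "subgroup M ?G" "L \<subseteq> M" "F \<subseteq> M" "boundedly_amenable ?G ?D M" by auto
    have N: "M \<lhd> ?G" using M L' by (intro H.normal_of_derived_subset) auto
    have f: "f \<in> carrier ?G" using insert by simp
    have "M \<subseteq> H" using subgroup.subset[OF M(1)] by simp
    have "boundedly_amenable ?G ?D (H.adjoin f M)"
    proof (rule H.boundedly_amenable_adjoin[OF N _ M(4) f])
      fix K assume "compactin ?D K" and K: "K \<subseteq> H.adjoin f M"
      then have "finite K" by (simp add: compactin_discrete_topology)
      obtain i where i: "\<And>x. x \<in> K \<Longrightarrow> x \<in> f [^]\<^bsub>?G\<^esub> (i x :: int) <#\<^bsub>?G\<^esub> M"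
        using K unfolding H.adjoin_def by (metis (no_types, lifting) UN_E subsetD)
      have "\<bar>i x\<bar> \<le> int (\<Sum>y\<in>K. nat \<bar>i y\<bar>)" if "x \<in> K" for x
        using member_le_sum[OF that, of "\<lambda>y. \<bar>i y\<bar>"] \<open>finite K\<close> by simp
      then show "\<exists>m::nat. \<forall>x\<in>K. \<exists>i::int. \<bar>i\<bar> \<le> int m \<and> x \<in> f [^]\<^bsub>?G\<^esub> i <#\<^bsub>?G\<^esub> M"
        using i by blast
    qed (use \<open>M \<subseteq> H\<close> in simp)
    then show ?case using H.subgroup_adjoin[OF N f] M by blast
  qed
  then show ?thesis
  proof (intro boundedly_amenableI)
    fix K e assume ex: "\<And>F. finite F \<Longrightarrow> F \<subseteq> H \<Longrightarrow> \<exists>M. subgroup M ?G \<and> L \<subseteq> M \<and> F \<subseteq> M \<and> boundedly_amenable ?G ?D M"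
      and K: "compactin (discrete_topology (carrier G)) K" "K \<subseteq> H" and e: "0 < (e :: real)"
    have "finite K" using K by (simp add: compactin_discrete_topology)
    then obtain M where M: "subgroup M ?G" "K \<subseteq> M" "boundedly_amenable ?G ?D M" using ex K by blast
    have "M \<subseteq> H" using subgroup.subset[OF M(1)] by simp
    then have "discretely_amenable M" using M amen_iff by blast
    from boundedly_amenableE[OF this K(1) M(2) e] \<open>M \<subseteq> H\<close>
    show "\<exists>K'. compactin (discrete_topology (carrier G)) K' \<and> K' \<subseteq> H \<and> (\<forall>E. finite E \<and> E \<subseteq> K \<longrightarrow>
      (\<exists>\<beta>. almost_invariant_in G K' e E \<beta>))"
      by (metis (no_types, lifting) order_trans)
  qed
qed

lemma derived_series_reaches_one:
  assumes B: "subgroup B G" "solvable (G\<lparr>carrier := B\<rparr>)"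
  obtains n where "(derived G ^^ n) B = {\<one>}"
proof -
  let ?G = "G\<lparr>carrier := B\<rparr>"
  interpret B: group ?G by (rule subgroup_imp_group[OF B(1)])
  have "(derived ?G ^^ n) B = (derived G ^^ n) B \<and> (derived G ^^ n) B \<subseteq> B" for n
  proof (induction n)
    case (Suc n)
    then show ?case
      using derived_consistent[OF _ B(1), of "(derived G ^^ n) B"] derived_incl[OF _ B(1), of "(derived G ^^ n) B"]
      by simp
  qed simp
  then show thesis
    using that B(2) unfolding B.solvable_iff_trivial_derived_seq by auto
qed

lemma closed_derived_series_induct:
  assumes T1: "closedin T {\<one>}"
    and B: "subgroup B G" "closedin T B" "(derived G ^^ n) B = {\<one>}"
    and trivial: "P {\<one>}"
    and step: "\<And>N H. subgroup N G \<Longrightarrow> closedin T N \<Longrightarrow> subgroup H G \<Longrightarrow> closedin T H \<Longrightarrow>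
      N \<subseteq> H \<Longrightarrow> H \<subseteq> B \<Longrightarrow> derived G H \<subseteq> N \<Longrightarrow> P N \<Longrightarrow> P H"
  shows "P B"
proof -
  define N where "N = (\<lambda>i. T closure_of ((derived G ^^ i) B))"
  have sg: "subgroup ((derived G ^^ i) B) G" for i
    by (rule exp_of_derived_is_subgroup[OF B(1)])
  have der_sub: "derived G ((derived G ^^ i) B) \<subseteq> (derived G ^^ i) B" for i
    using derived_incl[OF order_refl sg] .
  have "(derived G ^^ i) B \<subseteq> B" for i
    by (induction i) (use der_sub in auto)
  then have N: "subgroup (N i) G" "closedin T (N i)" "N i \<subseteq> B" for i
    unfolding N_def using sg B(2) by (auto simp: subgroup_closure_of closure_of_minimal)
  have "P (N i)" if "i \<le> n" for i
    using that
  proof (induction rule: inc_induct)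
    case base
    then show ?case using B(3) trivial T1 by (simp add: N_def closure_of_closedin)
  next
    case (step i)
    have "N (Suc i) \<subseteq> N i" unfolding N_def by (intro closure_of_mono) (simp add: der_sub)
    moreover have "derived G (N i) \<subseteq> N (Suc i)"
      using derived_closure_of_subset[OF subgroup.subset[OF sg]] by (simp add: N_def)
    ultimately show ?case using assms(6)[of "N (Suc i)" "N i"] N step by blast
  qed
  then have "P (N 0)" by simp
  then show ?thesis using B(2) by (simp add: N_def closure_of_closedin)
qed

text \<open>The derived series is used in the discrete topology, where every subgroup is closed.\<close>

lemma discretely_amenable_solvable:
  assumes B: "subgroup B G" "(derived G ^^ n) B = {\<one>}" and H: "subgroup H G" "H \<subseteq> B"
  shows "discretely_amenable H"
proof -
  interpret D: topological_group G "discrete_topology (carrier G)" by (rule topological_group_discrete)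
  have "(derived G ^^ n) H = {\<one>}"
    using mono_exp_of_derived[OF H(2), of n] B(2) subgroup.one_closed[OF exp_of_derived_is_subgroup[OF H(1)], of n]
    by blast
  then show ?thesis
    by (rule D.closed_derived_series_induct[rotated 3])
      (use H D.boundedly_amenable_trivial subgroup.subset[OF H(1)] discretely_amenable_abelian_extension in auto)
qed

end

locale locally_compact_group = topological_group +
  assumes Hausdorff: "Hausdorff_space T"
    and locally_compact: "locally_compact_space T"
begin

lemma compact_neighbourhood_one:
  obtains U K where "openin T U" "compactin T K" "\<one> \<in> U" "U \<subseteq> K"
  using locally_compact unfolding locally_compact_space_def topspace_eq by blast

lemma compactin_imp_closed: "compactin T K \<Longrightarrow> closedin T K"
  by (rule compactin_imp_closedin[OF Hausdorff])

text \<open>Locally compact Hausdorff spaces are compactly generated.\<close>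

lemma closedin_iff_compact_traces:
  assumes "A \<subseteq> carrier G" "\<And>K. compactin T K \<Longrightarrow> compactin T (K \<inter> A)"
  shows "closedin T A"
proof -
  have "k_space T" using locally_compact Hausdorff by (simp add: locally_compact_imp_k_space)
  then show ?thesis
    unfolding k_space using assms compactin_imp_closed
    by (simp add: closedin_subset_topspace topspace_eq)
qed

lemma closedin_compact_set_mult:
  assumes C: "compactin T C" and L: "closedin T L"
  shows "closedin T (C <#> L)"
proof (rule closedin_iff_compact_traces)
  have carr: "C \<subseteq> carrier G" "L \<subseteq> carrier G"
    using compact_subset_carrier[OF C] closedin_subset[OF L] topspace_eq by simp_all
  then show "C <#> L \<subseteq> carrier G" by (rule set_mult_closed)
  fix K assume K: "compactin T K"
  have "K \<inter> (C <#> L) = K \<inter> (C <#> (L \<inter> (m_inv G ` C <#> K)))"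
  proof (intro equalityI subsetI)
    fix x assume x: "x \<in> K \<inter> (C <#> L)"
    then obtain c l where cl: "c \<in> C" "l \<in> L" "x = c \<otimes> l" by (auto simp: set_mult_def)
    then have "l = inv c \<otimes> x" using carr by (auto simp: cancel_inv subsetD)
    moreover have "inv c \<otimes> x \<in> m_inv G ` C <#> K" using cl(1) x by (intro set_mult_memI) auto
    ultimately have "l \<in> m_inv G ` C <#> K" by simp
    then show "x \<in> K \<inter> (C <#> (L \<inter> (m_inv G ` C <#> K)))" using cl x by (auto intro!: set_mult_memI)
  qed (auto simp: set_mult_def)
  moreover have "compactin T (L \<inter> (m_inv G ` C <#> K))"
    using C K by (intro closed_Int_compactin[OF L] compactin_set_mult compactin_inv_image)
  ultimately show "compactin T (K \<inter> (C <#> L))"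
    using C K compactin_imp_closed by (metis closed_Int_compactin compactin_set_mult)
qed

end

section \<open>Cyclic subgroups of a locally compact group modulo a closed normal subgroup\<close>

context topological_group
begin

lemma saturation_mult:
  assumes L: "L \<lhd> G" and AB: "A \<subseteq> carrier G" "B \<subseteq> carrier G"
    and xy: "x \<in> A <#> L" "y \<in> B <#> L"
  shows "x \<otimes> y \<in> (A <#> B) <#> L"
proof -
  interpret L: normal L G by (rule L)
  obtain a l b k where *: "a \<in> A" "l \<in> L" "x = a \<otimes> l" "b \<in> B" "k \<in> L" "y = b \<otimes> k"
    using xy unfolding set_mult_def by blast
  then have c: "a \<in> carrier G" "l \<in> carrier G" "b \<in> carrier G" "k \<in> carrier G"
    using AB L.subset by auto
  have "x \<otimes> y = (a \<otimes> b) \<otimes> ((inv b \<otimes> l \<otimes> b) \<otimes> k)"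
    using * c by (simp add: m_assoc cancel_inv)
  moreover have "(inv b \<otimes> l \<otimes> b) \<otimes> k \<in> L"
    using conj_normal[OF L c(3) *(2)] *(5) L.m_closed by blast
  ultimately show ?thesis using * by (auto intro!: set_mult_memI)
qed

lemma saturation_inv:
  assumes L: "L \<lhd> G" and A: "A \<subseteq> carrier G" and x: "x \<in> A <#> L"
  shows "inv x \<in> (m_inv G ` A) <#> L"
proof -
  interpret L: normal L G by (rule L)
  obtain a l where *: "a \<in> A" "l \<in> L" "x = a \<otimes> l"
    using x unfolding set_mult_def by blast
  then have c: "a \<in> carrier G" "l \<in> carrier G" using A L.subset by auto
  have "inv x = inv a \<otimes> (a \<otimes> inv l \<otimes> inv a)"
    using * c by (simp add: m_assoc cancel_inv inv_mult_group)
  moreover have "a \<otimes> inv l \<otimes> inv a \<in> L"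
    using L.inv_op_closed2[OF c(1), of "inv l"] *(2) L.m_inv_closed by blast
  ultimately show ?thesis using * by (auto intro!: set_mult_memI)
qed

lemma saturation_mono: "A \<subseteq> B \<Longrightarrow> A <#> L \<subseteq> B <#> L"
  by (auto simp: set_mult_def)

lemma subset_saturation:
  assumes "subgroup L G" "A \<subseteq> carrier G" shows "A \<subseteq> A <#> L"
proof
  fix a assume "a \<in> A"
  then have "a = a \<otimes> \<one>" using assms by auto
  then show "a \<in> A <#> L" using \<open>a \<in> A\<close> subgroup.one_closed[OF assms(1)] by (metis set_mult_memI)
qed

text \<open>Two powers of \<open>f\<close> that lie in the same small translate modulo \<open>L\<close> have a quotient close to \<open>L\<close>. An
  infinite set of exponents provides quotients with arbitrarily large exponents.\<close>

lemma power_recurrence: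
  fixes K :: "'g set" and M :: int
  assumes L: "L \<lhd> G" and f: "f \<in> carrier G"
    and K: "compactin T K" "infinite {i::int. f [^] i \<in> K <#> L}"
    and U: "openin T U" "\<one> \<in> U"
  obtains n where "M \<le> n" "f [^] n \<in> U <#> L"
proof -
  obtain V where V: "openin T V" "\<one> \<in> V" "m_inv G ` V = V" "V <#> V \<subseteq> U" "V \<subseteq> U"
    using symmetric_square_root_neighbourhood[OF U] by blast
  have Vc: "V \<subseteq> carrier G" using V open_subset_carrier by blast
  obtain F where F: "finite F" "F \<subseteq> K" "K \<subseteq> F <#> V"
    using compact_finite_translates[OF K(1) V(1,2)] by blast
  have Fc: "F \<subseteq> carrier G" using F K compact_subset_carrier by blast
  have "{i::int. f [^] i \<in> K <#> L} \<subseteq> (\<Union>x\<in>F. {i. f [^] i \<in> (x <# V) <#> L})"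
    using F(3) by (fastforce simp: set_mult_def l_coset_def)
  then obtain x where x: "x \<in> F" "infinite {i::int. f [^] i \<in> (x <# V) <#> L}"
    using K(2) F(1) by (meson finite_UN finite_subset)
  define I where "I = {i::int. f [^] i \<in> (x <# V) <#> L}"
  have xc: "x \<in> carrier G" using x Fc by blast
  have xVc: "x <# V \<subseteq> carrier G" using xc Vc by (rule l_coset_subset_G[rotated])
  obtain i where i: "i \<in> I" using x(2) unfolding I_def[symmetric] by (metis finite.emptyI equals0I)
  have "\<not> I \<subseteq> {i - \<bar>M\<bar>..i + \<bar>M\<bar>}"
    using x(2) unfolding I_def[symmetric] by (meson finite_atLeastAtMost_int finite_subset)
  then obtain j where j: "j \<in> I" "\<bar>j - i\<bar> > \<bar>M\<bar>" by fastforce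
  have diff: "f [^] (b - a) \<in> U <#> L" if "a \<in> I" "b \<in> I" for a b :: int
  proof -
    have "inv (f [^] a) \<otimes> f [^] b \<in> (m_inv G ` (x <# V) <#> (x <# V)) <#> L"
      using that xVc unfolding I_def by (intro saturation_mult[OF L] saturation_inv[OF L]) auto
    moreover have "m_inv G ` (x <# V) <#> (x <# V) \<subseteq> V <#> V"
    proof
      fix z assume "z \<in> m_inv G ` (x <# V) <#> (x <# V)"
      then obtain v w where vw: "v \<in> V" "w \<in> V" "z = inv (x \<otimes> v) \<otimes> (x \<otimes> w)"
        unfolding set_mult_def l_coset_def by blast
      then have "z = inv v \<otimes> w" using Vc xc by (simp add: inv_mult_group m_assoc cancel_inv subsetD)
      moreover have "inv v \<in> V" using vw V(3) by blast
      ultimately show "z \<in> V <#> V" using vw by (auto intro!: set_mult_memI)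
    qed
    moreover have "inv (f [^] a) \<otimes> f [^] b = f [^] (b - a)"
      using f by (metis add.commute diff_conv_add_uminus int_pow_mult int_pow_neg)
    ultimately show ?thesis using V(4) saturation_mono by (metis subset_iff)
  qed
  show thesis
  proof (cases "j \<ge> i")
    case True
    then show thesis using that[of "j - i"] diff[OF i j(1)] j(2) by simp
  next
    case False
    then show thesis using that[of "i - j"] diff[OF j(1) i] j(2) by simp
  qed
qed

end

context locally_compact_group
begin

text \<open>The dichotomy for cyclic subgroups of a locally compact group, modulo \<open>L\<close>. If powers of \<open>f\<close> recur,
  the part of the closure of the group generated by \<open>f\<close> and \<open>L\<close> inside a compact neighbourhood of the identity is
  covered by finitely many translates \<open>f^n U L\<close> with \<open>n > 0\<close>. Hence a return of the powers of \<open>f\<close> to \<open>U L\<close> is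
  preceded by another return at most \<open>M\<close> steps earlier, so that the gaps between returns are bounded.\<close>

lemma cyclic_discrete_or_cocompact:
  assumes L: "L \<lhd> G" and f: "f \<in> carrier G"
    and K: "compactin T K" "infinite {i::int. f [^] i \<in> K <#> L}"
  obtains C where "compactin T C" "\<And>i::int. f [^] i \<in> C <#> L"
proof -
  interpret L: normal L G by (rule L)
  obtain W V where WV: "openin T W" "compactin T V" "\<one> \<in> W" "W \<subseteq> V"
    by (rule compact_neighbourhood_one)
  obtain U where U: "openin T U" "\<one> \<in> U" "m_inv G ` U = U" "U <#> U \<subseteq> W" "U \<subseteq> W"
    using symmetric_square_root_neighbourhood[OF WV(1,3)] by blast
  obtain U2 where U2: "openin T U2" "\<one> \<in> U2" "m_inv G ` U2 = U2" "U2 <#> U2 \<subseteq> U" "U2 \<subseteq> U"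
    using symmetric_square_root_neighbourhood[OF U(1,2)] by blast
  have Uc: "U \<subseteq> carrier G" "U2 \<subseteq> carrier G" using U U2 open_subset_carrier by auto
  note rec = power_recurrence[OF L f K]
  define Q where "Q = V \<inter> T closure_of (adjoin f L)"
  have "compactin T Q" unfolding Q_def using WV(2) by (metis closed_Int_compactin closedin_closure_of inf_commute)
  define S where "S = (\<lambda>n::nat. f [^] int n <# (U <#> L))"
  have S: "openin T (S n)" for n
    unfolding S_def using f U L.subset by (intro openin_l_coset openin_set_mult_left) auto
  have "\<exists>n>0. y \<in> S n" if "y \<in> Q" for y
  proof -
    have y: "y \<in> T closure_of (adjoin f L)" "y \<in> carrier G"
      using that compact_subset_carrier[OF \<open>compactin T Q\<close>] by (auto simp: Q_def)
    have "openin T (y <# (U2 <#> L))"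
      using y U2 L.subset by (intro openin_l_coset openin_set_mult_left) auto
    moreover have "y \<in> y <# (U2 <#> L)"
      using y U2(2) subset_saturation[OF L.is_subgroup Uc(2)] unfolding l_coset_def
      by (intro UN_I[of \<one>]) auto
    ultimately obtain z where z: "z \<in> adjoin f L" "z \<in> y <# (U2 <#> L)"
      using y(1) unfolding in_closure_of by blast
    then obtain i :: int and l where il: "l \<in> L" "z = f [^] i \<otimes> l" unfolding adjoin_iff by blast
    obtain u k where uk: "u \<in> U2" "k \<in> L" "z = y \<otimes> (u \<otimes> k)"
      using z(2) by (auto simp: l_coset_def set_mult_def)
    obtain n where n: "\<bar>i\<bar> + 1 \<le> n" "f [^] n \<in> U2 <#> L"
      by (rule rec[OF U2(1,2)])
    have c: "l \<in> carrier G" "u \<in> carrier G" "k \<in> carrier G" using il uk Uc L.subset by auto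
    have "u \<otimes> (k \<otimes> inv l) \<in> U2 <#> L" using uk il by (intro set_mult_memI L.m_closed L.m_inv_closed)
    then have "(u \<otimes> (k \<otimes> inv l)) \<otimes> f [^] n \<in> (U2 <#> U2) <#> L"
      using n Uc by (intro saturation_mult[OF L])
    then have mem: "inv ((u \<otimes> (k \<otimes> inv l)) \<otimes> f [^] n) \<in> U <#> L"
      using saturation_inv[OF L Uc(1)] saturation_mono[OF U2(4)] U(3) by fastforce
    have "f [^] i = y \<otimes> (u \<otimes> (k \<otimes> inv l))"
    proof -
      have "f [^] i = z \<otimes> inv l" using il c f by (simp add: m_assoc)
      then show ?thesis using uk c y by (simp add: m_assoc)
    qed
    then have "f [^] (i + n) = y \<otimes> ((u \<otimes> (k \<otimes> inv l)) \<otimes> f [^] n)"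
      using c y f by (simp add: int_pow_mult m_assoc)
    then have "y = f [^] (i + n) \<otimes> inv ((u \<otimes> (k \<otimes> inv l)) \<otimes> f [^] n)"
      using c y f by (simp add: inv_solve_right)
    moreover have "i + n = int (nat (i + n))" "nat (i + n) > 0" using n by auto
    ultimately show ?thesis using mem unfolding S_def l_coset_def by (metis (no_types, lifting) UN_I singletonI)
  qed
  then have "Q \<subseteq> \<Union>(S ` {0<..})" by auto
  then obtain N where N: "finite N" "N \<subseteq> {0<..}" "Q \<subseteq> \<Union>(S ` N)"
    using \<open>compactin T Q\<close> S unfolding compactin_def
    by (metis (no_types, lifting) finite_subset_image imageE)
  define M where "M = Max (insert 0 N)"
  have M: "n \<le> M" if "n \<in> N" for n using that N(1) by (simp add: M_def)
  have return: "\<exists>r::nat. r \<le> M \<and> f [^] (m + int r) \<in> U <#> L" for m :: int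
  proof -
    obtain n where n: "\<bar>m\<bar> \<le> n" "f [^] n \<in> U <#> L" by (rule rec[OF U(1,2)])
    have "m + int (nat (n - m)) = n" using n(1) by linarith
    then have "f [^] (m + int (nat (n - m))) \<in> U <#> L" using n(2) by simp
    then have ex: "\<exists>r::nat. f [^] (m + int r) \<in> U <#> L" by blast
    \<comment> \<open>If the first return time after \<open>m\<close> exceeded \<open>M\<close>, one of the covering translates
      would give an earlier return.\<close>
    define r where "r = (LEAST r::nat. f [^] (m + int r) \<in> U <#> L)"
    have r: "f [^] (m + int r) \<in> U <#> L" unfolding r_def by (rule LeastI_ex[OF ex])
    then obtain u l where ul: "u \<in> U" "l \<in> L" "f [^] (m + int r) = u \<otimes> l" by (auto simp: set_mult_def)
    have c: "u \<in> carrier G" "l \<in> carrier G" using ul Uc L.subset by auto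
    have "u = f [^] (m + int r) \<otimes> inv l" using ul c by (simp add: m_assoc)
    then have "u \<in> adjoin f L" unfolding adjoin_iff using ul L.m_inv_closed by blast
    moreover have "adjoin f L \<subseteq> T closure_of adjoin f L"
      using subgroup.subset[OF subgroup_adjoin(1)[OF L f]] by (simp add: closure_of_subset topspace_eq)
    ultimately have "u \<in> Q" using ul U WV by (auto simp: Q_def)
    then obtain n where n: "n \<in> N" "u \<in> S n" using N(3) by auto
    then obtain v k where vk: "v \<in> U" "k \<in> L" "u = f [^] int n \<otimes> (v \<otimes> k)"
      by (auto simp: S_def l_coset_def set_mult_def)
    have c': "v \<in> carrier G" "k \<in> carrier G" using vk Uc L.subset by auto
    have "f [^] (m + int r - int n) = v \<otimes> (k \<otimes> l)"
    proof -
      have "f [^] (m + int r - int n) = inv (f [^] int n) \<otimes> f [^] (m + int r)"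
        using f by (metis add.commute diff_conv_add_uminus int_pow_mult int_pow_neg)
      then show ?thesis using ul vk c c' f by (simp add: m_assoc cancel_inv)
    qed
    then have shifted: "f [^] (m + int r - int n) \<in> U <#> L"
      using vk ul by (auto intro!: set_mult_memI L.m_closed)
    have "r < n"
    proof (rule ccontr)
      assume "\<not> r < n"
      then have "f [^] (m + int (r - n)) \<in> U <#> L" "r - n < r" using shifted N(2) n(1) by (auto simp: of_nat_diff algebra_simps)
      then show False unfolding r_def using not_less_Least by blast
    qed
    then show ?thesis using r M[OF n(1)] by (intro exI[of _ r]) auto
  qed
  define P where "P = (\<lambda>r. f [^] (- int r)) ` {..M}"
  have "compactin T P"
    by (rule finite_imp_compactin) (use f in \<open>auto simp: P_def topspace_eq\<close>)
  then have "compactin T (P <#> V)" using WV(2) by (rule compactin_set_mult)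
  moreover have "f [^] m \<in> (P <#> V) <#> L" for m :: int
  proof -
    obtain r where r: "r \<le> M" "f [^] (m + int r) \<in> U <#> L" using return by blast
    then obtain u l where ul: "u \<in> U" "l \<in> L" "f [^] (m + int r) = u \<otimes> l" by (auto simp: set_mult_def)
    have c: "u \<in> carrier G" "l \<in> carrier G" using ul Uc L.subset by auto
    have "f [^] m = f [^] (- int r) \<otimes> f [^] (m + int r)"
      using f by (metis add.commute add.left_neutral add_minus_cancel int_pow_mult)
    then have "f [^] m = (f [^] (- int r) \<otimes> u) \<otimes> l" using ul c f by (simp add: m_assoc)
    moreover have "u \<in> V" using ul U WV by auto
    ultimately show ?thesis using r ul by (auto simp: P_def intro!: set_mult_memI)
  qed
  ultimately show thesis using that by blast
qed

end

section \<open>Closed solvable subgroups\<close>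

context locally_compact_group
begin

text \<open>In the discrete case the subgroup generated by \<open>f\<close> and \<open>L\<close> is closed, as a locally finite union of
  cosets. In the other case it is replaced by its closure, in which \<open>L\<close> is cocompact.\<close>

lemma boundedly_amenable_closed_adjoin:
  assumes L: "L \<lhd> G" "closedin T L" "boundedly_amenable G T L" and f: "f \<in> carrier G"
    and amenable: "\<And>H. subgroup H G \<Longrightarrow> discretely_amenable H"
  obtains M where "subgroup M G" "closedin T M" "L \<subseteq> M" "f \<in> M" "boundedly_amenable G T M"
proof (cases "\<exists>K. compactin T K \<and> infinite {i::int. f [^] i \<in> K <#> L}")
  case False
  interpret L: normal L G by (rule L(1))
  define I where "I = (\<lambda>K. {i::int. f [^] i \<in> K <#> L})"
  have I: "finite (I K)" if "compactin T K" for K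
    using False that unfolding I_def by blast
  have I_mem: "i \<in> I K" if x: "x \<in> K" "x \<in> f [^] i <# L" for x K i
  proof -
    obtain l where l: "l \<in> L" "x = f [^] i \<otimes> l" using x by (auto simp: l_coset_def)
    then have "f [^] i = x \<otimes> inv l" using f L.subset by (auto simp: m_assoc subset_iff)
    then show ?thesis using x(1) l(1) by (auto simp: I_def intro!: set_mult_memI)
  qed
  have "closedin T (adjoin f L)"
  proof (rule closedin_iff_compact_traces)
    show "adjoin f L \<subseteq> carrier G" using subgroup.subset[OF subgroup_adjoin(1)[OF L(1) f]] .
    fix K assume K: "compactin T K"
    have "K \<inter> adjoin f L = (\<Union>i\<in>I K. (f [^] i <# L) \<inter> K)"
      using I_mem by (fastforce simp: adjoin_def)
    moreover have "compactin T ((f [^] i <# L) \<inter> K)" for i :: int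
      using f L(2) K by (intro closed_Int_compactin closedin_l_coset) auto
    ultimately show "compactin T (K \<inter> adjoin f L)"
      using I[OF K] by (simp only:) (intro compactin_Union, auto)
  qed
  moreover have "boundedly_amenable G T (adjoin f L)"
  proof (rule boundedly_amenable_adjoin[OF L f])
    fix K assume K: "compactin T K" "K \<subseteq> adjoin f L"
    obtain m where m: "\<forall>n\<in>(\<lambda>i. nat \<bar>i\<bar>) ` I K. n \<le> m"
      using I[OF K(1)] by (meson finite_imageI finite_nat_set_iff_bounded_le)
    show "\<exists>m::nat. \<forall>x\<in>K. \<exists>i::int. \<bar>i\<bar> \<le> int m \<and> x \<in> f [^] i <# L"
    proof (intro exI[of _ m] ballI)
      fix x assume x: "x \<in> K"
      then obtain i :: int where i: "x \<in> f [^] i <# L" using K(2) by (auto simp: adjoin_def)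
      then have "nat \<bar>i\<bar> \<le> m" using m I_mem[OF x i] by blast
      then show "\<exists>i::int. \<bar>i\<bar> \<le> int m \<and> x \<in> f [^] i <# L" using i by (intro exI[of _ i]) auto
    qed
  qed
  ultimately show thesis using subgroup_adjoin[OF L(1) f] that by blast
next
  case True
  interpret L: normal L G by (rule L(1))
  obtain K where K: "compactin T K" "infinite {i::int. f [^] i \<in> K <#> L}" using True by blast
  obtain C where C: "compactin T C" "\<And>i::int. f [^] i \<in> C <#> L"
    using cyclic_discrete_or_cocompact[OF L(1) f K] by blast
  define M where "M = T closure_of (adjoin f L)"
  note A = subgroup_adjoin[OF L(1) f]
  have M: "subgroup M G" "closedin T M" "adjoin f L \<subseteq> M"
    unfolding M_def using A subgroup.subset[OF A(1)]
    by (simp_all add: subgroup_closure_of closure_of_subset topspace_eq)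
  have "adjoin f L \<subseteq> C <#> L"
  proof
    fix x assume "x \<in> adjoin f L"
    then obtain i :: int and l where l: "l \<in> L" "x = f [^] i \<otimes> l" unfolding adjoin_iff by blast
    obtain c k where ck: "c \<in> C" "k \<in> L" "f [^] i = c \<otimes> k" using C(2)[of i] by (auto simp: set_mult_def)
    have "c \<in> carrier G" "l \<in> carrier G" "k \<in> carrier G"
      using ck l L.subset compact_subset_carrier[OF C(1)] by auto
    then have "x = c \<otimes> (k \<otimes> l)" using l ck by (simp add: m_assoc)
    then show "x \<in> C <#> L" using ck l by (auto intro!: set_mult_memI)
  qed
  then have MC: "M \<subseteq> C <#> L"
    unfolding M_def using closedin_compact_set_mult[OF C(1) L(2)] by (rule closure_of_minimal)
  have "M \<subseteq> (M \<inter> C) <#> L"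
  proof
    fix x assume x: "x \<in> M"
    then obtain c l where cl: "c \<in> C" "l \<in> L" "x = c \<otimes> l" using MC by (auto simp: set_mult_def)
    have "c \<in> carrier G" "l \<in> carrier G" using cl L.subset compact_subset_carrier[OF C(1)] by auto
    then have "c = x \<otimes> inv l" using cl by (simp add: m_assoc)
    moreover have "l \<in> M" using cl A(2) M(3) by blast
    ultimately have "c \<in> M" using x M(1) by (simp add: subgroup.m_closed subgroup.m_inv_closed)
    then show "x \<in> (M \<inter> C) <#> L" using cl by (auto intro!: set_mult_memI)
  qed
  then have "boundedly_amenable G T M"
    using boundedly_amenable_cocompact[OF L.is_subgroup L(2) _ L(3) M(1) amenable[OF M(1)] closed_Int_compactin[OF M(2) C(1)]]
      A(2) M(3) by blast
  then show thesis using that M A by blast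
qed

text \<open>A symmetric compact neighbourhood \<open>K0\<close> of the identity that contains \<open>K\<close> satisfies \<open>K0 K0 \<subseteq> F K0\<close>
  for a finite set \<open>F\<close>. Once \<open>F\<close> is adjoined to \<open>N\<close>, the product \<open>K0 L\<close> is a subgroup, and \<open>L\<close> is
  cocompact in it.\<close>

lemma boundedly_amenable_abelian_extension:
  assumes N: "subgroup N G" "closedin T N" "derived G (carrier G) \<subseteq> N" "boundedly_amenable G T N"
    and amenable: "\<And>H. subgroup H G \<Longrightarrow> discretely_amenable H"
  shows "boundedly_amenable G T (carrier G)"
proof (rule boundedly_amenableI)
  fix K e assume K: "compactin T K" and e: "0 < (e :: real)"
  obtain U V where UV: "openin T U" "compactin T V" "\<one> \<in> U" "U \<subseteq> V"
    by (rule compact_neighbourhood_one)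
  \<comment> \<open>Symmetric, compact, and a neighbourhood of the identity.\<close>
  define K0 where "K0 = (K \<union> V) \<union> m_inv G ` (K \<union> V)"
  have K0: "compactin T K0" unfolding K0_def using K UV by (intro compactin_Un compactin_inv_image)
  have K0c: "K0 \<subseteq> carrier G" by (rule compact_subset_carrier[OF K0])
  have KVc: "K \<union> V \<subseteq> carrier G" using K0c by (auto simp: K0_def)
  have K0_inv: "inv x \<in> K0" if "x \<in> K0" for x
    using that KVc unfolding K0_def by (auto simp: subset_iff)
  have "compactin T (K0 <#> K0)" using K0 by (intro compactin_set_mult)
  then obtain F where F: "finite F" "F \<subseteq> K0 <#> K0" "K0 <#> K0 \<subseteq> F <#> U"
    using compact_finite_translates UV(1,3) by blast
  have Fc: "F \<subseteq> carrier G" using F(2) set_mult_closed[OF K0c K0c] by blast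
  have "\<exists>M. subgroup M G \<and> closedin T M \<and> N \<subseteq> M \<and> F \<subseteq> M \<and> boundedly_amenable G T M"
    using F(1) Fc
  proof (induction F rule: finite_induct)
    case empty
    then show ?case using N by blast
  next
    case (insert f F)
    then obtain M where M: "subgroup M G" "closedin T M" "N \<subseteq> M" "F \<subseteq> M" "boundedly_amenable G T M" by auto
    have nrm: "M \<lhd> G" using M N(3) by (intro normal_of_derived_subset) auto
    have f: "f \<in> carrier G" using insert by simp
    obtain M' where "subgroup M' G" "closedin T M'" "M \<subseteq> M'" "f \<in> M'" "boundedly_amenable G T M'"
      by (rule boundedly_amenable_closed_adjoin[OF nrm M(2,5) f amenable])
    then show ?case using M(3,4) by (intro exI[of _ M']) auto
  qed
  then obtain L where L: "subgroup L G" "closedin T L" "N \<subseteq> L" "F \<subseteq> L" "boundedly_amenable G T L" by blast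
  have nrm: "L \<lhd> G" using L N(3) by (intro normal_of_derived_subset) auto
  interpret L: normal L G by (rule nrm)
  have K0K0: "K0 <#> K0 \<subseteq> K0 <#> L"
  proof
    fix x assume "x \<in> K0 <#> K0"
    then have "x \<in> F <#> U" using F(3) by blast
    then obtain y u where yu: "y \<in> F" "u \<in> U" "x = y \<otimes> u" by (auto simp: set_mult_def)
    then have u: "u \<in> K0" using UV by (auto simp: K0_def)
    have c: "u \<in> carrier G" "y \<in> carrier G" using u yu K0c Fc by auto
    have "x = u \<otimes> (inv u \<otimes> y \<otimes> u)" using yu c by (simp add: m_assoc cancel_inv)
    moreover have "inv u \<otimes> y \<otimes> u \<in> L" using conj_normal[OF nrm c(1)] yu L(4) by blast
    ultimately show "x \<in> K0 <#> L" using u by (auto intro!: set_mult_memI)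
  qed
  have one: "\<one> \<in> K0" using UV by (auto simp: K0_def)
  define H where "H = K0 <#> L"
  have LH: "L \<subseteq> H"
  proof
    fix l assume "l \<in> L"
    then have "l = \<one> \<otimes> l" using L.subset by auto
    then show "l \<in> H" unfolding H_def using one \<open>l \<in> L\<close> by (metis set_mult_memI)
  qed
  have K0H: "K0 \<subseteq> H" unfolding H_def by (rule subset_saturation[OF L(1) K0c])
  have H: "subgroup H G"
  proof
    show "H \<subseteq> carrier G" unfolding H_def using K0c L.subset by (rule set_mult_closed)
    show "\<one> \<in> H" using LH L.one_closed by blast
    show "x \<otimes> y \<in> H" if "x \<in> H" "y \<in> H" for x y
    proof -
      have "x \<otimes> y \<in> (K0 <#> K0) <#> L"
        using that unfolding H_def by (intro saturation_mult[OF nrm K0c K0c])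
      then have "x \<otimes> y \<in> (K0 <#> L) <#> L" using saturation_mono[OF K0K0] by blast
      then show ?thesis
        unfolding H_def using set_mult_assoc[OF K0c L.subset L.subset] subgroup_mult_id[OF L(1)] by simp
    qed
    show "inv x \<in> H" if "x \<in> H" for x
    proof -
      have "inv x \<in> m_inv G ` K0 <#> L" using that unfolding H_def by (intro saturation_inv[OF nrm K0c])
      moreover have "m_inv G ` K0 \<subseteq> K0" using K0_inv by blast
      ultimately show ?thesis unfolding H_def using saturation_mono by blast
    qed
  qed
  have "boundedly_amenable G T H"
    by (rule boundedly_amenable_cocompact[OF L(1,2) LH L(5) H amenable[OF H] K0 K0H]) (simp add: H_def)
  moreover have "K \<subseteq> H" using K0H by (auto simp: K0_def)
  ultimately show "\<exists>K'. compactin T K' \<and> K' \<subseteq> carrier G \<and> (\<forall>E. finite E \<and> E \<subseteq> K \<longrightarrow>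
      (\<exists>\<beta>. almost_invariant_in G K' e E \<beta>))"
    using K e unfolding boundedly_amenable_def
    by (metis (no_types, lifting) compact_subset_carrier)
qed

lemma locally_compact_group_subgroup:
  assumes "subgroup H G" "closedin T H"
  shows "locally_compact_group (G\<lparr>carrier := H\<rparr>) (subtopology T H)"
  using topological_group_subgroup[OF assms(1)] Hausdorff locally_compact assms(2)
  by (auto simp: locally_compact_group_def locally_compact_group_axioms_def
      Hausdorff_space_subtopology locally_compact_space_closed_subset)

theorem boundedly_amenable_solvable:
  assumes B: "subgroup B G" "closedin T B" "solvable (G\<lparr>carrier := B\<rparr>)"
  shows "boundedly_amenable G T B"
proof -
  obtain n where n: "(derived G ^^ n) B = {\<one>}" by (rule derived_series_reaches_one[OF B(1,3)])
  have "closedin T {\<one>}" by (intro compactin_imp_closed) (simp add: topspace_eq)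
  then show ?thesis
  proof (rule closed_derived_series_induct[where P = "boundedly_amenable G T", OF _ B(1,2) n boundedly_amenable_trivial])
    fix N H assume NH: "subgroup N G" "closedin T N" "subgroup H G" "closedin T H" "N \<subseteq> H" "H \<subseteq> B"
      "derived G H \<subseteq> N" "boundedly_amenable G T N"
    let ?H = "G\<lparr>carrier := H\<rparr>"
    interpret H: locally_compact_group ?H "subtopology T H"
      by (rule locally_compact_group_subgroup[OF NH(3,4)])
    have "boundedly_amenable ?H (subtopology T H) (carrier ?H)"
    proof (rule H.boundedly_amenable_abelian_extension)
      show "subgroup N ?H" by (rule subgroup_incl[OF NH(1,3,5)])
      show "closedin (subtopology T H) N" using NH by (simp add: closedin_subset_topspace)
      show "derived ?H (carrier ?H) \<subseteq> N" using derived_consistent[OF order_refl NH(3)] NH(7) by simp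
      show "boundedly_amenable ?H (subtopology T H) N" using NH(8) boundedly_amenable_subtopology[OF NH(5)] by blast
      fix M assume M: "subgroup M ?H"
      have M': "subgroup M G" "M \<subseteq> H" using M subgroup.subset[OF M] incl_subgroup[OF NH(3) M] by auto
      have "discretely_amenable M"
        using discretely_amenable_solvable[OF B(1) n M'(1)] M'(2) NH(6) by blast
      then have "boundedly_amenable ?H (subtopology (discrete_topology (carrier G)) H) M"
        using boundedly_amenable_subtopology[OF M'(2)] by blast
      moreover have "subtopology (discrete_topology (carrier G)) H = discrete_topology H"
        using subgroup.subset[OF NH(3)] by (simp add: Int_absorb1)
      ultimately show "H.discretely_amenable M" by simp
    qed
    then show "boundedly_amenable G T H"
      by (simp add: boundedly_amenable_subtopology)
  qed
qed

end

section \<open>Almost equivariant kernels into a discrete subgroup\<close>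

lemma sum_normalized_diff_le:
  fixes a b :: "'i \<Rightarrow> real"
  assumes a: "\<And>i. i \<in> D \<Longrightarrow> 0 \<le> a i" "1 \<le> sum a D" and b: "1 \<le> sum b D"
  shows "(\<Sum>i\<in>D. \<bar>b i / sum b D - a i / sum a D\<bar>) \<le> 2 * (\<Sum>i\<in>D. \<bar>b i - a i\<bar>)"
proof -
  let ?A = "sum a D" and ?B = "sum b D" and ?d = "\<Sum>i\<in>D. \<bar>b i - a i\<bar>"
  have AB: "\<bar>?A - ?B\<bar> \<le> ?d"
    using sum_abs[of "\<lambda>i. b i - a i" D] by (simp add: sum_subtractf abs_minus_commute)
  have "\<bar>b i / ?B - a i / ?A\<bar> \<le> \<bar>b i - a i\<bar> / ?B + a i * (\<bar>?A - ?B\<bar> / (?A * ?B))" if "i \<in> D" for i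
  proof -
    have "b i / ?B - a i / ?A = (b i - a i) / ?B + a i * ((?A - ?B) / (?A * ?B))"
      using a(2) b by (simp add: field_simps)
    then have "\<bar>b i / ?B - a i / ?A\<bar> \<le> \<bar>(b i - a i) / ?B\<bar> + \<bar>a i * ((?A - ?B) / (?A * ?B))\<bar>"
      by (metis abs_triangle_ineq)
    also have "\<dots> = \<bar>b i - a i\<bar> / ?B + a i * (\<bar>?A - ?B\<bar> / (?A * ?B))"
      using a b that by (simp add: abs_mult abs_divide)
    finally show ?thesis .
  qed
  then have "(\<Sum>i\<in>D. \<bar>b i / ?B - a i / ?A\<bar>) \<le>
      (\<Sum>i\<in>D. \<bar>b i - a i\<bar> / ?B + a i * (\<bar>?A - ?B\<bar> / (?A * ?B)))"
    by (rule sum_mono)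
  also have "\<dots> = ?d / ?B + ?A * (\<bar>?A - ?B\<bar> / (?A * ?B))"
    by (simp add: sum.distrib sum_divide_distrib sum_distrib_right)
  also have "\<dots> = (?d + \<bar>?A - ?B\<bar>) / ?B" using a(2) by (simp add: add_divide_distrib)
  also have "\<dots> \<le> (2 * ?d) / ?B" using AB b by (intro divide_right_mono) auto
  also have "\<dots> \<le> 2 * ?d" using divide_left_mono[of 1 ?B "2 * ?d"] b by (simp add: sum_nonneg)
  finally show ?thesis .
qed

context locally_compact_group
begin

text \<open>A translate of a neighbourhood \<open>V\<close> with \<open>V V\<close> inside \<open>U\<close> and \<open>U \<inter> \<Gamma> = {\<one>}\<close> contains at most one
  element of \<open>\<Gamma>\<close>.\<close>

lemma finite_discrete_Int_compact:
  assumes \<Gamma>: "discrete_subgroup G T \<Gamma>" and K: "compactin T K"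
  shows "finite (\<Gamma> \<inter> K)"
proof -
  have sub: "subgroup \<Gamma> G" "\<Gamma> \<subseteq> carrier G"
    and top: "subtopology T \<Gamma> = discrete_topology \<Gamma>"
    using \<Gamma> subgroup.subset[of \<Gamma> G] by (simp_all add: discrete_subgroup_def)
  have one: "\<one> \<in> \<Gamma>" by (rule subgroup.one_closed[OF sub(1)])
  then have "openin (subtopology T \<Gamma>) {\<one>}" by (simp add: top)
  then obtain U where U: "openin T U" "{\<one>} = U \<inter> \<Gamma>" unfolding openin_subtopology by blast
  then have "\<one> \<in> U" by blast
  then obtain V where V: "openin T V" "\<one> \<in> V" "m_inv G ` V = V" "V <#> V \<subseteq> U"
    using symmetric_square_root_neighbourhood[OF U(1)] by metis
  have Vc: "V \<subseteq> carrier G" using V open_subset_carrier by blast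
  obtain F where F: "finite F" "F \<subseteq> K" "K \<subseteq> F <#> V"
    using compact_finite_translates[OF K V(1,2)] by blast
  have unique: "\<gamma> = \<gamma>'" if x: "x \<in> F" and \<gamma>: "\<gamma> \<in> \<Gamma> \<inter> (x <# V)" "\<gamma>' \<in> \<Gamma> \<inter> (x <# V)" for x \<gamma> \<gamma>'
  proof -
    obtain v w where vw: "v \<in> V" "w \<in> V" "\<gamma> = x \<otimes> v" "\<gamma>' = x \<otimes> w"
      using \<gamma> unfolding l_coset_def by blast
    have c: "x \<in> carrier G" "v \<in> carrier G" "w \<in> carrier G"
      using x F(2) compact_subset_carrier[OF K] vw Vc by auto
    have "inv v \<in> V" using vw V(3) by blast
    then have "inv v \<otimes> w \<in> U" using vw V(4) set_mult_memI by blast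
    moreover have eq: "inv \<gamma> \<otimes> \<gamma>' = inv v \<otimes> w" using vw c by (simp add: inv_mult_group m_assoc cancel_inv)
    moreover have "inv \<gamma> \<otimes> \<gamma>' \<in> \<Gamma>" using \<gamma> sub by (simp add: subgroup.m_closed subgroup.m_inv_closed)
    ultimately have "inv v \<otimes> w = \<one>" using U(2) by (metis IntI singletonD)
    then have "v = w" using c by (metis inv_equality inv_inv inv_closed)
    then show ?thesis using vw by simp
  qed
  have "finite (\<Gamma> \<inter> (x <# V))" if "x \<in> F" for x
  proof (cases "\<Gamma> \<inter> (x <# V) = {}")
    case False
    then obtain \<gamma> where \<gamma>: "\<gamma> \<in> \<Gamma> \<inter> (x <# V)" by blast
    then have "\<Gamma> \<inter> (x <# V) \<subseteq> {\<gamma>}" using unique[OF that _ \<gamma>] by blast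
    then show ?thesis by (rule finite_subset) simp
  qed simp
  then have "finite (\<Union>x\<in>F. \<Gamma> \<inter> (x <# V))" using F(1) by blast
  moreover have "\<Gamma> \<inter> K \<subseteq> (\<Union>x\<in>F. \<Gamma> \<inter> (x <# V))"
    using F(3) by (fastforce simp: set_mult_def l_coset_def)
  ultimately show ?thesis by (rule rev_finite_subset)
qed

lemma compact_bump_function:
  assumes Z: "compactin T Z"
  obtains Q and \<phi> :: "'a \<Rightarrow> real" where "compactin T Q" "continuous_map T euclideanreal \<phi>"
    "\<And>x. x \<in> carrier G \<Longrightarrow> 0 \<le> \<phi> x" "\<And>x. x \<in> Z \<Longrightarrow> \<phi> x = 1" "\<And>x. x \<in> carrier G - Q \<Longrightarrow> \<phi> x = 0"
proof -
  obtain U V where UV: "openin T U" "compactin T V" "\<one> \<in> U" "U \<subseteq> V"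
    by (rule compact_neighbourhood_one)
  have Zc: "Z \<subseteq> carrier G" by (rule compact_subset_carrier[OF Z])
  have "completely_regular_space T"
    using locally_compact Hausdorff
    by (simp add: locally_compact_regular_imp_completely_regular_space locally_compact_Hausdorff_or_regular)
  moreover have "closedin T (carrier G - (Z <#> U))"
    using openin_set_mult_right[OF UV(1) Zc] by (simp add: closedin_diff topspace_eq[symmetric])
  moreover have ZU: "Z \<subseteq> Z <#> U"
  proof
    fix x assume "x \<in> Z"
    then have "x = x \<otimes> \<one>" using Zc by auto
    then show "x \<in> Z <#> U" using \<open>x \<in> Z\<close> UV(3) by (metis set_mult_memI)
  qed
  then have "disjnt Z (carrier G - (Z <#> U))" by (auto simp: disjnt_def)
  ultimately obtain \<phi> where \<phi>: "continuous_map T (top_of_set {0..1::real}) \<phi>"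
     "\<phi> ` (carrier G - (Z <#> U)) \<subseteq> {0}" "\<phi> ` Z \<subseteq> {1}"
    using Urysohn_completely_regular_compact_closed[of 0 "1::real" T Z "carrier G - (Z <#> U)"] Z by auto
  have "Z <#> U \<subseteq> Z <#> V" using UV(4) by (intro mono_set_mult) auto
  then show thesis
    using that[of "Z <#> V" \<phi>] compactin_set_mult[OF Z UV(2)] \<phi>
    by (force simp: continuous_map_in_subtopology topspace_eq Pi_iff)
qed


text \<open>This is where discreteness of \<open>\<Gamma>\<close> enters: for a bump function \<open>\<phi>\<close>, the weights \<open>\<phi> (\<gamma>\<inverse> y)\<close> have finite
  support in \<open>\<gamma>\<close>. Normalised, they give an equivariant map to measures on \<open>\<Gamma>\<close> that is continuous in total
  variation. A single bump is enough, because only points of the \<open>\<Gamma>\<close>-orbits through the compact set \<open>Z\<close> matter.\<close>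

lemma equivariant_kernel:
  assumes \<Gamma>: "discrete_subgroup G T \<Gamma>" and Z: "compactin T Z"
  obtains \<psi> :: "'a \<Rightarrow> 'a pmf" where
    "\<And>y. y \<in> Z \<Longrightarrow> finite (set_pmf (\<psi> y)) \<and> set_pmf (\<psi> y) \<subseteq> \<Gamma>"
    "\<And>\<gamma> y. \<gamma> \<in> \<Gamma> \<Longrightarrow> y \<in> Z \<Longrightarrow> \<psi> (\<gamma> \<otimes> y) = map_pmf (\<lambda>x. \<gamma> \<otimes> x) (\<psi> y)"
    "\<And>e. 0 < e \<Longrightarrow> \<exists>V. openin T V \<and> \<one> \<in> V \<and>
      (\<forall>v\<in>V. \<forall>z\<in>Z. v \<otimes> z \<in> Z \<longrightarrow> tv_close e (\<psi> (v \<otimes> z)) (\<psi> z))"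
proof -
  have sub: "subgroup \<Gamma> G" "\<Gamma> \<subseteq> carrier G"
    using \<Gamma> subgroup.subset[of \<Gamma> G] by (simp_all add: discrete_subgroup_def)
  have Zc: "Z \<subseteq> carrier G" by (rule compact_subset_carrier[OF Z])
  obtain Q and \<phi> :: "'a \<Rightarrow> real" where Q: "compactin T Q" and \<phi>: "continuous_map T euclideanreal \<phi>"
    and \<phi>_nonneg: "\<And>x. x \<in> carrier G \<Longrightarrow> 0 \<le> \<phi> x" and \<phi>_one: "\<And>x. x \<in> Z \<Longrightarrow> \<phi> x = 1"
    and \<phi>_zero: "\<And>x. x \<in> carrier G - Q \<Longrightarrow> \<phi> x = 0"
    using compact_bump_function[OF Z] by metis
  define w where "w = (\<lambda>y \<gamma>. if \<gamma> \<in> \<Gamma> then \<phi> (inv \<gamma> \<otimes> y) else 0)"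
  have w_nonneg: "0 \<le> w y \<gamma>" if "y \<in> carrier G" for y \<gamma>
    using that sub by (auto simp: w_def intro!: \<phi>_nonneg)
  have w_support: "\<gamma> \<in> \<Gamma> \<inter> (K <#> m_inv G ` Q)" if y: "y \<in> K" "w y \<gamma> \<noteq> 0" and K: "K \<subseteq> carrier G" for y \<gamma> K
  proof -
    have \<gamma>: "\<gamma> \<in> \<Gamma>" using y by (auto simp: w_def split: if_splits)
    have c: "\<gamma> \<in> carrier G" "y \<in> carrier G" using \<gamma> sub y K by auto
    have "inv \<gamma> \<otimes> y \<in> Q" using y \<gamma> c \<phi>_zero[of "inv \<gamma> \<otimes> y"] by (auto simp: w_def)
    moreover have "\<gamma> = y \<otimes> inv (inv \<gamma> \<otimes> y)" using c by (simp add: inv_mult_group cancel_inv)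
    ultimately have "\<gamma> \<in> K <#> m_inv G ` Q" using y(1) by (metis imageI set_mult_memI)
    then show ?thesis using \<gamma> by simp
  qed
  have finite_support: "finite {\<gamma>. w y \<gamma> \<noteq> 0}" if y: "y \<in> carrier G" for y
  proof (rule finite_subset)
    show "{\<gamma>. w y \<gamma> \<noteq> 0} \<subseteq> \<Gamma> \<inter> ({y} <#> m_inv G ` Q)" using w_support[of y "{y}"] y by auto
    show "finite (\<Gamma> \<inter> ({y} <#> m_inv G ` Q))"
      using y by (intro finite_discrete_Int_compact[OF \<Gamma>] compactin_set_mult compactin_inv_image[OF Q])
        (simp add: topspace_eq)
  qed
  define W where "W = (\<lambda>y. \<Sum>\<gamma> | w y \<gamma> \<noteq> 0. w y \<gamma>)"
  have W_eq: "W y = sum (w y) D" if "finite D" "{\<gamma>. w y \<gamma> \<noteq> 0} \<subseteq> D" for y D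
    unfolding W_def using that by (intro sum.mono_neutral_left) auto
  have W_ge: "1 \<le> W y" if "y \<in> Z" for y
  proof -
    have y: "y \<in> carrier G" using that Zc by blast
    have "w y \<one> = 1" using that y subgroup.one_closed[OF sub(1)] \<phi>_one by (simp add: w_def)
    then show ?thesis
      unfolding W_def using member_le_sum[of \<one> "{\<gamma>. w y \<gamma> \<noteq> 0}" "w y"] finite_support[OF y] w_nonneg[OF y] by auto
  qed
  have w_shift: "w (\<gamma> \<otimes> y) \<delta> = w y (inv \<gamma> \<otimes> \<delta>)" if "\<gamma> \<in> \<Gamma>" "y \<in> carrier G" "\<delta> \<in> carrier G" for \<gamma> y \<delta>
  proof -
    have "\<gamma> \<in> carrier G" using that sub by blast
    moreover have "inv \<gamma> \<otimes> \<delta> \<in> \<Gamma> \<longleftrightarrow> \<delta> \<in> \<Gamma>"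
      using that(1,3) sub by (metis calculation cancel_inv(1) subgroup.m_closed subgroup.m_inv_closed)
    ultimately show ?thesis using that by (simp add: w_def inv_mult_group m_assoc)
  qed
  define \<psi> where "\<psi> = (\<lambda>y. embed_pmf (\<lambda>\<gamma>. w y \<gamma> / W y))"
  have pmf_\<psi>: "pmf (\<psi> y) \<gamma> = w y \<gamma> / W y" if y: "y \<in> carrier G" "0 < W y" for y \<gamma>
    unfolding \<psi>_def
  proof (rule pmf_embed_pmf)
    show "0 \<le> w y x / W y" for x using w_nonneg y by auto
    have "(\<integral>\<^sup>+ x. ennreal (w y x / W y) \<partial>count_space UNIV) = (\<Sum>x | w y x \<noteq> 0. ennreal (w y x / W y))"
      by (rule nn_integral_count_space'[OF finite_support[OF y(1)]]) auto
    also have "\<dots> = ennreal (\<Sum>x | w y x \<noteq> 0. w y x / W y)"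
      using w_nonneg[OF y(1)] y by (intro sum_ennreal) auto
    also have "\<dots> = 1" using y(2) by (simp add: W_def flip: sum_divide_distrib)
    finally show "(\<integral>\<^sup>+ x. ennreal (w y x / W y) \<partial>count_space UNIV) = 1" .
  qed
  have W_shift: "W (\<gamma> \<otimes> y) = W y" if \<gamma>: "\<gamma> \<in> \<Gamma>" and y: "y \<in> carrier G" for \<gamma> y
  proof -
    have c: "\<gamma> \<in> carrier G" using \<gamma> sub by blast
    have in_c: "\<delta> \<in> carrier G" if "w z \<delta> \<noteq> 0" for z \<delta>
      using that sub by (auto simp: w_def split: if_splits)
    have shift: "w (\<gamma> \<otimes> y) a = w y (inv \<gamma> \<otimes> a)" if "w (\<gamma> \<otimes> y) a \<noteq> 0" for a
      using w_shift[OF \<gamma> y in_c[OF that]] .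
    have nonzero: "w y (inv \<gamma> \<otimes> a) \<noteq> 0" if "w (\<gamma> \<otimes> y) a \<noteq> 0" for a
      using shift[OF that] that by simp
    show ?thesis
      unfolding W_def
      by (rule sum.reindex_bij_witness[of _ "\<lambda>\<delta>. \<gamma> \<otimes> \<delta>" "\<lambda>\<delta>. inv \<gamma> \<otimes> \<delta>"])
        (use \<gamma> y c in_c w_shift nonzero in \<open>auto simp: cancel_inv\<close>)
  qed
  show thesis
  proof (rule that[of \<psi>])
    fix y assume y: "y \<in> Z"
    have y': "y \<in> carrier G" "0 < W y" using y Zc W_ge[OF y] by auto
    have "set_pmf (\<psi> y) = {\<gamma>. w y \<gamma> \<noteq> 0}"
      using y' pmf_\<psi>[OF y'] by (auto simp: set_pmf_iff)
    then show "finite (set_pmf (\<psi> y)) \<and> set_pmf (\<psi> y) \<subseteq> \<Gamma>"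
      using finite_support[OF y'(1)] by (auto simp: w_def split: if_splits)
    fix \<gamma> assume \<gamma>: "\<gamma> \<in> \<Gamma>"
    have c: "\<gamma> \<in> carrier G" using \<gamma> sub by blast
    show "\<psi> (\<gamma> \<otimes> y) = map_pmf (\<lambda>x. \<gamma> \<otimes> x) (\<psi> y)"
    proof (rule pmf_eqI)
      fix \<delta>
      have \<gamma>y: "\<gamma> \<otimes> y \<in> carrier G" "0 < W (\<gamma> \<otimes> y)" using c y' W_shift[OF \<gamma> y'(1)] by auto
      have set_sub: "set_pmf (\<psi> y) \<subseteq> carrier G"
        using \<open>set_pmf (\<psi> y) = _\<close> sub by (auto simp: w_def split: if_splits)
      show "pmf (\<psi> (\<gamma> \<otimes> y)) \<delta> = pmf (map_pmf (\<lambda>x. \<gamma> \<otimes> x) (\<psi> y)) \<delta>"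
      proof (cases "\<delta> \<in> carrier G")
        case True
        have "pmf (map_pmf (\<lambda>x. \<gamma> \<otimes> x) (\<psi> y)) (\<gamma> \<otimes> (inv \<gamma> \<otimes> \<delta>)) = pmf (\<psi> y) (inv \<gamma> \<otimes> \<delta>)"
        proof (cases "inv \<gamma> \<otimes> \<delta> \<in> set_pmf (\<psi> y)")
          case True
          then show ?thesis
            using set_sub c by (intro pmf_map_inj) (auto intro!: inj_onI simp: subset_iff)
        next
          case False
          have "\<gamma> \<otimes> (inv \<gamma> \<otimes> \<delta>) \<notin> set_pmf (map_pmf (\<lambda>x. \<gamma> \<otimes> x) (\<psi> y))"
            using False True c set_sub by (auto simp: cancel_inv subset_iff)
          then show ?thesis using False by (metis pmf_eq_0_set_pmf)
        qed
        then show ?thesis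
          using True c pmf_\<psi>[OF \<gamma>y] pmf_\<psi>[OF y'] w_shift[OF \<gamma> y'(1)] W_shift[OF \<gamma> y'(1)]
          by (simp add: cancel_inv)
      next
        case False
        then have "\<delta> \<notin> set_pmf (map_pmf (\<lambda>x. \<gamma> \<otimes> x) (\<psi> y))"
          using set_sub c by (auto simp: subset_iff)
        moreover have "w (\<gamma> \<otimes> y) \<delta> = 0" using False sub by (auto simp: w_def)
        ultimately show ?thesis using pmf_\<psi>[OF \<gamma>y] by (metis div_0 pmf_eq_0_set_pmf)
      qed
    qed
  next
    fix e :: real assume e: "0 < e"
    define D where "D = \<Gamma> \<inter> (Z <#> m_inv G ` Q)"
    have D: "finite D" unfolding D_def
      by (intro finite_discrete_Int_compact[OF \<Gamma>] compactin_set_mult compactin_inv_image Q Z)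
    have D_sup: "{\<gamma>. w y \<gamma> \<noteq> 0} \<subseteq> D" if "y \<in> Z" for y
      using w_support[OF that _ Zc] by (auto simp: D_def)
    define d where "d = e / (2 * (real (card D) + 1))"
    have d: "0 < d" using e by (simp add: d_def)
    let ?g = "\<lambda>\<gamma> p. \<phi> (inv \<gamma> \<otimes> (fst p \<otimes> snd p)) - \<phi> (inv \<gamma> \<otimes> snd p)"
    let ?N = "\<lambda>\<gamma>. {p \<in> topspace (prod_topology T T). ?g \<gamma> p \<in> {-d<..<d}}"
    have N: "openin (prod_topology T T) (?N \<gamma>)" if "\<gamma> \<in> D" for \<gamma>
    proof (rule openin_continuous_map_preimage)
      have c: "inv \<gamma> \<in> carrier G" using that sub by (auto simp: D_def)
      have "continuous_map (prod_topology T T) T (\<lambda>p. inv \<gamma> \<otimes> (fst p \<otimes> snd p))"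
        "continuous_map (prod_topology T T) T (\<lambda>p. inv \<gamma> \<otimes> snd p)"
        using c by (auto intro!: continuous_map_mult continuous_map_fst continuous_map_snd simp: topspace_eq)
      then show "continuous_map (prod_topology T T) euclideanreal (?g \<gamma>)"
        using continuous_map_compose[OF _ \<phi>] by (intro continuous_map_diff) (auto simp: o_def)
    qed (simp flip: open_openin)
    define O' where "O' = topspace (prod_topology T T) \<inter> (\<Inter>\<gamma>\<in>D. ?N \<gamma>)"
    have "openin (prod_topology T T) O'"
    proof (cases "D = {}")
      case False
      have "O' = (\<Inter>\<gamma>\<in>D. ?N \<gamma>)" using False by (auto simp: O'_def)
      then show ?thesis using N D False by (simp only:) (intro openin_INT2, auto)
    qed (simp add: O'_def openin_prod_Times_iff openin_topspace)
    moreover have "{\<one>} \<times> Z \<subseteq> O'" using Zc d by (auto simp: O'_def topspace_eq)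
    moreover have "compactin T {\<one>}" by (simp add: topspace_eq)
    ultimately obtain V Z' where V: "openin T V" "{\<one>} \<subseteq> V" "Z \<subseteq> Z'" "V \<times> Z' \<subseteq> O'"
      using Wallace_theorem_prod_topology[OF _ Z] by metis
    have "tv_close e (\<psi> (v \<otimes> z)) (\<psi> z)" if v: "v \<in> V" and z: "z \<in> Z" "v \<otimes> z \<in> Z" for v z
      unfolding tv_close_def
    proof (intro allI impI)
      fix u :: "'a \<Rightarrow> real" assume u: "\<forall>x. \<bar>u x\<bar> \<le> 1"
      have ex: "measure_pmf.expectation (\<psi> y) u = (\<Sum>\<gamma>\<in>D. w y \<gamma> / W y * u \<gamma>)" if y: "y \<in> Z" for y
      proof -
        have y': "y \<in> carrier G" "0 < W y" using y Zc W_ge[OF y] by auto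
        have "set_pmf (\<psi> y) \<subseteq> D"
          using y' pmf_\<psi>[OF y'] D_sup[OF y] by (auto simp: set_pmf_iff)
        then have "measure_pmf.expectation (\<psi> y) u = (\<Sum>\<gamma>\<in>D. pmf (\<psi> y) \<gamma> *\<^sub>R u \<gamma>)"
          by (intro integral_measure_pmf[OF D]) auto
        then show ?thesis using pmf_\<psi>[OF y'] by simp
      qed
      have vz: "(v, z) \<in> O'" using v z V by blast
      have small: "\<bar>w (v \<otimes> z) \<gamma> - w z \<gamma>\<bar> \<le> d" if \<gamma>: "\<gamma> \<in> D" for \<gamma>
      proof -
        have "(v, z) \<in> ?N \<gamma>" using \<gamma> vz unfolding O'_def by blast
        then show ?thesis using \<gamma> by (simp add: w_def D_def abs_le_iff)
      qed
      note WD = W_eq[OF D D_sup]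
      have "\<bar>measure_pmf.expectation (\<psi> (v \<otimes> z)) u - measure_pmf.expectation (\<psi> z) u\<bar>
          = \<bar>\<Sum>\<gamma>\<in>D. (w (v \<otimes> z) \<gamma> / W (v \<otimes> z) - w z \<gamma> / W z) * u \<gamma>\<bar>"
        using ex z by (simp add: sum_subtractf left_diff_distrib)
      also have "\<dots> \<le> (\<Sum>\<gamma>\<in>D. \<bar>w (v \<otimes> z) \<gamma> / W (v \<otimes> z) - w z \<gamma> / W z\<bar> * \<bar>u \<gamma>\<bar>)"
        using sum_abs[of "\<lambda>\<gamma>. (w (v \<otimes> z) \<gamma> / W (v \<otimes> z) - w z \<gamma> / W z) * u \<gamma>" D] by (simp add: abs_mult)
      also have "\<dots> \<le> (\<Sum>\<gamma>\<in>D. \<bar>w (v \<otimes> z) \<gamma> / W (v \<otimes> z) - w z \<gamma> / W z\<bar>)"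
        using u by (intro sum_mono mult_right_le_one_le) auto
      also have "\<dots> \<le> 2 * (\<Sum>\<gamma>\<in>D. \<bar>w (v \<otimes> z) \<gamma> - w z \<gamma>\<bar>)"
        using sum_normalized_diff_le[of D "w z" "w (v \<otimes> z)"] w_nonneg z Zc W_ge WD by (simp add: subset_iff)
      also have "\<dots> \<le> 2 * (\<Sum>\<gamma>\<in>D. d)" using small by (intro mult_left_mono sum_mono) auto
      also have "\<dots> \<le> e" using e by (simp add: d_def field_simps)
      finally show "\<bar>measure_pmf.expectation (\<psi> (v \<otimes> z)) u - measure_pmf.expectation (\<psi> z) u\<bar> \<le> e" .
    qed
    then show "\<exists>V. openin T V \<and> \<one> \<in> V \<and> (\<forall>v\<in>V. \<forall>z\<in>Z. v \<otimes> z \<in> Z \<longrightarrow> tv_close e (\<psi> (v \<otimes> z)) (\<psi> z))"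
      using V by (intro exI[of _ V]) auto
  qed
qed


lemma compact_finite_right_translates:
  assumes K: "compactin T K" and U: "openin T U" "\<one> \<in> U"
  obtains F where "finite F" "F \<subseteq> K" "K \<subseteq> (\<Union>x\<in>F. U #> x)"
proof -
  have Kc: "K \<subseteq> carrier G" by (rule compact_subset_carrier[OF K])
  have "K \<subseteq> \<Union>((\<lambda>x. U #> x) ` K)"
  proof
    fix x assume "x \<in> K"
    moreover from this have "x = \<one> \<otimes> x" using Kc by auto
    ultimately show "x \<in> \<Union>((\<lambda>x. U #> x) ` K)" using U(2) unfolding r_coset_def by blast
  qed
  moreover have "\<forall>V \<in> (\<lambda>x. U #> x) ` K. openin T V"
    using U openin_r_coset Kc by blast
  ultimately obtain \<F> where "finite \<F>" "\<F> \<subseteq> (\<lambda>x. U #> x) ` K" "K \<subseteq> \<Union>\<F>"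
    using K unfolding compactin_def by meson
  moreover from this obtain F where "finite F" "F \<subseteq> K" "\<F> = (\<lambda>x. U #> x) ` F"
    by (meson finite_subset_image)
  ultimately show thesis using that[of F] by simp
qed

text \<open>Left translations by \<open>S\<close> distort small left perturbations only by conjugation, and \<open>S\<close> is finite.\<close>

lemma small_conjugated_neighbourhood:
  assumes S: "finite S" "S \<subseteq> carrier G" and V: "openin T V" "\<one> \<in> V"
  obtains W where "openin T W" "\<one> \<in> W"
    "\<And>s w w'. s \<in> S \<Longrightarrow> w \<in> W \<Longrightarrow> w' \<in> W \<Longrightarrow> s \<otimes> inv w \<otimes> inv s \<otimes> w' \<in> V"
proof -
  obtain U where U: "openin T U" "\<one> \<in> U" "m_inv G ` U = U" "U <#> U \<subseteq> V"
    using symmetric_square_root_neighbourhood[OF V] by metis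
  have Uc: "U \<subseteq> carrier G" using U open_subset_carrier by blast
  define W where "W = U \<inter> (\<Inter>s\<in>insert \<one> S. inv s <# (U #> s))"
  have "openin T (inv s <# (U #> s))" if "s \<in> insert \<one> S" for s
    using that S U by (intro openin_l_coset openin_r_coset) auto
  then have "openin T W"
    unfolding W_def using S(1) U(1) by (intro openin_Int openin_INT2) auto
  moreover have "\<one> \<in> inv s <# (U #> s)" if "s \<in> insert \<one> S" for s
  proof -
    have "s \<in> carrier G" using that S by auto
    then have "\<one> = inv s \<otimes> (\<one> \<otimes> s)" by simp
    then show ?thesis using U(2) unfolding l_coset_def r_coset_def by blast
  qed
  then have "\<one> \<in> W" using U(2) unfolding W_def by blast
  moreover have "s \<otimes> inv w \<otimes> inv s \<otimes> w' \<in> V" if s: "s \<in> S" and w: "w \<in> W" "w' \<in> W" for s w w'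
  proof -
    have "w \<in> inv s <# (U #> s)" using s w(1) by (auto simp: W_def)
    then obtain u where u: "u \<in> U" "w = inv s \<otimes> (u \<otimes> s)" by (auto simp: l_coset_def r_coset_def)
    have c: "s \<in> carrier G" "u \<in> carrier G" using s S u Uc by auto
    have "s \<otimes> inv w \<otimes> inv s = inv u" using u c by (simp add: inv_mult_group m_assoc cancel_inv)
    moreover have "inv u \<in> U" using u(1) U(3) by blast
    moreover have "w' \<in> U" using w(2) by (simp add: W_def)
    ultimately show ?thesis using U(4) set_mult_memI by (metis subsetD)
  qed
  ultimately show thesis using that by blast
qed

text \<open>The flag space is described by right \<open>B\<close>-invariant subsets of \<open>G\<close>. On \<open>U i = W x B\<close> with \<open>x = x i\<close>, the
  kernel is the average of \<open>\<psi> (x b)\<close> over an almost invariant measure \<open>\<beta>\<close> on \<open>B\<close>. If \<open>s\<close> moves a point of \<open>U i\<close>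
  into \<open>U j\<close>, then \<open>s x i = v x j k\<close> with \<open>v\<close> close to the identity and \<open>k \<in> B\<close>. Continuity of \<open>\<psi>\<close> removes \<open>v\<close> and almost
  invariance of \<open>\<beta>\<close> removes \<open>k\<close>. There is no circularity: \<open>k\<close> ranges over a compact set \<open>K\<close> that is known
  at the start, \<open>K\<close> determines the support \<open>K'\<close> of \<open>\<beta>\<close>, and \<open>K'\<close> determines \<open>\<psi>\<close> and \<open>W\<close>; only then is the finite
  set of values of \<open>k\<close>, and with it \<open>\<beta>\<close>, fixed.\<close>

theorem approximately_equivariant_kernels:
  assumes \<Gamma>: "discrete_subgroup G T \<Gamma>"
    and B: "subgroup B G" "closedin T B" "boundedly_amenable G T B"
    and C: "compactin T C" and S: "finite S" "S \<subseteq> \<Gamma>" and e: "0 < (e :: real)"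
  obtains n :: nat and U :: "nat \<Rightarrow> 'a set" and m :: "nat \<Rightarrow> 'a pmf" where
    "\<And>i. i < n \<Longrightarrow> openin T (U i)"
    "\<And>i. i < n \<Longrightarrow> U i <#> B \<subseteq> U i"
    "C \<subseteq> (\<Union>i<n. U i)"
    "\<And>i. i < n \<Longrightarrow> finite (set_pmf (m i)) \<and> set_pmf (m i) \<subseteq> \<Gamma>"
    "\<And>s i j y. s \<in> S \<Longrightarrow> i < n \<Longrightarrow> j < n \<Longrightarrow> y \<in> U i \<Longrightarrow> s \<otimes> y \<in> U j \<Longrightarrow>
      tv_close e (map_pmf (\<lambda>x. s \<otimes> x) (m i)) (m j)"
proof -
  have sub: "subgroup \<Gamma> G" "\<Gamma> \<subseteq> carrier G"
    using \<Gamma> subgroup.subset[of \<Gamma> G] by (simp_all add: discrete_subgroup_def)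
  have Sc: "S \<subseteq> carrier G" using S(2) sub(2) by blast
  have Cc: "C \<subseteq> carrier G" by (rule compact_subset_carrier[OF C])
  have Bc: "B \<subseteq> carrier G" by (rule subgroup.subset[OF B(1)])
  obtain O0 V0 where V0: "openin T O0" "compactin T V0" "\<one> \<in> O0" "O0 \<subseteq> V0"
    by (rule compact_neighbourhood_one)
  have V0c: "V0 \<subseteq> carrier G" by (rule compact_subset_carrier[OF V0(2)])
  \<comment> \<open>The elements \<open>k \<in> B\<close> with \<open>s x = v y k\<close> for some \<open>x, y \<in> C\<close> and \<open>v \<in> V0\<close>.\<close>
  define K where "K = B \<inter> (m_inv G ` C <#> (m_inv G ` V0 <#> (S <#> C)))"
  have "compactin T S" using S(1) Sc by (intro finite_imp_compactin) (auto simp: topspace_eq)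
  then have K: "compactin T K"
    unfolding K_def using C V0(2)
    by (intro closed_Int_compactin[OF B(2)] compactin_set_mult compactin_inv_image)
  have "K \<subseteq> B" by (simp add: K_def)
  have e2: "0 < e / 2" using e by simp
  obtain K' where K': "compactin T K'" "K' \<subseteq> B" and \<beta>_ex: "\<And>E. finite E \<Longrightarrow> E \<subseteq> K \<Longrightarrow>
      \<exists>\<beta>. almost_invariant_in G K' (e / 2) E \<beta>"
    by (rule boundedly_amenableE[OF B(3) K \<open>K \<subseteq> B\<close> e2]) blast
  define K1 where "K1 = insert \<one> K"
  \<comment> \<open>All points at which \<open>\<psi>\<close> will be evaluated or compared.\<close>
  define Z where "Z = V0 <#> (C <#> (K1 <#> K'))"
  have K1: "compactin T K1"
    unfolding K1_def using K compactin_Un[of T "{\<one>}" K] by (simp add: topspace_eq)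
  have Z: "compactin T Z" unfolding Z_def by (intro compactin_set_mult V0 C K1 K')
  have K1c: "K1 \<subseteq> carrier G" "K' \<subseteq> carrier G"
    using K1 K' by (simp_all add: compact_subset_carrier)
  have Z_mem: "v \<otimes> (x \<otimes> (k \<otimes> b)) \<in> Z" if "v \<in> V0" "x \<in> C" "k \<in> K1" "b \<in> K'" for v x k b
    using that unfolding Z_def by (intro set_mult_memI)
  obtain \<psi> :: "'a \<Rightarrow> 'a pmf" where
    \<psi>_set: "\<And>y. y \<in> Z \<Longrightarrow> finite (set_pmf (\<psi> y)) \<and> set_pmf (\<psi> y) \<subseteq> \<Gamma>"
    and \<psi>_shift: "\<And>\<gamma> y. \<gamma> \<in> \<Gamma> \<Longrightarrow> y \<in> Z \<Longrightarrow> \<psi> (\<gamma> \<otimes> y) = map_pmf (\<lambda>x. \<gamma> \<otimes> x) (\<psi> y)"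
    and \<psi>_cont: "\<And>e. 0 < e \<Longrightarrow> \<exists>V. openin T V \<and> \<one> \<in> V \<and>
      (\<forall>v\<in>V. \<forall>z\<in>Z. v \<otimes> z \<in> Z \<longrightarrow> tv_close e (\<psi> (v \<otimes> z)) (\<psi> z))"
    by (rule equivariant_kernel[OF \<Gamma> Z]) blast
  obtain V1 where V1: "openin T V1" "\<one> \<in> V1"
    and close: "\<And>v z. v \<in> V1 \<Longrightarrow> z \<in> Z \<Longrightarrow> v \<otimes> z \<in> Z \<Longrightarrow> tv_close (e / 2) (\<psi> (v \<otimes> z)) (\<psi> z)"
    using \<psi>_cont[OF e2] by blast
  define V where "V = V1 \<inter> O0"
  have V: "openin T V" "\<one> \<in> V" using V1 V0 by (simp_all add: V_def openin_Int)
  obtain W where W: "openin T W" "\<one> \<in> W"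
    and W_conj: "\<And>s w w'. s \<in> S \<Longrightarrow> w \<in> W \<Longrightarrow> w' \<in> W \<Longrightarrow> s \<otimes> inv w \<otimes> inv s \<otimes> w' \<in> V"
    using small_conjugated_neighbourhood[OF S(1) Sc V] by metis
  have Wc: "W \<subseteq> carrier G" by (rule open_subset_carrier[OF W(1)])
  obtain F where F: "finite F" "F \<subseteq> C" "C \<subseteq> (\<Union>x\<in>F. W #> x)"
    using compact_finite_right_translates[OF C W] by metis
  obtain xs where xs: "set xs = F" using F(1) finite_list by blast
  define n where "n = length xs"
  define x where "x = (\<lambda>i. xs ! i)"
  have x: "x i \<in> C" "x i \<in> carrier G" if "i < n" for i
    using that xs F(2) Cc by (auto simp: n_def x_def subset_iff)
  define U where "U = (\<lambda>i. (W #> x i) <#> B)"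
  have transfer: "\<exists>k\<in>K. \<exists>v\<in>V. s \<otimes> x i = v \<otimes> (x j \<otimes> k)"
    if s: "s \<in> S" and ij: "i < n" "j < n" and y: "y \<in> U i" "s \<otimes> y \<in> U j" for s i j y
  proof -
    obtain w b where wb: "w \<in> W" "b \<in> B" "y = w \<otimes> x i \<otimes> b"
      using y(1) unfolding U_def set_mult_def r_coset_def by blast
    obtain w' b' where wb': "w' \<in> W" "b' \<in> B" "s \<otimes> y = w' \<otimes> x j \<otimes> b'"
      using y(2) unfolding U_def set_mult_def r_coset_def by blast
    have c: "s \<in> carrier G" "w \<in> carrier G" "w' \<in> carrier G" "b \<in> carrier G" "b' \<in> carrier G"
      "x i \<in> carrier G" "x j \<in> carrier G"
      using s Sc wb wb' Wc Bc x ij by auto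
    define v where "v = s \<otimes> inv w \<otimes> inv s \<otimes> w'"
    define k where "k = b' \<otimes> inv b"
    have v: "v \<in> V" unfolding v_def by (rule W_conj[OF s wb(1) wb'(1)])
    have vc: "v \<in> carrier G" using v open_subset_carrier[OF V(1)] by blast
    have "s \<otimes> x i = s \<otimes> inv w \<otimes> inv s \<otimes> ((s \<otimes> y) \<otimes> inv b)"
      using wb c by (simp add: m_assoc cancel_inv)
    also have "\<dots> = v \<otimes> (x j \<otimes> k)"
      unfolding wb'(3) v_def k_def using c by (simp add: m_assoc)
    finally have eq: "s \<otimes> x i = v \<otimes> (x j \<otimes> k)" .
    have kB: "k \<in> B" unfolding k_def using wb wb' B(1) by (simp add: subgroup.m_closed subgroup.m_inv_closed)
    then have kc: "k \<in> carrier G" using Bc by blast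
    have "k = inv (x j) \<otimes> (inv v \<otimes> (s \<otimes> x i))"
      unfolding eq using vc kc c by (simp add: cancel_inv)
    moreover have "\<dots> \<in> m_inv G ` C <#> (m_inv G ` V0 <#> (S <#> C))"
      using v V0(4) s x ij by (intro set_mult_memI imageI) (auto simp: V_def)
    ultimately have "k \<in> K" using kB by (simp add: K_def)
    then show ?thesis using v eq by blast
  qed
  define P where "P = {(s, i, j). s \<in> S \<and> i < n \<and> j < n \<and> (\<exists>k\<in>K. \<exists>v\<in>V. s \<otimes> x i = v \<otimes> (x j \<otimes> k))}"
  have "finite P"
    by (rule finite_subset[of _ "S \<times> {..<n} \<times> {..<n}"]) (use S(1) in \<open>auto simp: P_def\<close>)
  have "\<forall>p\<in>P. \<exists>k. k \<in> K \<and> (\<exists>v\<in>V. fst p \<otimes> x (fst (snd p)) = v \<otimes> (x (snd (snd p)) \<otimes> k))"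
    by (auto simp: P_def)
  then obtain \<kappa> where \<kappa>: "\<forall>p\<in>P. \<kappa> p \<in> K \<and> (\<exists>v\<in>V. fst p \<otimes> x (fst (snd p)) = v \<otimes> (x (snd (snd p)) \<otimes> \<kappa> p))"
    by (rule bchoice[THEN exE])
  have "finite (\<kappa> ` P)" "\<kappa> ` P \<subseteq> K" using \<open>finite P\<close> \<kappa> by auto
  from \<beta>_ex[OF this] obtain \<beta> where \<beta>: "finite (set_pmf \<beta>)" "set_pmf \<beta> \<subseteq> K'"
    and \<beta>_close: "\<forall>k\<in>\<kappa> ` P. tv_close (e / 2) (map_pmf (\<lambda>y. k \<otimes> y) \<beta>) \<beta>"
    by (elim exE conjE)
  define m where "m = (\<lambda>i. bind_pmf \<beta> (\<lambda>b. \<psi> (x i \<otimes> b)))"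
  have one_V0: "\<one> \<in> V0" using V0 by blast
  have xb_Z: "x i \<otimes> b \<in> Z" if "i < n" "b \<in> set_pmf \<beta>" for i b
  proof -
    have "b \<in> K'" using that \<beta> by blast
    then have "b \<in> carrier G" using K1c by blast
    then show ?thesis
      using Z_mem[OF one_V0 x(1)[OF that(1)] _ \<open>b \<in> K'\<close>, of \<one>] x(2)[OF that(1)] by (simp add: K1_def)
  qed
  show thesis
  proof (rule that[of n U m])
    show "openin T (U i)" if "i < n" for i
      unfolding U_def using x(2)[OF that] W(1) Bc by (intro openin_set_mult_left openin_r_coset)
    show "U i <#> B \<subseteq> U i" if "i < n" for i
    proof -
      have "W #> x i \<subseteq> carrier G" using r_coset_subset_G[OF Wc x(2)[OF that]] .
      then have "U i <#> B = U i" unfolding U_def using set_mult_assoc[OF _ Bc Bc] subgroup_mult_id[OF B(1)] by simp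
      then show ?thesis by simp
    qed
    show "C \<subseteq> (\<Union>i<n. U i)"
    proof
      fix y assume y: "y \<in> C"
      then obtain i where i: "i < n" "y \<in> W #> x i"
        using F(3) xs by (auto simp: n_def x_def in_set_conv_nth dest!: subsetD)
      have "W #> x i \<subseteq> U i" unfolding U_def
        using r_coset_subset_G[OF Wc x(2)[OF i(1)]] by (intro subset_saturation[OF B(1)])
      then show "y \<in> (\<Union>i<n. U i)" using i by blast
    qed
    show "finite (set_pmf (m i)) \<and> set_pmf (m i) \<subseteq> \<Gamma>" if "i < n" for i
      unfolding m_def using \<beta>(1) \<psi>_set[OF xb_Z[OF that]] by auto
    fix s i j y assume s: "s \<in> S" and ij: "i < n" "j < n" and y: "y \<in> U i" "s \<otimes> y \<in> U j"
    define k where "k = \<kappa> (s, i, j)"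
    have p: "(s, i, j) \<in> P" using transfer[OF s ij y] s ij by (simp add: P_def)
    obtain v where v: "v \<in> V" "s \<otimes> x i = v \<otimes> (x j \<otimes> k)" using \<kappa> p by (force simp: k_def)
    have kK: "k \<in> K" using \<kappa> p by (auto simp: k_def)
    have c: "s \<in> carrier G" "x i \<in> carrier G" "x j \<in> carrier G" "v \<in> carrier G" "k \<in> carrier G"
      using s Sc x ij v(1) open_subset_carrier[OF V(1)] kK compact_subset_carrier[OF K] by auto
    have s\<Gamma>: "s \<in> \<Gamma>" using s S(2) by blast
    have "map_pmf (\<lambda>x. s \<otimes> x) (m i) = bind_pmf \<beta> (\<lambda>b. \<psi> (v \<otimes> (x j \<otimes> (k \<otimes> b))))"
      unfolding m_def map_bind_pmf
    proof (rule bind_pmf_cong[OF refl])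
      fix b assume b: "b \<in> set_pmf \<beta>"
      have bc: "b \<in> carrier G" using b \<beta> K1c by blast
      have "map_pmf (\<lambda>x. s \<otimes> x) (\<psi> (x i \<otimes> b)) = \<psi> (s \<otimes> (x i \<otimes> b))"
        by (rule \<psi>_shift[OF s\<Gamma> xb_Z[OF ij(1) b], symmetric])
      also have "s \<otimes> (x i \<otimes> b) = v \<otimes> (x j \<otimes> (k \<otimes> b))"
        using v(2) c bc by (metis m_assoc m_closed)
      finally show "map_pmf (\<lambda>x. s \<otimes> x) (\<psi> (x i \<otimes> b)) = \<psi> (v \<otimes> (x j \<otimes> (k \<otimes> b)))" .
    qed
    moreover have "tv_close (e / 2) \<dots> (bind_pmf \<beta> (\<lambda>b. \<psi> (x j \<otimes> (k \<otimes> b))))"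
    proof (intro tv_close_bind_kernel close)
      fix b assume "b \<in> set_pmf \<beta>"
      then have b: "b \<in> K'" "b \<in> carrier G" using \<beta> K1c by auto
      have k1: "k \<in> K1" using kK by (simp add: K1_def)
      show "v \<in> V1" using v by (simp add: V_def)
      show "x j \<otimes> (k \<otimes> b) \<in> Z" using Z_mem[OF one_V0 x(1)[OF ij(2)] k1 b(1)] c b by simp
      show "v \<otimes> (x j \<otimes> (k \<otimes> b)) \<in> Z"
        using v V0(4) by (intro Z_mem x ij k1 b) (auto simp: V_def)
    qed
    moreover have "bind_pmf \<beta> (\<lambda>b. \<psi> (x j \<otimes> (k \<otimes> b))) = bind_pmf (map_pmf (\<lambda>y. k \<otimes> y) \<beta>) (\<lambda>b. \<psi> (x j \<otimes> b))"
      by (simp add: bind_map_pmf)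
    moreover have "tv_close (e / 2) \<dots> (m j)"
      unfolding m_def using \<beta>_close p by (intro tv_close_bind) (auto simp: k_def)
    ultimately show "tv_close e (map_pmf (\<lambda>x. s \<otimes> x) (m i)) (m j)"
      using tv_close_trans[of "e / 2" _ _ "e / 2"] by simp
  qed
qed

end

section \<open>Tangents of a convex function\<close>

text \<open>A subgradient of \<open>f\<close> at \<open>u\<close>. For convex \<open>f\<close> and \<open>u > 0\<close> there is one, but it is unique only where \<open>f\<close> is
  differentiable.\<close>

definition tangent_slope :: "(real \<Rightarrow> real) \<Rightarrow> real \<Rightarrow> real" where
  "tangent_slope f u = (SOME a. \<forall>t>0. f u + a * (t - u) \<le> f t)"

definition affine_minorant :: "(real \<Rightarrow> real) \<Rightarrow> real \<Rightarrow> real \<Rightarrow> bool" where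
  "affine_minorant f a b \<longleftrightarrow> (\<forall>t>0. a * t + b \<le> f t)"

context
  fixes f :: "real \<Rightarrow> real"
  assumes convex: "convex_on {0<..} f"
begin

lemma tangent_below:
  assumes "0 < u" "0 < t"
  shows "f u + tangent_slope f u * (t - u) \<le> f t"
proof -
  let ?L = "(\<lambda>s. (f u - f s) / (u - s)) ` {0<..<u}"
  have slope: "(f u - f s) / (u - s) \<le> (f r - f u) / (r - u)" if s: "0 < s" "s < u" and r: "u < r" for s r
  proof -
    have "(f s - f u) / (s - u) \<le> (f u - f r) / (u - r)"
      using convex_on_slope_le[OF convex, of s r u] s r by simp
    then show ?thesis by (metis minus_diff_eq minus_divide_divide)
  qed
  have ne: "?L \<noteq> {}" using assms(1) by (auto intro: exI[of _ "u / 2"])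
  have bdd: "bdd_above ?L"
    using slope[of _ "u + 1"] by (intro bdd_aboveI[of _ "(f (u + 1) - f u) / (u + 1 - u)"]) auto
  have "\<forall>t>0. f u + Sup ?L * (t - u) \<le> f t"
  proof (intro allI impI)
    fix t :: real assume t: "0 < t"
    consider "t < u" | "t = u" | "u < t" by linarith
    then show "f u + Sup ?L * (t - u) \<le> f t"
    proof cases
      case 1
      have "(f u - f t) / (u - t) \<le> Sup ?L" using 1 t by (intro cSup_upper[OF _ bdd]) auto
      then show ?thesis using 1 by (simp add: divide_le_eq algebra_simps)
    next
      case 3
      have "Sup ?L \<le> (f t - f u) / (t - u)" using slope 3 by (intro cSup_least[OF ne]) auto
      then show ?thesis using 3 by (simp add: le_divide_eq algebra_simps)
    qed simp
  qed
  then have "\<forall>t>0. f u + tangent_slope f u * (t - u) \<le> f t"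
    unfolding tangent_slope_def by (rule someI)
  then show ?thesis using assms(2) by blast
qed

lemma affine_minorant_tangent:
  assumes "0 < u"
  shows "affine_minorant f (tangent_slope f u) (f u - tangent_slope f u * u)"
  unfolding affine_minorant_def
proof (intro allI impI)
  fix t :: real assume "0 < t"
  from tangent_below[OF assms this]
  show "tangent_slope f u * t + (f u - tangent_slope f u * u) \<le> f t" by (simp add: algebra_simps)
qed

lemma tangent_slope_mono:
  assumes "0 < u" "u \<le> v"
  shows "tangent_slope f u \<le> tangent_slope f v"
proof (cases "u = v")
  case False
  then have "u < v" using assms by simp
  have "f u + tangent_slope f u * (v - u) \<le> f v" "f v + tangent_slope f v * (u - v) \<le> f u"
    using tangent_below assms by simp_all
  then have "tangent_slope f u * (v - u) \<le> tangent_slope f v * (v - u)" by (simp add: algebra_simps)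
  then show ?thesis using \<open>u < v\<close> by simp
qed simp

lemma isCont_convex: "0 < t \<Longrightarrow> isCont f t"
  using convex_on_continuous[OF open_greaterThan convex] by (simp add: continuous_on_eq_continuous_at open_greaterThan)

text \<open>By continuity of \<open>f\<close> and monotonicity of the slopes, the tangents at positive rational points suffice.
  The tangent at \<open>1\<close> comes first, because it serves to normalise \<open>f\<close>.\<close>

lemma countable_tangents:
  obtains u :: "nat \<Rightarrow> real" where "u 0 = 1" "\<And>n. 0 < u n"
    "\<And>t. 0 < t \<Longrightarrow> (SUP n. ereal (tangent_slope f (u n) * t + (f (u n) - tangent_slope f (u n) * u n))) = ereal (f t)"
proof -
  define S where "S = {r \<in> \<rat>. 0 < (r::real)}"
  have S: "S \<noteq> {}" "countable S" by (auto simp: S_def countable_rat intro: countable_Collect exI[of _ 1])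
  define u where "u = (\<lambda>n. case n of 0 \<Rightarrow> 1 | Suc n \<Rightarrow> from_nat_into S n)"
  have u_S: "u n \<in> S" for n
    using from_nat_into[OF S(1)] by (auto simp: u_def S_def split: nat.splits)
  have u_range: "\<exists>n. r = u n" if r: "r \<in> S" for r
  proof -
    obtain n where "from_nat_into S n = r" using from_nat_into_surj[OF S(2) r] by blast
    then show ?thesis by (intro exI[of _ "Suc n"]) (simp add: u_def)
  qed
  have sup: "(SUP n. ereal (tangent_slope f (u n) * t + (f (u n) - tangent_slope f (u n) * u n))) = ereal (f t)"
    if t: "0 < t" for t
  proof (rule antisym)
    show "(SUP n. ereal (tangent_slope f (u n) * t + (f (u n) - tangent_slope f (u n) * u n))) \<le> ereal (f t)"
      using tangent_below[OF _ t] u_S by (intro SUP_least) (auto simp: S_def algebra_simps)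
    show "ereal (f t) \<le> (SUP n. ereal (tangent_slope f (u n) * t + (f (u n) - tangent_slope f (u n) * u n)))"
    proof (rule ereal_le_epsilon2)
      fix e :: real assume e: "0 < e"
      define M where "M = max \<bar>tangent_slope f t\<bar> \<bar>tangent_slope f (2 * t)\<bar>"
      have "((\<lambda>r. f r - M * \<bar>r - t\<bar>) \<longlongrightarrow> f t - M * \<bar>t - t\<bar>) (at t)"
        using isCont_convex[OF t] by (intro tendsto_intros) (simp add: isCont_def)
      then have "\<forall>\<^sub>F r in at t. f t - e < f r - M * \<bar>r - t\<bar>"
        using e by (intro order_tendstoD(1)) auto
      then obtain d where d: "0 < d" "\<And>r. r \<noteq> t \<Longrightarrow> dist r t < d \<Longrightarrow> f t - e < f r - M * \<bar>r - t\<bar>"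
        unfolding eventually_at by blast
      obtain r where r: "r \<in> \<rat>" "t < r" "r < t + min d t"
        using Rats_dense_in_real[of t "t + min d t"] d(1) t by auto
      then obtain n where n: "r = u n" using u_range[of r] t by (auto simp: S_def)
      have "tangent_slope f t \<le> tangent_slope f r" "tangent_slope f r \<le> tangent_slope f (2 * t)"
        using r t by (auto intro!: tangent_slope_mono)
      then have "\<bar>tangent_slope f r\<bar> \<le> M" by (auto simp: M_def)
      then have "\<bar>tangent_slope f r * (t - r)\<bar> \<le> M * \<bar>r - t\<bar>"
        by (simp add: abs_mult abs_minus_commute mult_right_mono)
      moreover have "f t - e < f r - M * \<bar>r - t\<bar>" using d(2)[of r] r by (simp add: dist_real_def)
      ultimately have "f t \<le> tangent_slope f r * t + (f r - tangent_slope f r * r) + e"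
        by (simp add: algebra_simps abs_le_iff)
      then have "ereal (f t) \<le> ereal (tangent_slope f (u n) * t + (f (u n) - tangent_slope f (u n) * u n)) + ereal e"
        by (simp add: n)
      also have "\<dots> \<le> (SUP n. ereal (tangent_slope f (u n) * t + (f (u n) - tangent_slope f (u n) * u n))) + ereal e"
        by (intro add_right_mono SUP_upper) simp
      finally show "ereal (f t) \<le> (SUP n. ereal (tangent_slope f (u n) * t + (f (u n) - tangent_slope f (u n) * u n))) + ereal e" .
    qed
  qed
  show thesis
    using that[of u] u_S sup by (auto simp: u_def S_def)
qed

text \<open>The two values that extend \<open>f\<close> to the boundary, its limit at \<open>0\<close> and its slope at infinity, are the
  suprema of the intercepts and of the slopes of the same countable family of tangents. The upper bounds hold
  because a tangent at a point above \<open>1\<close> lies below the tangent at \<open>1\<close> on \<open>(0, 1)\<close>, and symmetrically.\<close>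

lemma exhausting_minorants:
  assumes f1: "f 1 = 0"
  obtains a b :: "nat \<Rightarrow> real" where
    "\<And>n. affine_minorant f (a n) (b n)" "b 0 = - a 0"
    "\<And>t. 0 < t \<Longrightarrow> (SUP n. ereal (a n * t + b n)) = ereal (f t)"
    "((\<lambda>s. ereal (f s)) \<longlongrightarrow> (SUP n. ereal (b n))) (at_right 0)"
    "((\<lambda>t. ereal (f t / t)) \<longlongrightarrow> (SUP n. ereal (a n))) at_top"
proof -
  obtain u :: "nat \<Rightarrow> real" where u: "u 0 = 1" "\<And>n. 0 < u n"
    and sup: "\<And>t. 0 < t \<Longrightarrow> (SUP n. ereal (tangent_slope f (u n) * t + (f (u n) - tangent_slope f (u n) * u n))) = ereal (f t)"
    by (rule countable_tangents) blast
  define a where "a = (\<lambda>n. tangent_slope f (u n))"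
  define b where "b = (\<lambda>n. f (u n) - a n * u n)"
  have minorant: "affine_minorant f (a n) (b n)" for n
    unfolding a_def b_def by (rule affine_minorant_tangent[OF u(2)])
  have ab: "a n * t + b n \<le> f t" if "0 < t" for n t
    using minorant[of n] that by (simp add: affine_minorant_def)
  have sup': "(SUP n. ereal (a n * t + b n)) = ereal (f t)" if "0 < t" for t
    using sup[OF that] by (simp add: a_def b_def)
  have ab1: "a n + b n \<le> 0" for n using ab[of 1 n] f1 by simp
  have b0: "b 0 = - a 0" using u(1) f1 by (simp add: b_def)
  have a_le: "a n \<le> a 0" if "u n \<le> 1" for n using that u tangent_slope_mono[of "u n" 1] by (simp add: a_def)
  have a_ge: "a 0 \<le> a n" if "1 \<le> u n" for n using that u tangent_slope_mono[of 1 "u n"] by (simp add: a_def)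
  have 1: "((\<lambda>s. ereal (f s)) \<longlongrightarrow> (SUP n. ereal (b n))) (at_right 0)"
  proof (rule order_tendstoI)
    fix y assume "y < (SUP n. ereal (b n))"
    then obtain n where n: "y < ereal (b n)" by (auto simp: less_SUP_iff)
    have "((\<lambda>s. ereal (a n * s + b n)) \<longlongrightarrow> ereal (a n * 0 + b n)) (at_right 0)"
      by (intro tendsto_intros)
    then have "\<forall>\<^sub>F s in at_right 0. y < ereal (a n * s + b n)" using n by (intro order_tendstoD(1)) auto
    moreover have "\<forall>\<^sub>F s::real in at_right 0. 0 < s" by (simp add: eventually_at_right_less)
    ultimately show "\<forall>\<^sub>F s in at_right 0. y < ereal (f s)"
      by eventually_elim (use ab in \<open>auto intro: less_le_trans\<close>)
  next
    fix y assume y: "(SUP n. ereal (b n)) < y"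
    have "(SUP n. ereal (b n)) \<noteq> - \<infinity>" using SUP_upper[of 0 UNIV "\<lambda>n. ereal (b n)"] by auto
    then obtain r where r: "(SUP n. ereal (b n)) = ereal r" using y by (cases "SUP n. ereal (b n)") auto
    have br: "b n \<le> r" for n using SUP_upper[of n UNIV "\<lambda>n. ereal (b n)"] r by simp
    have le: "f s \<le> a 0 * s + r" if s: "0 < s" "s < 1" for s
    proof -
      have "a n * s + b n \<le> a 0 * s + r" for n
      proof (cases "u n \<le> 1")
        case True
        then show ?thesis using a_le br s by (intro add_mono mult_right_mono) auto
      next
        case False
        have "a n * s + b n \<le> - (a n * (1 - s))" using ab1[of n] by (simp add: algebra_simps)
        also have "\<dots> \<le> - (a 0 * (1 - s))" using a_ge[of n] False s by (simp add: mult_right_mono)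
        also have "\<dots> \<le> a 0 * s + r" using br[of 0] b0 by (simp add: algebra_simps)
        finally show ?thesis .
      qed
      then have "ereal (f s) \<le> ereal (a 0 * s + r)" unfolding sup'[OF s(1), symmetric] by (intro SUP_least) simp
      then show ?thesis by simp
    qed
    have "((\<lambda>s. ereal (a 0 * s + r)) \<longlongrightarrow> ereal (a 0 * 0 + r)) (at_right 0)"
      by (intro tendsto_intros)
    then have "\<forall>\<^sub>F s in at_right 0. ereal (a 0 * s + r) < y" using y r by (intro order_tendstoD(2)) auto
    moreover have "\<forall>\<^sub>F s::real in at_right 0. s \<in> {0<..<1}" by (rule eventually_at_right_real) simp
    ultimately show "\<forall>\<^sub>F s in at_right 0. ereal (f s) < y"
      by eventually_elim (use le in \<open>auto intro: le_less_trans[rotated]\<close>)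
  qed
  have 2: "((\<lambda>t. ereal (f t / t)) \<longlongrightarrow> (SUP n. ereal (a n))) at_top"
  proof (rule order_tendstoI)
    fix y assume "y < (SUP n. ereal (a n))"
    then obtain n where n: "y < ereal (a n)" by (auto simp: less_SUP_iff)
    have "((\<lambda>t. ereal (a n + b n / t)) \<longlongrightarrow> ereal (a n + 0)) at_top"
      by (intro tendsto_intros tendsto_divide_0[OF tendsto_const] filterlim_at_top_imp_at_infinity filterlim_ident)
    then have "\<forall>\<^sub>F t in at_top. y < ereal (a n + b n / t)" using n by (intro order_tendstoD(1)) auto
    moreover have "\<forall>\<^sub>F t::real in at_top. 0 < t" by (rule eventually_gt_at_top)
    ultimately show "\<forall>\<^sub>F t in at_top. y < ereal (f t / t)"
    proof eventually_elim
      case (elim t)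
      have "a n + b n / t = (a n * t + b n) / t" using elim(2) by (simp add: field_simps)
      also have "\<dots> \<le> f t / t" using ab[of t n] elim(2) by (intro divide_right_mono) auto
      finally have "a n + b n / t \<le> f t / t" .
      then show ?case using elim(1) by (auto intro: less_le_trans)
    qed
  next
    fix y assume y: "(SUP n. ereal (a n)) < y"
    have "(SUP n. ereal (a n)) \<noteq> - \<infinity>" using SUP_upper[of 0 UNIV "\<lambda>n. ereal (a n)"] by auto
    then obtain r where r: "(SUP n. ereal (a n)) = ereal r" using y by (cases "SUP n. ereal (a n)") auto
    have ar: "a n \<le> r" for n using SUP_upper[of n UNIV "\<lambda>n. ereal (a n)"] r by simp
    have le: "f t \<le> r * t - a 0" if t: "1 < t" for t
    proof -
      have "a n * t + b n \<le> r * t - a 0" for n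
      proof (cases "u n \<le> 1")
        case True
        have "a n * t + b n \<le> a n * (t - 1)" using ab1[of n] by (simp add: algebra_simps)
        also have "\<dots> \<le> a 0 * (t - 1)" using a_le[OF True] t by (simp add: mult_right_mono)
        also have "\<dots> \<le> r * t - a 0" using mult_right_mono[OF ar[of 0], of t] t by (simp add: algebra_simps)
        finally show ?thesis .
      next
        case False
        then have "b n \<le> - a 0" using ab1[of n] a_ge[of n] by simp
        moreover have "a n * t \<le> r * t" using ar[of n] t by (simp add: mult_right_mono)
        ultimately show ?thesis by linarith
      qed
      then have "ereal (f t) \<le> ereal (r * t - a 0)" unfolding sup'[OF less_trans[OF zero_less_one t], symmetric]
        by (intro SUP_least) simp
      then show ?thesis by simp
    qed
    have "((\<lambda>t. ereal (r - a 0 / t)) \<longlongrightarrow> ereal (r - 0)) at_top"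
      by (intro tendsto_intros tendsto_divide_0[OF tendsto_const] filterlim_at_top_imp_at_infinity filterlim_ident)
    then have "\<forall>\<^sub>F t in at_top. ereal (r - a 0 / t) < y" using y r by (intro order_tendstoD(2)) auto
    moreover have "\<forall>\<^sub>F t::real in at_top. 1 < t" by (rule eventually_gt_at_top)
    ultimately show "\<forall>\<^sub>F t in at_top. ereal (f t / t) < y"
    proof eventually_elim
      case (elim t)
      have "f t / t \<le> r - a 0 / t" using le[OF elim(2)] elim(2) by (simp add: field_simps)
      then show ?case using elim(1) by (auto intro: le_less_trans[rotated])
    qed
  qed
  show thesis using that[of a b, OF minorant b0 sup' 1 2] .
qed

end

section \<open>Densities of two probability measures\<close>

lemma space_sum_measure: "space (sum_measure P Q) = space P"
  and sets_sum_measure: "sets (sum_measure P Q) = sets P"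
  by (simp_all add: sum_measure_def sets.space_closed space_measure_of_conv)

lemma emeasure_sum_measure:
  assumes "sets P = sets Q" "E \<in> sets P"
  shows "emeasure (sum_measure P Q) E = emeasure P E + emeasure Q E"
proof (rule emeasure_measure_of[OF sum_measure_def])
  show "sets P \<subseteq> Pow (space P)" by (rule sets.space_closed)
  show "E \<in> sets (sum_measure P Q)" using assms by (simp add: sets_sum_measure)
  show "positive (sets (sum_measure P Q)) (\<lambda>E. emeasure P E + emeasure Q E)"
    by (simp add: positive_def)
  show "countably_additive (sets (sum_measure P Q)) (\<lambda>E. emeasure P E + emeasure Q E)"
  proof (rule countably_additiveI)
    fix A :: "nat \<Rightarrow> _" assume A: "range A \<subseteq> sets (sum_measure P Q)" "disjoint_family A"
    have "range A \<subseteq> sets P" "range A \<subseteq> sets Q" using A(1) assms(1) by (simp_all add: sets_sum_measure)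
    then show "(\<Sum>i. emeasure P (A i) + emeasure Q (A i)) = emeasure P (\<Union>i. A i) + emeasure Q (\<Union>i. A i)"
      using A(2) by (simp add: suminf_add[symmetric] suminf_emeasure)
  qed
qed

locale probability_pair =
  P: prob_space P + Q: prob_space Q for P Q :: "'a measure" +
  assumes same_sets: "sets P = sets Q"
begin

definition R :: "'a measure" where "R = sum_measure P Q"
definition p :: "'a \<Rightarrow> real" where "p x = enn2real (RN_deriv R P x)"
definition q :: "'a \<Rightarrow> real" where "q x = enn2real (RN_deriv R Q x)"

lemma space_R: "space R = space P" and sets_R: "sets R = sets P"
  and space_Q: "space Q = space P"
  using sets_eq_imp_space_eq[OF same_sets] by (simp_all add: R_def space_sum_measure sets_sum_measure)

lemma emeasure_R: "E \<in> sets P \<Longrightarrow> emeasure R E = emeasure P E + emeasure Q E"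
  by (simp add: R_def emeasure_sum_measure[OF same_sets])

sublocale R: finite_measure R
proof
  show "emeasure R (space R) \<noteq> \<infinity>"
    unfolding space_R using emeasure_R[OF sets.top] space_Q P.emeasure_space_1 Q.emeasure_space_1 by simp
qed

lemma p_nonneg [simp]: "0 \<le> p x" and q_nonneg [simp]: "0 \<le> q x"
  by (simp_all add: p_def q_def)

lemma p_measurable [measurable]: "p \<in> borel_measurable R"
  and q_measurable [measurable]: "q \<in> borel_measurable R"
  by (simp_all add: p_def[abs_def] q_def[abs_def])

text \<open>Both measures are dominated by their sum, so the real-valued truncations of the Radon-Nikodym derivatives
  are densities.\<close>

lemma density_RN:
  assumes "sets M = sets R" "prob_space M" "\<And>E. E \<in> sets P \<Longrightarrow> emeasure M E \<le> emeasure R E"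
  shows "density R (\<lambda>x. ennreal (enn2real (RN_deriv R M x))) = M"
proof -
  interpret M: prob_space M by fact
  have ac: "absolutely_continuous R M"
    unfolding absolutely_continuous_def
  proof
    fix E assume "E \<in> null_sets R"
    then show "E \<in> null_sets M"
      using assms(1) assms(3)[of E] by (auto simp: null_sets_def sets_R)
  qed
  have fin: "AE x in R. RN_deriv R M x \<noteq> \<infinity>"
    by (rule R.RN_deriv_finite[OF M.sigma_finite_measure ac assms(1)])
  have "density R (\<lambda>x. ennreal (enn2real (RN_deriv R M x))) = density R (RN_deriv R M)"
    using fin by (intro density_cong) (auto elim!: eventually_mono simp: less_top)
  also have "\<dots> = M" by (rule R.density_RN_deriv[OF ac assms(1)])
  finally show ?thesis .
qed

lemma density_p: "density R p = P"
  unfolding p_def using P.prob_space_axioms emeasure_R by (intro density_RN) (auto simp: sets_R)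

lemma density_q: "density R q = Q"
  unfolding q_def using Q.prob_space_axioms emeasure_R same_sets by (intro density_RN) (auto simp: sets_R)

lemma integrable_density:
  assumes E: "E \<in> sets P"
  shows "integrable R (\<lambda>x. p x * indicator E x)" "(\<integral>x. p x * indicator E x \<partial>R) = measure P E"
    and "integrable R (\<lambda>x. q x * indicator E x)" "(\<integral>x. q x * indicator E x \<partial>R) = measure Q E"
proof -
  have ER: "E \<in> sets R" "E \<in> sets Q" using E sets_R same_sets by auto
  have "integrable (density R p) (indicator E :: _ \<Rightarrow> real)"
    unfolding density_p using E by (simp add: P.emeasure_finite less_top[symmetric])
  then show "integrable R (\<lambda>x. p x * indicator E x)"
    using ER by (subst (asm) integrable_density) auto
  have "integrable (density R q) (indicator E :: _ \<Rightarrow> real)"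
    unfolding density_q using ER by (simp add: Q.emeasure_finite less_top[symmetric])
  then show "integrable R (\<lambda>x. q x * indicator E x)"
    using ER by (subst (asm) integrable_density) auto
  have "(\<integral>x. indicator E x \<partial>density R p) = (\<integral>x. p x * indicator E x \<partial>R)"
    using ER by (subst integral_density) auto
  then show "(\<integral>x. p x * indicator E x \<partial>R) = measure P E" unfolding density_p using E by simp
  have "(\<integral>x. indicator E x \<partial>density R q) = (\<integral>x. q x * indicator E x \<partial>R)"
    using ER by (subst integral_density) auto
  then show "(\<integral>x. q x * indicator E x \<partial>R) = measure Q E" unfolding density_q using ER by simp
qed

lemma integrable_p: "integrable R p" and integrable_q: "integrable R q"
  and integral_p: "integral\<^sup>L R p = 1" and integral_q: "integral\<^sup>L R q = 1"
proof -
  have "(\<lambda>x. p x * indicator (space P) x) \<in> borel_measurable R" by (simp add: space_R[symmetric])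
  have 1: "integrable R p \<longleftrightarrow> integrable R (\<lambda>x. p x * indicator (space P) x)"
    "integrable R q \<longleftrightarrow> integrable R (\<lambda>x. q x * indicator (space P) x)"
    "integral\<^sup>L R p = (\<integral>x. p x * indicator (space P) x \<partial>R)"
    "integral\<^sup>L R q = (\<integral>x. q x * indicator (space P) x \<partial>R)"
    by (auto intro!: Bochner_Integration.integrable_cong Bochner_Integration.integral_cong simp: space_R)
  show "integrable R p" "integrable R q" "integral\<^sup>L R p = 1" "integral\<^sup>L R q = 1"
    using integrable_density[OF sets.top] P.prob_space Q.prob_space space_Q unfolding 1 by simp_all
qed

end

section \<open>The divergence as a supremum over finite partitions\<close>

lemma e2ennreal_SUP:
  fixes r :: "nat \<Rightarrow> ereal"
  shows "e2ennreal (SUP n. r n) = (SUP n. e2ennreal (r n))"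
proof -
  have "e2ennreal (Sup (range r)) = (SUP s\<in>range r. e2ennreal s)"
    by (rule continuous_at_Sup_mono)
      (auto simp: mono_def e2ennreal_mono intro!: continuous_at_imp_continuous_within continuous_at_e2ennreal)
  then show ?thesis by (simp add: image_comp o_def)
qed

text \<open>Positive and negative parts of \<open>H\<close> are related to the nonnegative function \<open>H - g\<close>, without subtracting
  infinities.\<close>

lemma ennreal_split_pos_neg:
  assumes "ereal g \<le> H"
  shows "e2ennreal H + ennreal (max 0 (- g)) =
    e2ennreal (H - ereal g) + (ennreal (max 0 g) + e2ennreal (- H))"
proof (cases H)
  case (real h)
  have pos: "e2ennreal H = ennreal (max 0 h)" "e2ennreal (- H) = ennreal (max 0 (- h))"
    using real by (auto simp: max_def ennreal_neg)
  have diff: "e2ennreal (H - ereal g) = ennreal (h - g)" using real by simp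
  have "ennreal (max 0 h) + ennreal (max 0 (- g)) = ennreal (max 0 h + max 0 (- g))"
    by (simp add: ennreal_plus)
  also have "max 0 h + max 0 (- g) = (h - g) + (max 0 g + max 0 (- h))" by (auto simp: max_def)
  also have "ennreal \<dots> = ennreal (h - g) + (ennreal (max 0 g) + ennreal (max 0 (- h)))"
    using assms real by (subst ennreal_plus) (auto simp: ennreal_plus)
  finally show ?thesis unfolding pos diff .
qed (use assms in auto)

text \<open>The passage from separately integrated positive and negative parts to the integral of a
  nonnegative function. \<open>I\<close> and \<open>w\<close> are the integrals of the positive and negative part of the integrand where \<open>q > 0\<close>,
  \<open>J\<close> that of the normalised integrand there, \<open>m\<close> the mass of \<open>P\<close> where \<open>q = 0\<close>, and \<open>S\<close> the slope at infinity.\<close>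

lemma ereal_difference_bookkeeping:
  fixes I J :: ennreal and S :: ereal
  assumes eq: "I + ennreal u = J + (ennreal v + ennreal w)"
    and nonneg: "0 \<le> u" "0 \<le> v" "0 \<le> w" "0 \<le> m" and uv: "v - u = - c * m" and S: "ereal c \<le> S"
  shows "e2ennreal (enn2ereal I - enn2ereal (ennreal w) + ereal m * S) = J + ennreal m * e2ennreal (S - ereal c)"
proof (cases J rule: ennreal_cases)
  case top
  then have "I = \<infinity>" using eq by (metis ennreal_add_eq_top ennreal_neq_top infinity_ennreal_def)
  have "ereal m * S \<noteq> - \<infinity>" using S nonneg(4) by (cases S) auto
  then have infinite: "enn2ereal I - enn2ereal (ennreal w) + ereal m * S = \<infinity>"
    using \<open>I = \<infinity>\<close> nonneg(3) by (cases "ereal m * S") auto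
  show ?thesis unfolding infinite top by simp
next
  case (real j)
  have Iu: "I + ennreal u = ennreal (j + (v + w))" using eq real nonneg by (simp add: ennreal_plus)
  then obtain i where i: "I = ennreal i" "0 \<le> i" by (cases I rule: ennreal_cases) auto
  then have "ennreal (i + u) = ennreal (j + (v + w))"
    using Iu nonneg by (simp add: ennreal_plus)
  then have "i + u = j + (v + w)" using i nonneg real by (subst (asm) ennreal_inj) auto
  then have iw: "i - w = j - c * m" using uv by (simp add: algebra_simps)
  have I: "enn2ereal I - enn2ereal (ennreal w) = ereal (j - c * m)"
    using i nonneg iw by simp
  show ?thesis
  proof (cases S)
    case (real s)
    have sum: "ereal (j - c * m) + ereal m * S = ereal (j + m * (s - c))" using real by (simp add: algebra_simps)
    have "ennreal (j + m * (s - c)) = ennreal j + ennreal m * ennreal (s - c)"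
      using S real nonneg \<open>0 \<le> j\<close> by (simp add: ennreal_plus ennreal_mult)
    then show ?thesis unfolding I sum using real \<open>J = ennreal j\<close> by simp
  next
    case PInf
    then show ?thesis
      unfolding I using \<open>J = ennreal j\<close> nonneg(4) by (cases "m = 0") (auto simp: ennreal_mult_top)
  qed (use S in auto)
qed

context probability_pair
begin

lemma perspective_eq_SUP:
  fixes a b :: "nat \<Rightarrow> real"
  assumes sup: "\<And>t. 0 < t \<Longrightarrow> (SUP n. ereal (a n * t + b n)) = ereal (f t)"
    and zero: "((\<lambda>s. ereal (f s)) \<longlongrightarrow> (SUP n. ereal (b n))) (at_right 0)"
    and xy: "0 \<le> x" "0 < (y::real)"
  shows "extended_at_zero f (x / y) * ereal y = (SUP n. ereal (a n * x + b n * y))"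
proof (cases "x = 0")
  case True
  have "extended_at_zero f 0 = (SUP n. ereal (b n))"
    unfolding extended_at_zero_def using tendsto_Lim[OF _ zero] by simp
  then have "extended_at_zero f (x / y) * ereal y = ereal y * (SUP n. ereal (b n))"
    using True by (simp add: mult.commute)
  also have "\<dots> = (SUP n. ereal y * ereal (b n))" using xy by (intro Sup_ereal_mult_left') auto
  finally show ?thesis using True by (simp add: mult.commute)
next
  case False
  then have "0 < x / y" using xy by simp
  then have "extended_at_zero f (x / y) = (SUP n. ereal (a n * (x / y) + b n))"
    using sup[OF \<open>0 < x / y\<close>] by (auto simp: extended_at_zero_def)
  then have "extended_at_zero f (x / y) * ereal y = ereal y * (SUP n. ereal (a n * (x / y) + b n))"
    by (simp only: mult.commute)
  also have "\<dots> = (SUP n. ereal y * ereal (a n * (x / y) + b n))" using xy by (intro Sup_ereal_mult_left') auto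
  also have "\<dots> = (SUP n. ereal (a n * x + b n * y))"
  proof (rule SUP_cong[OF refl])
    fix n
    have "y * (a n * (x / y) + b n) = a n * x + b n * y" using xy by (simp add: field_simps)
    then show "ereal y * ereal (a n * (x / y) + b n) = ereal (a n * x + b n * y)" by simp
  qed
  finally show ?thesis .
qed

text \<open>Subtracting the tangent \<open>c (t - 1)\<close> at \<open>1\<close> from \<open>f\<close> does not change the divergence of two probability
  measures and makes the integrand nonnegative. In this form the part where \<open>q = 0\<close> is no longer special: the
  integrand is everywhere the supremum of the same affine functions of \<open>p\<close> and \<open>q\<close>.\<close>

lemma f_divergence_eq_nn_integral:
  fixes a b :: "nat \<Rightarrow> real"
  assumes sup: "\<And>t. 0 < t \<Longrightarrow> (SUP n. ereal (a n * t + b n)) = ereal (f t)"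
    and zero: "((\<lambda>s. ereal (f s)) \<longlongrightarrow> (SUP n. ereal (b n))) (at_right 0)"
    and infty: "((\<lambda>t. ereal (f t / t)) \<longlongrightarrow> (SUP n. ereal (a n))) at_top"
    and b0: "b 0 = - a 0"
  shows "f_divergence f P Q = (\<integral>\<^sup>+x. (SUP n. ennreal (a n * p x + b n * q x - a 0 * (p x - q x))) \<partial>R)"
proof -
  define c where "c = a 0"
  define g where "g = (\<lambda>x. c * (p x - q x))"
  define \<Phi> where "\<Phi> = (\<lambda>x. SUP n. ennreal (a n * p x + b n * q x - g x))"
  define A where "A = {x \<in> space R. 0 < q x}"
  define Z where "Z = {x \<in> space R. q x = 0}"
  define H where "H = (\<lambda>x. SUP n. ereal (a n * p x + b n * q x))"
  define S where "S = (SUP n. ereal (a n))"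
  define m where "m = measure P Z"
  have AZ [measurable]: "A \<in> sets R" "Z \<in> sets R" by (simp_all add: A_def Z_def)
  have AZP: "A \<in> sets P" "Z \<in> sets P" using AZ by (simp_all add: sets_R)
  have H_meas [measurable]: "H \<in> borel_measurable R" unfolding H_def by measurable
  have \<Phi>_meas [measurable]: "\<Phi> \<in> borel_measurable R" unfolding \<Phi>_def g_def by measurable
  have g_meas [measurable]: "g \<in> borel_measurable R" unfolding g_def by measurable
  have Hg: "ereal (g x) \<le> H x" for x
    unfolding H_def by (rule SUP_upper2[of 0]) (simp_all add: g_def c_def b0 algebra_simps)
  have \<Phi>: "\<Phi> x = e2ennreal (H x - ereal (g x))" for x
  proof -
    have "(SUP n. ereal (a n * p x + b n * q x) - ereal (g x)) = H x - ereal (g x)"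
      unfolding H_def by (rule SUP_ereal_minus_left) auto
    moreover have "\<Phi> x = e2ennreal (SUP n. ereal (a n * p x + b n * q x) - ereal (g x))"
      unfolding \<Phi>_def e2ennreal_SUP by simp
    ultimately show ?thesis by simp
  qed
  have Sc: "ereal c \<le> S" unfolding S_def c_def by (rule SUP_upper) simp
  have slope: "slope_at_infinity f = S"
    unfolding slope_at_infinity_def S_def by (rule tendsto_Lim[OF _ infty]) simp
  have \<Phi>_Z: "\<Phi> x = ennreal (p x) * e2ennreal (S - ereal c)" if "x \<in> Z" for x
  proof -
    have "(SUP n. ereal (a n) - ereal c) = S - ereal c"
      unfolding S_def by (rule SUP_ereal_minus_left) auto
    moreover have "e2ennreal (SUP n. ereal (a n) - ereal c) = (SUP n. ennreal (a n - c))"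
      unfolding e2ennreal_SUP by simp
    ultimately have "e2ennreal (S - ereal c) = (SUP n. ennreal (a n - c))" by simp
    then have "ennreal (p x) * e2ennreal (S - ereal c) = (SUP n. ennreal (p x) * ennreal (a n - c))"
      by (simp add: SUP_mult_left_ennreal)
    also have "\<dots> = \<Phi> x"
      unfolding \<Phi>_def
    proof (rule SUP_cong[OF refl])
      fix n
      have "ennreal (p x) * ennreal (a n - c) = ennreal (p x * (a n - c))" by (simp add: ennreal_mult')
      also have "p x * (a n - c) = a n * p x + b n * q x - g x"
        using that by (simp add: Z_def g_def algebra_simps)
      finally show "ennreal (p x) * ennreal (a n - c) = ennreal (a n * p x + b n * q x - g x)" .
    qed
    finally show ?thesis by simp
  qed
  let ?ind = "\<lambda>B x. indicator B x :: ennreal"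
  let ?F = "\<lambda>x. if q x > 0 then extended_at_zero f (p x / q x) * ereal (q x) else 0"
  have F: "?F x = H x" if "x \<in> A" for x
    using perspective_eq_SUP[OF sup zero, of "p x" "q x"] that by (simp add: A_def H_def)
  define I where "I = (\<integral>\<^sup>+x. e2ennreal (?F x) \<partial>R)"
  define I' where "I' = (\<integral>\<^sup>+x. e2ennreal (- ?F x) \<partial>R)"
  have F': "?F x = (if x \<in> A then H x else 0)" if "x \<in> space R" for x
    using F[of x] that by (simp add: A_def)
  have IA: "I = (\<integral>\<^sup>+x. e2ennreal (H x) * ?ind A x \<partial>R)"
    unfolding I_def by (rule nn_integral_cong) (simp only: F', simp add: indicator_def)
  have I'A: "I' = (\<integral>\<^sup>+x. e2ennreal (- H x) * ?ind A x \<partial>R)"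
    unfolding I'_def by (rule nn_integral_cong) (simp only: F', simp add: indicator_def)
  have g_int: "integrable R (\<lambda>x. g x * indicator A x)" "(\<integral>x. g x * indicator A x \<partial>R) = - c * m"
  proof -
    have eq: "g x * indicator A x = c * (p x * indicator A x) - c * (q x * indicator A x)" for x
      by (simp add: g_def algebra_simps)
    show "integrable R (\<lambda>x. g x * indicator A x)"
      unfolding eq using integrable_density[OF AZP(1)] by simp
    have "(\<integral>x. g x * indicator A x \<partial>R) = c * measure P A - c * measure Q A"
      unfolding eq using integrable_density[OF AZP(1)] by simp
    moreover have "measure P A = 1 - m"
    proof -
      have "A = space P - Z" by (auto simp: A_def Z_def space_R less_le)
      then show ?thesis using P.prob_compl[OF AZP(2)] by (simp add: m_def)
    qed
    moreover have "measure Q A = 1"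
    proof -
      have "measure Q A = (\<integral>x. q x * indicator A x \<partial>R)" using integrable_density[OF AZP(1)] by simp
      also have "\<dots> = integral\<^sup>L R q"
        by (intro Bochner_Integration.integral_cong) (auto simp: A_def indicator_def less_le)
      finally show ?thesis by (simp add: integral_q)
    qed
    ultimately show "(\<integral>x. g x * indicator A x \<partial>R) = - c * m" by (simp add: algebra_simps)
  qed
  define u where "u = (\<integral>x. max 0 (- g x) * indicator A x \<partial>R)"
  define v where "v = (\<integral>x. max 0 (g x) * indicator A x \<partial>R)"
  have uv_int: "integrable R (\<lambda>x. max 0 (- g x) * indicator A x)" "integrable R (\<lambda>x. max 0 (g x) * indicator A x)"
    by (rule Bochner_Integration.integrable_bound[OF g_int(1)]; auto simp: indicator_def)+
  have "v - u = (\<integral>x. max 0 (g x) * indicator A x - max 0 (- g x) * indicator A x \<partial>R)"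
    using uv_int by (simp add: u_def v_def)
  also have "\<dots> = (\<integral>x. g x * indicator A x \<partial>R)"
    by (intro Bochner_Integration.integral_cong) (auto simp: indicator_def max_def)
  finally have uv: "v - u = - c * m" using g_int(2) by simp
  have uv_nonneg: "0 \<le> u" "0 \<le> v" unfolding u_def v_def by (auto intro!: integral_nonneg_AE)
  have uv_nn: "(\<integral>\<^sup>+x. ennreal (max 0 (- g x)) * ?ind A x \<partial>R) = ennreal u"
    "(\<integral>\<^sup>+x. ennreal (max 0 (g x)) * ?ind A x \<partial>R) = ennreal v"
  proof -
    have "(\<integral>\<^sup>+x. ennreal (max 0 (- g x)) * ?ind A x \<partial>R) = (\<integral>\<^sup>+x. ennreal (max 0 (- g x) * indicator A x) \<partial>R)"
      "(\<integral>\<^sup>+x. ennreal (max 0 (g x)) * ?ind A x \<partial>R) = (\<integral>\<^sup>+x. ennreal (max 0 (g x) * indicator A x) \<partial>R)"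
      by (auto intro!: nn_integral_cong simp: indicator_def)
    then show "(\<integral>\<^sup>+x. ennreal (max 0 (- g x)) * ?ind A x \<partial>R) = ennreal u"
      "(\<integral>\<^sup>+x. ennreal (max 0 (g x)) * ?ind A x \<partial>R) = ennreal v"
      using nn_integral_eq_integral[OF uv_int(1)] nn_integral_eq_integral[OF uv_int(2)]
      by (simp_all add: u_def v_def)
  qed
  have "I' \<le> ennreal u"
    unfolding I'A uv_nn(1)[symmetric]
  proof (intro nn_integral_mono mult_right_mono)
    fix x
    have "- H x \<le> - ereal (g x)" using Hg[of x] by (simp only: ereal_minus_le_minus)
    then have "- H x \<le> ereal (- g x)" by simp
    then have "e2ennreal (- H x) \<le> e2ennreal (ereal (- g x))" by (rule e2ennreal_mono)
    also have "\<dots> \<le> ennreal (max 0 (- g x))" by (simp add: ennreal_leI)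
    finally show "e2ennreal (- H x) \<le> ennreal (max 0 (- g x))" .
  qed simp
  then obtain w where w: "I' = ennreal w" "0 \<le> w"
    by (metis ennreal_cases ennreal_neq_top neq_top_trans)
  define J where "J = (\<integral>\<^sup>+x. \<Phi> x * ?ind A x \<partial>R)"
  have "I + ennreal u = (\<integral>\<^sup>+x. (e2ennreal (H x) + ennreal (max 0 (- g x))) * ?ind A x \<partial>R)"
    unfolding IA uv_nn(1)[symmetric] by (subst nn_integral_add[symmetric]) (auto simp: distrib_right)
  also have "\<dots> = (\<integral>\<^sup>+x. (\<Phi> x + (ennreal (max 0 (g x)) + e2ennreal (- H x))) * ?ind A x \<partial>R)"
    using ennreal_split_pos_neg[OF Hg] by (simp add: \<Phi>)
  also have "\<dots> = J + (ennreal v + I')"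
    unfolding J_def uv_nn(2)[symmetric] I'A distrib_right
    by (subst nn_integral_add, (simp_all)[2], subst nn_integral_add) auto
  finally have "I + ennreal u = J + (ennreal v + ennreal w)" unfolding w(1) .
  note book = ereal_difference_bookkeeping[OF this uv_nonneg w(2) _ uv Sc]
  have "f_divergence f P Q = e2ennreal (ereal_integral R ?F + ereal (measure P {x \<in> space P. q x = 0}) * slope_at_infinity f)"
    unfolding f_divergence_def Let_def R_def[symmetric] p_def q_def ..
  also have "\<dots> = e2ennreal (enn2ereal I - enn2ereal I' + ereal m * S)"
    by (simp add: ereal_integral_def I_def I'_def m_def Z_def space_R slope)
  also have "\<dots> = J + ennreal m * e2ennreal (S - ereal c)"
    unfolding w(1) by (rule book) (simp add: m_def)
  also have "ennreal m * e2ennreal (S - ereal c) = (\<integral>\<^sup>+x. \<Phi> x * ?ind Z x \<partial>R)"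
  proof -
    have "ennreal m = emeasure (density R p) Z"
      unfolding density_p m_def by (simp add: P.emeasure_eq_measure)
    also have "\<dots> = (\<integral>\<^sup>+x. ennreal (p x) * ?ind Z x \<partial>R)" by (rule emeasure_density) simp_all
    finally have "ennreal m * e2ennreal (S - ereal c) = (\<integral>\<^sup>+x. ennreal (p x) * ?ind Z x * e2ennreal (S - ereal c) \<partial>R)"
      by (simp add: nn_integral_multc)
    also have "\<dots> = (\<integral>\<^sup>+x. \<Phi> x * ?ind Z x \<partial>R)"
      by (intro nn_integral_cong) (auto simp: \<Phi>_Z indicator_def)
    finally show ?thesis .
  qed
  also have "J + (\<integral>\<^sup>+x. \<Phi> x * ?ind Z x \<partial>R) = (\<integral>\<^sup>+x. \<Phi> x * ?ind A x + \<Phi> x * ?ind Z x \<partial>R)"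
    unfolding J_def by (rule nn_integral_add[symmetric]) simp_all
  also have "\<dots> = (\<integral>\<^sup>+x. \<Phi> x \<partial>R)"
    by (intro nn_integral_cong) (auto simp: A_def Z_def indicator_def less_le)
  finally show ?thesis by (simp add: \<Phi>_def g_def c_def)
qed

lemma minorant_le_SUP:
  fixes a b :: "nat \<Rightarrow> real"
  assumes sup: "\<And>t. 0 < t \<Longrightarrow> (SUP n. ereal (a n * t + b n)) = ereal (f t)"
    and zero: "((\<lambda>s. ereal (f s)) \<longlongrightarrow> (SUP n. ereal (b n))) (at_right 0)"
    and infty: "((\<lambda>t. ereal (f t / t)) \<longlongrightarrow> (SUP n. ereal (a n))) at_top"
    and minorant: "affine_minorant f \<alpha> \<beta>" and xy: "0 \<le> x" "0 \<le> y"
  shows "ereal (\<alpha> * x + \<beta> * y) \<le> (SUP n. ereal (a n * x + b n * y))"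
proof -
  have below: "\<alpha> * t + \<beta> \<le> f t" if "0 < t" for t using minorant that by (simp add: affine_minorant_def)
  consider "y = 0" | "0 < y" "x = 0" | "0 < y" "0 < x" using xy by linarith
  then show ?thesis
  proof cases
    case 1
    have lim: "((\<lambda>t. ereal (\<alpha> + \<beta> / t)) \<longlongrightarrow> ereal (\<alpha> + 0)) at_top"
      by (intro tendsto_intros tendsto_divide_0[OF tendsto_const] filterlim_at_top_imp_at_infinity filterlim_ident)
    have "\<forall>\<^sub>F t in at_top. ereal (\<alpha> + \<beta> / t) \<le> ereal (f t / t)"
      using eventually_gt_at_top[of "0::real"]
    proof eventually_elim
      case (elim t)
      have "\<alpha> + \<beta> / t = (\<alpha> * t + \<beta>) / t" using elim by (simp add: field_simps)
      also have "\<dots> \<le> f t / t" using below[of t] elim by (intro divide_right_mono) auto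
      finally show ?case by simp
    qed
    from tendsto_le[OF trivial_limit_at_top_linorder infty lim this]
    have "ereal \<alpha> \<le> (SUP n. ereal (a n))" by simp
    then have "ereal x * ereal \<alpha> \<le> ereal x * (SUP n. ereal (a n))"
      using xy by (intro ereal_mult_left_mono) auto
    also have "\<dots> = (SUP n. ereal x * ereal (a n))" using xy by (intro Sup_ereal_mult_left') auto
    finally show ?thesis using 1 by (simp add: mult.commute)
  next
    case 2
    have lim: "((\<lambda>s. ereal (\<alpha> * s + \<beta>)) \<longlongrightarrow> ereal (\<alpha> * 0 + \<beta>)) (at_right 0)"
      by (intro tendsto_intros)
    have "\<forall>\<^sub>F s in at_right 0. ereal (\<alpha> * s + \<beta>) \<le> ereal (f s)"
      using eventually_at_right_less[of "0::real"] by eventually_elim (simp add: below)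
    from tendsto_le[OF trivial_limit_at_right_real zero lim this]
    have "ereal \<beta> \<le> (SUP n. ereal (b n))" by simp
    then have "ereal y * ereal \<beta> \<le> ereal y * (SUP n. ereal (b n))"
      using xy by (intro ereal_mult_left_mono) auto
    also have "\<dots> = (SUP n. ereal y * ereal (b n))" using xy by (intro Sup_ereal_mult_left') auto
    finally show ?thesis using 2 by (simp add: mult.commute)
  next
    case 3
    have "\<alpha> * x + \<beta> * y = (\<alpha> * (x / y) + \<beta>) * y" using 3 by (simp add: field_simps)
    also have "\<dots> \<le> f (x / y) * y" using below[of "x / y"] 3 by (intro mult_right_mono) auto
    finally have "ereal (\<alpha> * x + \<beta> * y) \<le> extended_at_zero f (x / y) * ereal y"
      using 3 by (simp add: extended_at_zero_def)
    then show ?thesis using perspective_eq_SUP[OF sup zero xy(1) 3(1)] by simp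
  qed
qed

lemma integral_partition:
  fixes k :: "'a \<Rightarrow> nat" and \<alpha> \<beta> :: "nat \<Rightarrow> real"
  assumes k: "k \<in> measurable P (count_space UNIV)" "\<And>x. x \<in> space P \<Longrightarrow> k x < n"
  shows "integrable R (\<lambda>x. \<alpha> (k x) * p x + \<beta> (k x) * q x - c * (p x - q x))"
    and "(\<integral>x. \<alpha> (k x) * p x + \<beta> (k x) * q x - c * (p x - q x) \<partial>R) =
      (\<Sum>i<n. \<alpha> i * measure P {x \<in> space P. k x = i} + \<beta> i * measure Q {x \<in> space P. k x = i})"
proof -
  define E where "E = (\<lambda>i. {x \<in> space P. k x = i})"
  have E: "E i \<in> sets P" for i
  proof -
    have "E i = k -` {i} \<inter> space P" by (auto simp: E_def)
    then show ?thesis using measurable_sets[OF k(1), of "{i}"] by simp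
  qed
  define h where "h = (\<lambda>x. \<Sum>i<n. \<alpha> i * (p x * indicator (E i) x) + \<beta> i * (q x * indicator (E i) x))"
  have h: "h x = \<alpha> (k x) * p x + \<beta> (k x) * q x" if "x \<in> space R" for x
  proof -
    have x: "x \<in> space P" using that by (simp add: space_R)
    have "h x = (\<Sum>i<n. if i = k x then \<alpha> i * p x + \<beta> i * q x else 0)"
      unfolding h_def using x by (intro sum.cong) (auto simp: E_def indicator_def)
    also have "\<dots> = \<alpha> (k x) * p x + \<beta> (k x) * q x" using k(2)[OF x] by simp
    finally show ?thesis .
  qed
  have int: "integrable R (\<lambda>x. h x - c * (p x - q x))"
    "(\<integral>x. h x - c * (p x - q x) \<partial>R) = (\<Sum>i<n. \<alpha> i * measure P (E i) + \<beta> i * measure Q (E i))"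
    unfolding h_def using integrable_density[OF E] integrable_p integrable_q integral_p integral_q by simp_all
  show "integrable R (\<lambda>x. \<alpha> (k x) * p x + \<beta> (k x) * q x - c * (p x - q x))"
    using int(1) h by (simp cong: Bochner_Integration.integrable_cong)
  show "(\<integral>x. \<alpha> (k x) * p x + \<beta> (k x) * q x - c * (p x - q x) \<partial>R) =
      (\<Sum>i<n. \<alpha> i * measure P {x \<in> space P. k x = i} + \<beta> i * measure Q {x \<in> space P. k x = i})"
    using int(2) h by (simp add: E_def cong: Bochner_Integration.integral_cong)
qed

text \<open>On the part of the partition where \<open>k x = i\<close>, the function \<open>\<alpha> i * p + \<beta> i * q\<close> is below the integrand.\<close>

theorem minorant_sum_le_f_divergence:
  fixes k :: "'a \<Rightarrow> nat" and \<alpha> \<beta> :: "nat \<Rightarrow> real"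
  assumes f: "convex_on {0<..} f" "f 1 = 0"
    and k: "k \<in> measurable P (count_space UNIV)" "\<And>x. x \<in> space P \<Longrightarrow> k x < n"
    and minorant: "\<And>i. i < n \<Longrightarrow> affine_minorant f (\<alpha> i) (\<beta> i)"
  shows "ennreal (\<Sum>i<n. \<alpha> i * measure P {x \<in> space P. k x = i} + \<beta> i * measure Q {x \<in> space P. k x = i})
    \<le> f_divergence f P Q"
proof -
  obtain a b :: "nat \<Rightarrow> real" where b0: "b 0 = - a 0"
    and ab: "\<And>t. 0 < t \<Longrightarrow> (SUP n. ereal (a n * t + b n)) = ereal (f t)"
    "((\<lambda>s. ereal (f s)) \<longlongrightarrow> (SUP n. ereal (b n))) (at_right 0)"
    "((\<lambda>t. ereal (f t / t)) \<longlongrightarrow> (SUP n. ereal (a n))) at_top"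
    by (rule exhausting_minorants[OF f]) blast
  define h where "h = (\<lambda>x. \<alpha> (k x) * p x + \<beta> (k x) * q x - a 0 * (p x - q x))"
  have int: "integrable R h"
    "integral\<^sup>L R h = (\<Sum>i<n. \<alpha> i * measure P {x \<in> space P. k x = i} + \<beta> i * measure Q {x \<in> space P. k x = i})"
    unfolding h_def by (rule integral_partition[OF k]; assumption)+
  have int': "integrable R (\<lambda>x. max 0 (h x))" using int(1) by simp
  have "ennreal (integral\<^sup>L R h) \<le> ennreal (\<integral>x. max 0 (h x) \<partial>R)"
    by (intro ennreal_leI integral_mono int(1) int') auto
  also have "\<dots> = (\<integral>\<^sup>+x. ennreal (max 0 (h x)) \<partial>R)"
    by (rule nn_integral_eq_integral[OF int', symmetric]) auto
  also have "\<dots> \<le> (\<integral>\<^sup>+x. (SUP n. ennreal (a n * p x + b n * q x - a 0 * (p x - q x))) \<partial>R)"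
  proof (rule nn_integral_mono)
    fix x assume "x \<in> space R"
    then have "affine_minorant f (\<alpha> (k x)) (\<beta> (k x))" using minorant k(2) by (simp add: space_R)
    from minorant_le_SUP[OF ab this p_nonneg q_nonneg]
    have "ereal (\<alpha> (k x) * p x + \<beta> (k x) * q x) \<le> (SUP n. ereal (a n * p x + b n * q x))" .
    from ereal_minus_mono[OF this order_refl]
    have "ereal (h x) \<le> (SUP n. ereal (a n * p x + b n * q x)) - ereal (a 0 * (p x - q x))"
      by (simp only: h_def ereal_minus(1)[symmetric])
    also have "\<dots> = (SUP n. ereal (a n * p x + b n * q x) - ereal (a 0 * (p x - q x)))"
      by (rule SUP_ereal_minus_left[symmetric]) auto
    finally have "e2ennreal (ereal (h x)) \<le> e2ennreal \<dots>" by (rule e2ennreal_mono)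
    then show "ennreal (max 0 (h x)) \<le> (SUP n. ennreal (a n * p x + b n * q x - a 0 * (p x - q x)))"
      unfolding e2ennreal_SUP by (simp add: max_def ennreal_neg)
  qed
  also have "\<dots> = f_divergence f P Q"
    by (rule f_divergence_eq_nn_integral[OF ab b0, symmetric])
  finally show ?thesis unfolding int(2) .
qed

text \<open>By monotone convergence finitely many tangents suffice up to an error; the partition records which of them
  is the largest.\<close>

theorem f_divergence_leI:
  assumes f: "convex_on {0<..} f" "f 1 = 0"
    and bound: "\<And>(n :: nat) k \<alpha> \<beta>. k \<in> measurable P (count_space UNIV) \<Longrightarrow> (\<And>x. x \<in> space P \<Longrightarrow> k x < n) \<Longrightarrow>
      (\<And>i. i < n \<Longrightarrow> affine_minorant f (\<alpha> i) (\<beta> i)) \<Longrightarrow>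
      ennreal (\<Sum>i<n. \<alpha> i * measure P {x \<in> space P. k x = i} + \<beta> i * measure Q {x \<in> space P. k x = i}) \<le> c"
  shows "f_divergence f P Q \<le> c"
proof -
  obtain a b :: "nat \<Rightarrow> real" where minorant: "\<And>n. affine_minorant f (a n) (b n)" and b0: "b 0 = - a 0"
    and ab: "\<And>t. 0 < t \<Longrightarrow> (SUP n. ereal (a n * t + b n)) = ereal (f t)"
    "((\<lambda>s. ereal (f s)) \<longlongrightarrow> (SUP n. ereal (b n))) (at_right 0)"
    "((\<lambda>t. ereal (f t / t)) \<longlongrightarrow> (SUP n. ereal (a n))) at_top"
    by (rule exhausting_minorants[OF f]) blast
  define r where "r = (\<lambda>n x. a n * p x + b n * q x)"
  define g where "g = (\<lambda>x. a 0 * (p x - q x))"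
  have [measurable]: "r n \<in> borel_measurable R" "g \<in> borel_measurable R" for n
    unfolding r_def g_def by measurable
  have "f_divergence f P Q = (\<integral>\<^sup>+x. (SUP n. ennreal (r n x - g x)) \<partial>R)"
    unfolding r_def g_def by (rule f_divergence_eq_nn_integral[OF ab b0])
  also have "\<dots> \<le> (\<integral>\<^sup>+x. (SUP n. SUP i\<in>{..n}. ennreal (r i x - g x)) \<partial>R)"
    by (intro nn_integral_mono SUP_mono) (auto intro!: SUP_upper)
  also have "\<dots> = (SUP n. \<integral>\<^sup>+x. (SUP i\<in>{..n}. ennreal (r i x - g x)) \<partial>R)"
    by (rule nn_integral_monotone_convergence_SUP)
      (auto simp: incseq_def le_fun_def intro!: SUP_subset_mono)
  also have "\<dots> \<le> c"
  proof (rule SUP_least)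
    fix n
    define k where "k = (\<lambda>x. LEAST i. i \<le> n \<and> (\<forall>j\<in>{..n}. r j x \<le> r i x))"
    have k: "k x \<le> n \<and> (\<forall>j\<in>{..n}. r j x \<le> r (k x) x)" for x
    proof -
      have "\<exists>i. i \<le> n \<and> (\<forall>j\<in>{..n}. r j x \<le> r i x)"
        using Max_in[of "(\<lambda>i. r i x) ` {..n}"] Max_ge[of "(\<lambda>i. r i x) ` {..n}"] by fastforce
      then show ?thesis unfolding k_def by (rule LeastI_ex)
    qed
    have "k \<in> measurable R (count_space UNIV)"
      unfolding k_def by measurable
    moreover have "measurable R (count_space UNIV) = measurable P (count_space (UNIV :: nat set))"
      by (rule measurable_cong_sets[OF sets_R refl])
    ultimately have k_meas: "k \<in> measurable P (count_space UNIV)" by simp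
    have k_less: "k x < Suc n" if "x \<in> space P" for x using k[of x] by simp
    have nonneg: "0 \<le> a (k x) * p x + b (k x) * q x - g x" for x
    proof -
      have "r 0 x \<le> r (k x) x" using k[of x] by simp
      then show ?thesis by (simp add: r_def g_def b0 algebra_simps)
    qed
    have "(\<integral>\<^sup>+x. (SUP i\<in>{..n}. ennreal (r i x - g x)) \<partial>R) \<le>
        (\<integral>\<^sup>+x. ennreal (a (k x) * p x + b (k x) * q x - g x) \<partial>R)"
    proof (intro nn_integral_mono SUP_least ennreal_leI)
      fix x i assume "i \<in> {..n}"
      then show "r i x - g x \<le> a (k x) * p x + b (k x) * q x - g x"
        using k[of x] by (simp add: r_def)
    qed
    also have "\<dots> = ennreal (\<integral>x. a (k x) * p x + b (k x) * q x - g x \<partial>R)"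
      using integral_partition(1)[OF k_meas k_less, of a b "a 0"] nonneg
      by (intro nn_integral_eq_integral) (auto simp: g_def)
    also have "\<dots> = ennreal (\<Sum>i<Suc n. a i * measure P {x \<in> space P. k x = i} + b i * measure Q {x \<in> space P. k x = i})"
      using integral_partition(2)[OF k_meas k_less, of a b "a 0"] by (simp add: g_def)
    also have "\<dots> \<le> c" by (rule bound[OF k_meas]) (use k_less minorant in auto)
    finally show "(\<integral>\<^sup>+x. (SUP i\<in>{..n}. ennreal (r i x - g x)) \<partial>R) \<le> c" .
  qed
  finally show ?thesis .
qed

end

section \<open>Data processing for the divergence\<close>

lemma f_divergence_distr_le:
  assumes f: "convex_on {0<..} f" "f 1 = 0"
    and PQ: "probability_pair P Q" and h: "h \<in> measurable P N"
  shows "f_divergence f (distr P N h) (distr Q N h) \<le> f_divergence f P Q"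
proof -
  interpret PQ: probability_pair P Q by (rule PQ)
  have hQ: "h \<in> measurable Q N" using h measurable_cong_sets[OF PQ.same_sets refl] by blast
  interpret D: probability_pair "distr P N h" "distr Q N h"
    using PQ.P.prob_space_distr[OF h] PQ.Q.prob_space_distr[OF hQ]
    by (simp add: probability_pair_def probability_pair_axioms_def)
  show ?thesis
  proof (rule D.f_divergence_leI[OF f])
    fix n :: nat and k \<alpha> \<beta>
    assume k: "k \<in> measurable (distr P N h) (count_space UNIV)" "\<And>x. x \<in> space (distr P N h) \<Longrightarrow> k x < n"
      and minorant: "\<And>i. i < n \<Longrightarrow> affine_minorant f (\<alpha> i) (\<beta> i)"
    have k': "k \<in> measurable N (count_space UNIV)" using k(1) by simp
    have sets: "{x \<in> space N. k x = i} \<in> sets N" for i using k' by measurable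
    have "measure (distr P N h) {x \<in> space N. k x = i} = measure P {x \<in> space P. k (h x) = i}"
      "measure (distr Q N h) {x \<in> space N. k x = i} = measure Q {x \<in> space P. k (h x) = i}" for i
      using measurable_space[OF h] measurable_space[OF hQ] PQ.space_Q
      by (auto simp: measure_distr[OF h sets] measure_distr[OF hQ sets] intro!: arg_cong[of _ _ "measure _"])
    then show "ennreal (\<Sum>i<n. \<alpha> i * measure (distr P N h) {x \<in> space (distr P N h). k x = i}
        + \<beta> i * measure (distr Q N h) {x \<in> space (distr P N h). k x = i}) \<le> f_divergence f P Q"
      using PQ.minorant_sum_le_f_divergence[OF f, of "\<lambda>x. k (h x)" n \<alpha> \<beta>] minorant
        measurable_compose[OF h k'] measurable_space[OF h] k(2) by simp
  qed
qed

text \<open>The affine minorants of \<open>f\<close> form a convex set.\<close>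

lemma affine_minorant_expectation:
  assumes "\<And>\<gamma>. affine_minorant f (\<alpha> \<gamma>) (\<beta> \<gamma>)"
    and bounded: "\<And>\<gamma>. \<bar>\<alpha> \<gamma>\<bar> \<le> c" "\<And>\<gamma>. \<bar>\<beta> \<gamma>\<bar> \<le> c"
  shows "affine_minorant f (measure_pmf.expectation M \<alpha>) (measure_pmf.expectation M \<beta>)"
  unfolding affine_minorant_def
proof (intro allI impI)
  fix t :: real assume t: "0 < t"
  note int = integrable_pmf_bounded[of \<alpha>, OF bounded(1)] integrable_pmf_bounded[of \<beta>, OF bounded(2)]
  have "measure_pmf.expectation M \<alpha> * t + measure_pmf.expectation M \<beta> =
      measure_pmf.expectation M (\<lambda>\<gamma>. \<alpha> \<gamma> * t + \<beta> \<gamma>)"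
    using int by simp
  also have "\<dots> \<le> f t"
    using int assms(1) t by (intro measure_pmf.integral_le_const) (auto simp: affine_minorant_def)
  finally show "measure_pmf.expectation M \<alpha> * t + measure_pmf.expectation M \<beta> \<le> f t" .
qed

lemma pmf_of_distr_exists:
  fixes k :: "'x \<Rightarrow> nat"
  assumes "prob_space \<nu>" "k \<in> measurable \<nu> (count_space UNIV)"
  obtains \<theta> where "measure_pmf \<theta> = distr \<nu> (count_space UNIV) k"
proof -
  let ?D = "distr \<nu> (count_space UNIV) k"
  interpret D: prob_space ?D by (rule prob_space.prob_space_distr[OF assms])
  have "(\<Union>i\<in>{i. measure ?D {i} = 0}. {i}) \<in> null_sets ?D"
    by (rule null_sets_UN') (auto simp: null_sets_def D.emeasure_eq_measure)
  then have "AE i in ?D. measure ?D {i} \<noteq> 0"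
    by (rule AE_I') auto
  then have "measure_pmf (Abs_pmf ?D) = ?D"
    using D.prob_space_axioms by (intro Abs_pmf_inverse) auto
  then show thesis by (rule that)
qed

lemma ennreal_add_le:
  assumes "0 \<le> b" shows "ennreal (a + b) \<le> ennreal a + ennreal b"
proof (cases "0 \<le> a")
  case True
  then show ?thesis using assms by (simp add: ennreal_plus)
next
  case False
  then have "ennreal (a + b) \<le> ennreal b" by (intro ennreal_leI) simp
  then show ?thesis using False by (simp add: ennreal_neg)
qed

text \<open>The measure \<open>\<nu>\<close> is moved to the group by the kernel \<open>m\<close>, which has the value \<open>m i\<close> where \<open>\<iota> = i\<close>. Outside \<open>D\<close> the
  kernel intertwines \<open>T\<close> and \<open>\<sigma>\<close> up to \<open>e\<close>, so the bounded function \<open>\<alpha>\<close> may be integrated against \<open>m (\<iota> (T x))\<close>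
  instead of \<open>\<sigma> \<cdot> m (\<iota> x)\<close>. What remains is a sum over the level sets of \<open>\<iota>\<close>, with coefficients that are averages
  of affine minorants.\<close>

lemma divergence_transfer:
  fixes \<iota> :: "'x \<Rightarrow> nat" and m :: "nat \<Rightarrow> 'g pmf" and \<sigma> :: "'g \<Rightarrow> 'g"
  assumes f: "convex_on {0<..} f" "f 1 = 0"
    and \<nu>: "prob_space \<nu>" and T: "T \<in> measurable \<nu> \<nu>"
    and \<iota>: "\<iota> \<in> measurable \<nu> (count_space UNIV)" "\<And>x. x \<in> space \<nu> \<Longrightarrow> \<iota> x < N"
    and bad: "D \<in> sets \<nu>" "measure \<nu> D \<le> d"
    and close: "\<And>x. x \<in> space \<nu> - D \<Longrightarrow> tv_close e (map_pmf \<sigma> (m (\<iota> x))) (m (\<iota> (T x)))"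
    and e: "0 \<le> e"
    and minorant: "\<And>\<gamma>. affine_minorant f (\<alpha> \<gamma>) (\<beta> \<gamma>)"
    and bounded: "0 < L" "\<And>\<gamma>. \<bar>\<alpha> \<gamma>\<bar> \<le> L" "\<And>\<gamma>. \<bar>\<beta> \<gamma>\<bar> \<le> L"
    and \<theta>: "measure_pmf \<theta> = distr \<nu> (count_space UNIV) \<iota>"
  shows "ennreal (measure_pmf.expectation (map_pmf \<sigma> (bind_pmf \<theta> m)) \<alpha>
      + measure_pmf.expectation (bind_pmf \<theta> m) \<beta>)
    \<le> f_divergence f (distr \<nu> \<nu> T) \<nu> + ennreal (L * (e + 2 * d))"
proof -
  interpret \<nu>: prob_space \<nu> by (rule \<nu>)
  interpret pair: probability_pair "distr \<nu> \<nu> T" \<nu>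
    using \<nu> \<nu>.prob_space_distr[OF T] by (simp add: probability_pair_def probability_pair_axioms_def)
  let ?E = "measure_pmf.expectation"
  define A where "A = (\<lambda>i. ?E (m i) \<alpha>)"
  define A' where "A' = (\<lambda>i. ?E (map_pmf \<sigma> (m i)) \<alpha>)"
  define B where "B = (\<lambda>i. ?E (m i) \<beta>)"
  have bound: "\<bar>A i\<bar> \<le> L" "\<bar>A' i\<bar> \<le> L" "\<bar>B i\<bar> \<le> L" for i
    unfolding A_def A'_def B_def using bounded by (auto intro!: expectation_pmf_bounded simp del: integral_map_pmf)
  have \<iota>T: "(\<lambda>x. \<iota> (T x)) \<in> measurable \<nu> (count_space UNIV)"
    using measurable_compose[OF T \<iota>(1)] .
  have meas: "(\<lambda>x. F (k x)) \<in> borel_measurable \<nu>" if "k \<in> measurable \<nu> (count_space UNIV)" for F :: "nat \<Rightarrow> real" and k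
    using measurable_compose[OF that, of F borel] by simp
  have int: "integrable \<nu> (\<lambda>x. F (k x))" if "k \<in> measurable \<nu> (count_space UNIV)" "\<And>i. \<bar>F i\<bar> \<le> L"
    for F :: "nat \<Rightarrow> real" and k
    using that by (intro \<nu>.integrable_const_bound[of _ L] meas) auto
  have intA: "integrable \<nu> (\<lambda>x. A' (\<iota> x))" "integrable \<nu> (\<lambda>x. A (\<iota> (T x)))"
    by (rule int[OF \<iota>(1)], rule bound, rule int[OF \<iota>T], rule bound)
  have E\<theta>: "?E (bind_pmf \<theta> K) \<phi> = (\<integral>x. ?E (K (\<iota> x)) \<phi> \<partial>\<nu>)" if "\<And>\<gamma>. \<bar>\<phi> \<gamma>\<bar> \<le> L" for \<phi> :: "'g \<Rightarrow> real" and K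
    using \<iota>(1) by (simp add: expectation_bind_pmf[OF that] \<theta> integral_distr)
  have diff: "A' (\<iota> x) - A (\<iota> (T x)) \<le> L * e + 2 * L * indicator D x" if "x \<in> space \<nu>" for x
  proof (cases "x \<in> D")
    case True
    have "A' (\<iota> x) - A (\<iota> (T x)) \<le> 2 * L" using bound(2)[of "\<iota> x"] bound(1)[of "\<iota> (T x)"] by (simp add: abs_le_iff)
    moreover have "0 \<le> L * e" using bounded(1) e by simp
    ultimately show ?thesis using True by simp
  next
    case False
    then have "tv_close e (map_pmf \<sigma> (m (\<iota> x))) (m (\<iota> (T x)))" using close that by simp
    from tv_closeD[where \<phi> = \<alpha> and c = L, OF this bounded(2,1)] show ?thesis
      using False by (simp add: A_def A'_def abs_le_iff)
  qed
  have "(\<integral>x. A' (\<iota> x) - A (\<iota> (T x)) \<partial>\<nu>) \<le> (\<integral>x. L * e + 2 * L * indicator D x \<partial>\<nu>)"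
    using intA bad(1) diff
    by (intro integral_mono) (auto simp: \<nu>.emeasure_finite less_top[symmetric])
  also have "\<dots> = L * e + 2 * L * measure \<nu> D"
    using bad(1) by (simp add: \<nu>.emeasure_finite less_top[symmetric] \<nu>.prob_space)
  also have "\<dots> \<le> L * (e + 2 * d)" using bad(2) bounded(1) by (simp add: algebra_simps)
  finally have "(\<integral>x. A' (\<iota> x) \<partial>\<nu>) \<le> (\<integral>x. A (\<iota> (T x)) \<partial>\<nu>) + L * (e + 2 * d)"
    using intA by simp
  moreover have "?E (map_pmf \<sigma> (bind_pmf \<theta> m)) \<alpha> = (\<integral>x. A' (\<iota> x) \<partial>\<nu>)"
    unfolding map_bind_pmf A'_def by (rule E\<theta>) (rule bounded)
  moreover have "?E (bind_pmf \<theta> m) \<beta> = (\<integral>x. B (\<iota> x) \<partial>\<nu>)"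
    unfolding B_def by (rule E\<theta>) (rule bounded)
  ultimately have le: "?E (map_pmf \<sigma> (bind_pmf \<theta> m)) \<alpha> + ?E (bind_pmf \<theta> m) \<beta> \<le>
      ((\<integral>x. A (\<iota> (T x)) \<partial>\<nu>) + (\<integral>x. B (\<iota> x) \<partial>\<nu>)) + L * (e + 2 * d)" by simp
  have sum_int: "(\<integral>x. F (k x) \<partial>\<nu>) = (\<Sum>i<N. F i * measure \<nu> {x \<in> space \<nu>. k x = i})"
    if k: "k \<in> measurable \<nu> (count_space UNIV)" "\<And>x. x \<in> space \<nu> \<Longrightarrow> k x < N" for F :: "nat \<Rightarrow> real" and k
  proof -
    have sets: "{x \<in> space \<nu>. k x = i} \<in> sets \<nu>" for i using k(1) by measurable
    have "(\<integral>x. F (k x) \<partial>\<nu>) = (\<integral>x. (\<Sum>i<N. F i * indicator {x \<in> space \<nu>. k x = i} x) \<partial>\<nu>)"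
    proof (rule Bochner_Integration.integral_cong[OF refl])
      fix x assume x: "x \<in> space \<nu>"
      have "(\<Sum>i<N. F i * indicator {x \<in> space \<nu>. k x = i} x) = (\<Sum>i<N. if i = k x then F i else 0)"
        using x by (intro sum.cong) (auto simp: indicator_def)
      then show "F (k x) = (\<Sum>i<N. F i * indicator {x \<in> space \<nu>. k x = i} x)" using k(2)[OF x] by simp
    qed
    also have "\<dots> = (\<Sum>i<N. (\<integral>x. F i * indicator {x \<in> space \<nu>. k x = i} x \<partial>\<nu>))"
      using sets by (intro Bochner_Integration.integral_sum integrable_mult_right)
        (simp add: \<nu>.emeasure_finite less_top[symmetric])
    also have "\<dots> = (\<Sum>i<N. F i * measure \<nu> {x \<in> space \<nu>. k x = i})"
    proof (rule sum.cong[OF refl])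
      fix i
      have "(\<integral>x. indicator {x \<in> space \<nu>. k x = i} x \<partial>\<nu>) = measure \<nu> {x \<in> space \<nu>. k x = i}"
        using sets[of i] sets.sets_into_space[OF sets[of i]] by (simp add: Int_absorb1)
      then show "(\<integral>x. F i * indicator {x \<in> space \<nu>. k x = i} x \<partial>\<nu>) = F i * measure \<nu> {x \<in> space \<nu>. k x = i}"
        by (simp only: integral_mult_right_zero)
    qed
    finally show ?thesis .
  qed
  have "(\<integral>x. A (\<iota> (T x)) \<partial>\<nu>) + (\<integral>x. B (\<iota> x) \<partial>\<nu>) =
      (\<Sum>i<N. A i * measure (distr \<nu> \<nu> T) {x \<in> space (distr \<nu> \<nu> T). \<iota> x = i}
        + B i * measure \<nu> {x \<in> space (distr \<nu> \<nu> T). \<iota> x = i})"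
  proof -
    have sets: "{x \<in> space \<nu>. \<iota> x = i} \<in> sets \<nu>" for i using \<iota>(1) by measurable
    have "measure (distr \<nu> \<nu> T) {x \<in> space \<nu>. \<iota> x = i} = measure \<nu> {x \<in> space \<nu>. \<iota> (T x) = i}" for i
      using measurable_space[OF T] by (auto simp: measure_distr[OF T sets] intro!: arg_cong[of _ _ "measure _"])
    then show ?thesis
      using sum_int[OF \<iota>, of B] sum_int[OF \<iota>T, of A] \<iota>(2) measurable_space[OF T] by (simp add: sum.distrib)
  qed
  moreover have "ennreal \<dots> \<le> f_divergence f (distr \<nu> \<nu> T) \<nu>"
    using \<iota> affine_minorant_expectation[OF minorant bounded(2,3)]
    by (intro pair.minorant_sum_le_f_divergence[OF f]) (auto simp: A_def B_def)
  ultimately have "ennreal ((\<integral>x. A (\<iota> (T x)) \<partial>\<nu>) + (\<integral>x. B (\<iota> x) \<partial>\<nu>)) \<le> f_divergence f (distr \<nu> \<nu> T) \<nu>"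
    by simp
  moreover have "ennreal (?E (map_pmf \<sigma> (bind_pmf \<theta> m)) \<alpha> + ?E (bind_pmf \<theta> m) \<beta>) \<le>
      ennreal ((\<integral>x. A (\<iota> (T x)) \<partial>\<nu>) + (\<integral>x. B (\<iota> x) \<partial>\<nu>)) + ennreal (L * (e + 2 * d))"
  proof (rule order_trans[OF ennreal_leI[OF le] ennreal_add_le])
    have "0 \<le> d" using bad(2) measure_nonneg[of \<nu> D] by linarith
    then show "0 \<le> L * (e + 2 * d)" using bounded(1) e by simp
  qed
  ultimately show ?thesis by (meson add_right_mono order_trans)
qed

section \<open>Smoothing a measure on a finitely generated group\<close>

lemma pmf_bind_ge: "pmf M i * pmf (K i) x \<le> pmf (bind_pmf M K) x"
proof -
  have "pmf M i * pmf (K i) x = measure_pmf.expectation M (\<lambda>j. indicator {i} j * pmf (K i) x)"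
    by (simp add: measure_pmf_single)
  also have "\<dots> \<le> measure_pmf.expectation M (\<lambda>j. pmf (K j) x)"
    by (intro integral_mono integrable_pmf_bounded[where c = 1])
      (auto simp: indicator_def pmf_le_1 abs_mult)
  finally show ?thesis by (simp add: pmf_bind)
qed

lemma pmf_map_ge: "pmf M x \<le> pmf (map_pmf h M) (h x)"
proof -
  have "pmf M x = measure (measure_pmf M) {x}" by (simp add: measure_pmf_single)
  also have "\<dots> \<le> measure (measure_pmf M) (h -` {h x})" by (intro measure_pmf.finite_measure_mono) auto
  finally show ?thesis by (simp add: pmf_map)
qed

lemma expectation_reweight:
  fixes \<phi> :: "'a \<Rightarrow> real"
  assumes "set_pmf P \<subseteq> set_pmf Q"
  shows "measure_pmf.expectation P \<phi> = measure_pmf.expectation Q (\<lambda>x. pmf P x / pmf Q x * \<phi> x)"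
proof -
  have "measure_pmf.expectation P \<phi> = (\<integral>x. pmf P x * \<phi> x \<partial>count_space UNIV)"
    unfolding measure_pmf_eq_density[of P] by (subst integral_density) auto
  also have "\<dots> = (\<integral>x. pmf Q x * (pmf P x / pmf Q x * \<phi> x) \<partial>count_space UNIV)"
    using assms by (intro Bochner_Integration.integral_cong refl) (auto simp: set_pmf_iff)
  also have "\<dots> = measure_pmf.expectation Q (\<lambda>x. pmf P x / pmf Q x * \<phi> x)"
    unfolding measure_pmf_eq_density[of Q] by (subst integral_density) auto
  finally show ?thesis .
qed

lemma expectation_pair_reweight:
  fixes \<phi> \<psi> :: "'a \<Rightarrow> real"
  assumes PQ: "set_pmf P \<subseteq> set_pmf Q" "\<forall>x\<in>set_pmf Q. pmf P x \<le> C * pmf Q x"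
    and bounded: "\<And>x. \<bar>\<phi> x\<bar> \<le> K" "\<And>x. \<bar>\<psi> x\<bar> \<le> K"
  shows "integrable (measure_pmf Q) (\<lambda>x. pmf P x / pmf Q x * \<phi> x + \<psi> x)"
    and "measure_pmf.expectation P \<phi> + measure_pmf.expectation Q \<psi> =
      measure_pmf.expectation Q (\<lambda>x. pmf P x / pmf Q x * \<phi> x + \<psi> x)"
proof -
  have int\<psi>: "integrable (measure_pmf Q) \<psi>" by (rule integrable_pmf_bounded[OF bounded(2)])
  have int\<phi>: "integrable (measure_pmf Q) (\<lambda>x. pmf P x / pmf Q x * \<phi> x)"
  proof (rule measure_pmf.integrable_const_bound[where B = "C * K"])
    show "AE x in measure_pmf Q. norm (pmf P x / pmf Q x * \<phi> x) \<le> C * K"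
    proof (rule AE_pmfI)
      fix x assume x: "x \<in> set_pmf Q"
      have "pmf P x / pmf Q x \<le> C" using PQ(2) x pmf_positive[OF x] by (simp add: divide_le_eq)
      moreover have "0 \<le> pmf P x / pmf Q x" by simp
      moreover from calculation have "0 \<le> C" by linarith
      ultimately show "norm (pmf P x / pmf Q x * \<phi> x) \<le> C * K"
        unfolding real_norm_def abs_mult using bounded(1)[of x] by (intro mult_mono) auto
    qed
  qed simp
  show "integrable (measure_pmf Q) (\<lambda>x. pmf P x / pmf Q x * \<phi> x + \<psi> x)" using int\<psi> int\<phi> by simp
  show "measure_pmf.expectation P \<phi> + measure_pmf.expectation Q \<psi> =
      measure_pmf.expectation Q (\<lambda>x. pmf P x / pmf Q x * \<phi> x + \<psi> x)"
    using int\<psi> int\<phi> expectation_reweight[OF PQ(1), of \<phi>] by simp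
qed

context group
begin

text \<open>\<open>\<kappa>\<close> is the law of a random walk started from \<open>\<omega>\<close> and stopped at a geometric time. The equation
  \<open>\<kappa> = \<omega>/2 + u * \<kappa>/2\<close>, with \<open>u\<close> the uniform measure on the generators and their inverses, gives all the bounds, with a
  constant that does not depend on \<open>\<omega>\<close>.\<close>

lemma smoothing_pmf:
  assumes S: "finite S" "S \<noteq> {}" "S \<subseteq> carrier G"
  obtains c :: real where "0 < c" "c \<le> 1"
    "\<And>\<omega>. set_pmf \<omega> \<subseteq> generate G S \<Longrightarrow> \<exists>\<kappa>. set_pmf \<kappa> = generate G S \<and>
      (\<forall>x. c * pmf \<omega> x \<le> pmf \<kappa> x) \<and> (\<forall>s\<in>S \<union> m_inv G ` S. \<forall>x. c * pmf \<kappa> x \<le> pmf \<kappa> (s \<otimes> x))"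
proof -
  define S' where "S' = S \<union> m_inv G ` S"
  have S': "finite S'" "S' \<noteq> {}" "S' \<subseteq> carrier G" using S by (auto simp: S'_def)
  define u where "u = pmf_of_set S'"
  define c where "c = 1 / (2 * real (card S'))"
  have card: "1 \<le> real (card S')" using S' by (simp add: Suc_le_eq card_gt_0_iff)
  have c: "0 < c" "c \<le> 1 / 2" using card by (auto simp: c_def field_simps)
  have set_u: "set_pmf u = S'" using S' by (simp add: u_def)
  have gen: "subgroup (generate G S) G" by (rule generate_is_subgroup[OF S(3)])
  have S'_gen: "s \<in> generate G S" if "s \<in> S'" for s
    using that subgroup.m_inv_closed[OF gen] by (auto simp: S'_def intro: generate.incl)
  show thesis
  proof (rule that[of c])
    fix \<omega> :: "'a pmf" assume \<omega>: "set_pmf \<omega> \<subseteq> generate G S"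
    define W where "W = rec_nat \<omega> (\<lambda>_ M. bind_pmf u (\<lambda>s. map_pmf (\<lambda>x. s \<otimes> x) M))"
    have W: "W 0 = \<omega>" "W (Suc n) = bind_pmf u (\<lambda>s. map_pmf (\<lambda>x. s \<otimes> x) (W n))" for n
      by (simp_all add: W_def)
    have set_W: "set_pmf (W n) \<subseteq> generate G S" for n
    proof (induction n)
      case (Suc n)
      then show ?case using S'_gen set_u subgroup.m_closed[OF gen] by (auto simp: W)
    qed (simp add: W \<omega>)
    define \<kappa> where "\<kappa> = bind_pmf (geometric_pmf (1 / 2)) W"
    define \<kappa>' where "\<kappa>' = bind_pmf u (\<lambda>s. map_pmf (\<lambda>x. s \<otimes> x) \<kappa>)"
    have \<kappa>'_eq: "\<kappa>' = bind_pmf (geometric_pmf (1 / 2)) (\<lambda>n. W (Suc n))"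
      unfolding \<kappa>'_def \<kappa>_def W map_bind_pmf by (subst bind_commute_pmf) simp
    have \<kappa>_eq: "\<kappa> = bind_pmf (bernoulli_pmf (1 / 2)) (\<lambda>b. if b then \<omega> else bind_pmf (geometric_pmf (1 / 2)) (\<lambda>n. W (Suc n)))"
      unfolding \<kappa>_def
      by (subst geometric_bind_pmf_unfold) (auto simp: bind_assoc_pmf bind_map_pmf bind_return_pmf W(1) intro!: bind_pmf_cong)
    have mix: "\<kappa> = bind_pmf (bernoulli_pmf (1 / 2)) (\<lambda>b. if b then \<omega> else \<kappa>')"
      unfolding \<kappa>'_eq by (rule \<kappa>_eq)
    have half: "pmf \<kappa> x = (pmf \<omega> x + pmf \<kappa>' x) / 2" for x
      by (subst mix) (simp add: pmf_bind)
    have shift: "c * pmf \<kappa> x \<le> pmf \<kappa> (s \<otimes> x)" if s: "s \<in> S'" for s x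
    proof -
      have "c * pmf \<kappa> x = (pmf u s * pmf \<kappa> x) / 2" using S' s by (simp add: c_def u_def)
      also have "\<dots> \<le> (pmf u s * pmf (map_pmf (\<lambda>x. s \<otimes> x) \<kappa>) (s \<otimes> x)) / 2"
        by (intro divide_right_mono mult_left_mono pmf_map_ge) auto
      also have "\<dots> \<le> pmf \<kappa>' (s \<otimes> x) / 2"
        unfolding \<kappa>'_def by (intro divide_right_mono pmf_bind_ge) auto
      also have "\<dots> \<le> pmf \<kappa> (s \<otimes> x)" by (simp add: half)
      finally show ?thesis .
    qed
    have "c * pmf \<omega> x \<le> pmf \<kappa> x" for x
    proof -
      have "c * pmf \<omega> x \<le> 1 / 2 * pmf \<omega> x" using c by (intro mult_right_mono) auto
      also have "\<dots> \<le> pmf \<kappa> x" by (simp add: half)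
      finally show ?thesis .
    qed
    moreover have "set_pmf \<kappa> = generate G S"
    proof
      show "set_pmf \<kappa> \<subseteq> generate G S" using set_W by (auto simp: \<kappa>_def)
      have spread: "x \<otimes> h \<in> set_pmf \<kappa>" if "x \<in> generate G S" "h \<in> set_pmf \<kappa>" "h \<in> carrier G" for x h
        using that
      proof (induction arbitrary: h rule: generate.induct)
        case (incl s)
        have "0 < c * pmf \<kappa> h" using c(1) incl(2) by (simp add: pmf_positive)
        also have "\<dots> \<le> pmf \<kappa> (s \<otimes> h)" using incl(1) by (intro shift) (simp add: S'_def)
        finally show ?case by (simp add: set_pmf_iff)
      next
        case (inv s)
        have "0 < c * pmf \<kappa> h" using c(1) inv(2) by (simp add: pmf_positive)
        also have "\<dots> \<le> pmf \<kappa> (inv s \<otimes> h)" using inv(1) by (intro shift) (simp add: S'_def)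
        finally show ?case by (simp add: set_pmf_iff)
      next
        case (eng x y)
        have "x \<in> carrier G" "y \<in> carrier G" using eng(1,2) subgroup.subset[OF gen] by auto
        then show ?case using eng(3)[OF eng(4)[OF eng(5,6)]] eng(6) by (simp add: m_assoc)
      qed simp
      obtain h where h: "h \<in> set_pmf \<kappa>" using set_pmf_not_empty[of \<kappa>] by blast
      then have hg: "h \<in> generate G S" using \<open>set_pmf \<kappa> \<subseteq> generate G S\<close> by blast
      then have hc: "h \<in> carrier G" using subgroup.subset[OF gen] by blast
      show "generate G S \<subseteq> set_pmf \<kappa>"
      proof
        fix x assume x: "x \<in> generate G S"
        have "x \<otimes> inv h \<in> generate G S" using x hg subgroup.m_closed[OF gen] subgroup.m_inv_closed[OF gen] by blast
        from spread[OF this h hc] show "x \<in> set_pmf \<kappa>" using x hc subgroup.subset[OF gen] by (simp add: m_assoc subset_iff)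
      qed
    qed
    ultimately show "\<exists>\<kappa>. set_pmf \<kappa> = generate G S \<and>
      (\<forall>x. c * pmf \<omega> x \<le> pmf \<kappa> x) \<and> (\<forall>s\<in>S \<union> m_inv G ` S. \<forall>x. c * pmf \<kappa> x \<le> pmf \<kappa> (s \<otimes> x))"
      using shift unfolding S'_def by blast
  qed (use c in auto)
qed

end

text \<open>The measure \<open>\<omega>\<close> as a measure with underlying space \<open>\<Gamma>\<close>. The point \<open>z \<in> \<Gamma>\<close> only absorbs the values outside \<open>\<Gamma>\<close>,
  which have probability zero.\<close>

definition measure_on :: "'a set \<Rightarrow> 'a \<Rightarrow> 'a pmf \<Rightarrow> 'a measure" where
  "measure_on \<Gamma> z \<omega> = distr (measure_pmf \<omega>) (count_space \<Gamma>) (\<lambda>x. if x \<in> \<Gamma> then x else z)"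

lemma measure_on_facts:
  assumes "z \<in> \<Gamma>" "set_pmf \<omega> \<subseteq> \<Gamma>"
  shows "prob_space (measure_on \<Gamma> z \<omega>)" "sets (measure_on \<Gamma> z \<omega>) = sets (count_space \<Gamma>)"
    "space (measure_on \<Gamma> z \<omega>) = \<Gamma>"
    "A \<subseteq> \<Gamma> \<Longrightarrow> emeasure (measure_on \<Gamma> z \<omega>) A = emeasure (measure_pmf \<omega>) A"
proof -
  have meas: "(\<lambda>x. if x \<in> \<Gamma> then x else z) \<in> measurable (measure_pmf \<omega>) (count_space \<Gamma>)"
    using assms(1) by simp
  show "prob_space (measure_on \<Gamma> z \<omega>)"
    unfolding measure_on_def by (rule measure_pmf.prob_space_distr[OF meas])
  show "sets (measure_on \<Gamma> z \<omega>) = sets (count_space \<Gamma>)" "space (measure_on \<Gamma> z \<omega>) = \<Gamma>"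
    by (simp_all add: measure_on_def)
  assume A: "A \<subseteq> \<Gamma>"
  have "emeasure (measure_on \<Gamma> z \<omega>) A = emeasure (measure_pmf \<omega>) ((\<lambda>x. if x \<in> \<Gamma> then x else z) -` A)"
    unfolding measure_on_def using A by (subst emeasure_distr[OF meas]) auto
  also have "\<dots> = emeasure (measure_pmf \<omega>) A"
    using assms(2) by (intro emeasure_eq_AE) (auto simp: AE_measure_pmf_iff subset_iff)
  finally show "emeasure (measure_on \<Gamma> z \<omega>) A = emeasure (measure_pmf \<omega>) A" .
qed

lemma distr_measure_on:
  assumes z: "z \<in> \<Gamma>" and \<omega>: "set_pmf \<omega> \<subseteq> \<Gamma>" and t: "\<And>x. x \<in> \<Gamma> \<Longrightarrow> t x \<in> \<Gamma>"
  shows "distr (measure_on \<Gamma> z \<omega>) (measure_on \<Gamma> z \<omega>) t = measure_on \<Gamma> z (map_pmf t \<omega>)"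
proof (rule measure_eqI)
  have t\<omega>: "set_pmf (map_pmf t \<omega>) \<subseteq> \<Gamma>" using \<omega> t by auto
  note facts = measure_on_facts[OF z \<omega>] measure_on_facts[OF z t\<omega>]
  show "sets (distr (measure_on \<Gamma> z \<omega>) (measure_on \<Gamma> z \<omega>) t) = sets (measure_on \<Gamma> z (map_pmf t \<omega>))"
    by (simp add: facts(2,6))
  fix A assume "A \<in> sets (distr (measure_on \<Gamma> z \<omega>) (measure_on \<Gamma> z \<omega>) t)"
  then have A: "A \<subseteq> \<Gamma>" by (simp add: facts(2))
  have "t \<in> measurable (count_space \<Gamma>) (count_space \<Gamma>)" using t by simp
  then have meas: "t \<in> measurable (measure_on \<Gamma> z \<omega>) (measure_on \<Gamma> z \<omega>)"
    using measurable_cong_sets[OF facts(2) facts(2)] by blast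
  have "emeasure (distr (measure_on \<Gamma> z \<omega>) (measure_on \<Gamma> z \<omega>) t) A =
      emeasure (measure_on \<Gamma> z \<omega>) (t -` A \<inter> \<Gamma>)"
    using A by (subst emeasure_distr[OF meas]) (auto simp: facts(2,3))
  also have "\<dots> = emeasure (measure_pmf \<omega>) (t -` A \<inter> \<Gamma>)" by (rule facts(4)) simp
  also have "\<dots> = emeasure (measure_pmf \<omega>) (t -` A)"
    using \<omega> by (intro emeasure_eq_AE) (auto simp: AE_measure_pmf_iff)
  also have "\<dots> = emeasure (measure_pmf (map_pmf t \<omega>)) A" by simp
  also have "\<dots> = emeasure (measure_on \<Gamma> z (map_pmf t \<omega>)) A" by (rule facts(8)[OF A, symmetric])
  finally show "emeasure (distr (measure_on \<Gamma> z \<omega>) (measure_on \<Gamma> z \<omega>) t) A =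
      emeasure (measure_on \<Gamma> z (map_pmf t \<omega>)) A" .
qed

text \<open>At every point the tangent at the ratio of the two weights is the largest of all affine minorants.\<close>

lemma f_divergence_measure_on_le:
  assumes f: "convex_on {0<..} f" "f 1 = 0"
    and z: "z \<in> \<Gamma>" and sets: "set_pmf P = \<Gamma>" "set_pmf Q = \<Gamma>"
    and ratio: "\<And>x. x \<in> \<Gamma> \<Longrightarrow> pmf P x \<le> C * pmf Q x"
    and tangent: "\<And>x. x \<in> \<Gamma> \<Longrightarrow> \<alpha> x * (pmf P x / pmf Q x) + \<beta> x = f (pmf P x / pmf Q x)"
    and bounded: "\<And>x. \<bar>\<alpha> x\<bar> \<le> L" "\<And>x. \<bar>\<beta> x\<bar> \<le> L"
  shows "f_divergence f (measure_on \<Gamma> z P) (measure_on \<Gamma> z Q) \<le>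
    ennreal (measure_pmf.expectation P \<alpha> + measure_pmf.expectation Q \<beta>)"
proof -
  let ?E = "measure_pmf.expectation"
  let ?r = "\<lambda>x. pmf P x / pmf Q x"
  have facts: "prob_space (measure_on \<Gamma> z P)" "prob_space (measure_on \<Gamma> z Q)"
    "sets (measure_on \<Gamma> z P) = sets (measure_on \<Gamma> z Q)" "space (measure_on \<Gamma> z P) = \<Gamma>"
    using measure_on_facts[OF z] sets by simp_all
  have meas: "measure (measure_on \<Gamma> z P) A = measure (measure_pmf P) A"
    "measure (measure_on \<Gamma> z Q) A = measure (measure_pmf Q) A" if "A \<subseteq> \<Gamma>" for A
    unfolding measure_def using measure_on_facts(4)[OF z _ that] sets by auto
  interpret pair: probability_pair "measure_on \<Gamma> z P" "measure_on \<Gamma> z Q"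
    using facts by (simp add: probability_pair_def probability_pair_axioms_def)
  have Qpos: "0 < pmf Q x" "0 < ?r x" "?r x \<le> C" if "x \<in> \<Gamma>" for x
  proof -
    show "0 < pmf Q x" using that sets(2) by (simp add: pmf_positive)
    then show "0 < ?r x" "?r x \<le> C" using that sets(1) ratio[OF that] by (simp_all add: pmf_positive divide_le_eq)
  qed
  have PQ: "set_pmf P \<subseteq> set_pmf Q" "\<forall>x\<in>set_pmf Q. pmf P x \<le> C * pmf Q x"
    using sets ratio by auto
  note reweight = expectation_pair_reweight[OF PQ]
  show ?thesis
  proof (rule pair.f_divergence_leI[OF f])
    fix n :: nat and k a b
    assume k: "k \<in> measurable (measure_on \<Gamma> z P) (count_space UNIV)" "\<And>x. x \<in> space (measure_on \<Gamma> z P) \<Longrightarrow> k x < n"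
      and minorant: "\<And>i. i < n \<Longrightarrow> affine_minorant f (a i) (b i)"
    define k' where "k' = (\<lambda>x. if x \<in> \<Gamma> then k x else 0)"
    have n: "0 < n" using k(2)[of z] z facts(4) by auto
    have k': "k' x < n" for x using k(2)[of x] n facts(4) by (auto simp: k'_def)
    have sum: "(\<Sum>i<n. F i * measure (measure_pmf M) {x \<in> \<Gamma>. k x = i}) = ?E M (\<lambda>x. F (k' x))"
      if M: "set_pmf M = \<Gamma>" for F :: "nat \<Rightarrow> real" and M
    proof -
      have "?E M (\<lambda>x. F (k' x)) = ?E (map_pmf k' M) F" by simp
      also have "\<dots> = (\<Sum>i<n. F i * pmf (map_pmf k' M) i)"
        using k' by (intro integral_measure_pmf_real) auto
      also have "\<dots> = (\<Sum>i<n. F i * measure (measure_pmf M) {x \<in> \<Gamma>. k x = i})"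
        using M by (auto simp: pmf_map k'_def AE_measure_pmf_iff intro!: sum.cong measure_pmf.finite_measure_eq_AE)
      finally show ?thesis by simp
    qed
    define K where "K = Max ((\<lambda>i. \<bar>a i\<bar>) ` {..<n} \<union> (\<lambda>i. \<bar>b i\<bar>) ` {..<n})"
    have K: "\<bar>a (k' x)\<bar> \<le> K" "\<bar>b (k' x)\<bar> \<le> K" for x
      using k'[of x] by (auto simp: K_def intro!: Max_ge)
    have "(\<Sum>i<n. a i * measure (measure_pmf P) {x \<in> \<Gamma>. k x = i} + b i * measure (measure_pmf Q) {x \<in> \<Gamma>. k x = i})
        = ?E P (\<lambda>x. a (k' x)) + ?E Q (\<lambda>x. b (k' x))"
      using sum[OF sets(1), of a] sum[OF sets(2), of b] by (simp add: sum.distrib)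
    also have "\<dots> = ?E Q (\<lambda>x. ?r x * a (k' x) + b (k' x))" by (rule reweight(2)[OF K])
    also have "\<dots> \<le> ?E Q (\<lambda>x. ?r x * \<alpha> x + \<beta> x)"
    proof (rule integral_mono_AE[OF reweight(1)[OF K] reweight(1)[OF bounded]], rule AE_pmfI)
      fix x assume "x \<in> set_pmf Q"
      then have x: "x \<in> \<Gamma>" using sets by simp
      have "a (k' x) * ?r x + b (k' x) \<le> f (?r x)"
        using minorant[OF k'[of x]] Qpos(2)[OF x] unfolding affine_minorant_def by blast
      then show "?r x * a (k' x) + b (k' x) \<le> ?r x * \<alpha> x + \<beta> x"
        using tangent[OF x] by (simp add: mult.commute)
    qed
    also have "\<dots> = ?E P \<alpha> + ?E Q \<beta>" by (rule reweight(2)[OF bounded, symmetric])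
    finally show "ennreal (\<Sum>i<n. a i * measure (measure_on \<Gamma> z P) {x \<in> space (measure_on \<Gamma> z P). k x = i}
        + b i * measure (measure_on \<Gamma> z Q) {x \<in> space (measure_on \<Gamma> z P). k x = i}) \<le> ennreal (?E P \<alpha> + ?E Q \<beta>)"
      using meas by (simp add: facts(4) ennreal_leI)
  qed
qed

lemma tangents_bounded:
  assumes f: "convex_on {0<..} f" and C: "1 \<le> C"
  obtains K where "0 < K" "\<And>u. 1 / C \<le> u \<Longrightarrow> u \<le> C \<Longrightarrow>
    \<bar>f u\<bar> \<le> K \<and> \<bar>tangent_slope f u\<bar> \<le> K \<and> \<bar>f u - tangent_slope f u * u\<bar> \<le> K"
proof -
  have pos: "0 < u" if "1 / C \<le> u" for u
  proof -
    have "0 < 1 / C" using C by simp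
    then show ?thesis using that by linarith
  qed
  have "continuous_on {1 / C..C} f"
    using isCont_convex[OF f] pos by (intro continuous_at_imp_continuous_on) auto
  then have "bounded (f ` {1 / C..C})" by (intro compact_imp_bounded compact_continuous_image) auto
  then obtain F where F: "0 < F" "\<forall>y\<in>f ` {1 / C..C}. norm y \<le> F" unfolding bounded_pos by blast
  define A where "A = max \<bar>tangent_slope f (1 / C)\<bar> \<bar>tangent_slope f C\<bar>"
  show thesis
  proof (rule that[of "F + A * C"])
    have "0 \<le> A * C" using C by (simp add: A_def)
    then show "0 < F + A * C" using F(1) by linarith
    fix u assume u: "1 / C \<le> u" "u \<le> C"
    have fu: "\<bar>f u\<bar> \<le> F" using F(2) u by auto
    have "tangent_slope f (1 / C) \<le> tangent_slope f u" "tangent_slope f u \<le> tangent_slope f C"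
      using tangent_slope_mono[OF f] pos u C by auto
    then have a: "\<bar>tangent_slope f u\<bar> \<le> A" by (auto simp: A_def)
    have "\<bar>tangent_slope f u * u\<bar> \<le> A * C"
      unfolding abs_mult using a u pos[OF u(1)] by (intro mult_mono) auto
    moreover have "A \<le> A * C" using C by (simp add: A_def mult_le_cancel_left1 max_def)
    ultimately show "\<bar>f u\<bar> \<le> F + A * C \<and> \<bar>tangent_slope f u\<bar> \<le> F + A * C \<and> \<bar>f u - tangent_slope f u * u\<bar> \<le> F + A * C"
      using fu a F(1) \<open>0 \<le> A * C\<close> by linarith
  qed
qed

abbreviation bounded_minorants ::
  "(real \<Rightarrow> real) \<Rightarrow> real \<Rightarrow> ('a \<Rightarrow> real) \<Rightarrow> ('a \<Rightarrow> real) \<Rightarrow> bool" where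
  "bounded_minorants f L \<alpha> \<beta> \<equiv>
    (\<forall>x. affine_minorant f (\<alpha> x) (\<beta> x) \<and> \<bar>\<alpha> x\<bar> \<le> L \<and> \<bar>\<beta> x\<bar> \<le> L)"

context group
begin

text \<open>The mixture \<open>\<omega>\<close> of \<open>\<omega>'\<close> and \<open>\<kappa>\<close> with weights \<open>1 - \<eta>\<close> and \<open>\<eta>\<close> has bounded ratios, since \<open>\<kappa>\<close> dominates all the
  measures involved. The bound \<open>M\<close> for the contribution of \<open>\<kappa>\<close> has to be independent of \<open>\<eta>\<close>, unlike \<open>L\<close>; it comes
  from the ratios of \<open>\<kappa>\<close> alone.\<close>

lemma smoothed_approximation:
  assumes f: "convex_on {0<..} f" "f 1 = 0"
    and S: "finite S" "S \<noteq> {}" "S \<subseteq> carrier G" and \<delta>: "0 < (\<delta> :: real)"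
  obtains L \<eta> :: real where "0 < L" "0 < \<eta>" "\<eta> < 1"
    "\<And>\<omega>'. set_pmf \<omega>' \<subseteq> generate G S \<Longrightarrow> \<exists>\<omega>. set_pmf \<omega> = generate G S \<and> (\<forall>s\<in>S. \<exists>\<alpha> \<beta>.
      bounded_minorants f L \<alpha> \<beta> \<and>
      f_divergence f (measure_on (generate G S) \<one> (map_pmf (\<lambda>x. s \<otimes> x) \<omega>)) (measure_on (generate G S) \<one> \<omega>) \<le>
        ennreal ((1 - \<eta>) * (measure_pmf.expectation (map_pmf (\<lambda>x. s \<otimes> x) \<omega>') \<alpha> + measure_pmf.expectation \<omega>' \<beta>) + \<delta>))"
proof -
  let ?E = "measure_pmf.expectation"
  define \<Gamma> where "\<Gamma> = generate G S"
  have gen: "subgroup \<Gamma> G" unfolding \<Gamma>_def by (rule generate_is_subgroup[OF S(3)])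
  have \<Gamma>c: "\<Gamma> \<subseteq> carrier G" by (rule subgroup.subset[OF gen])
  have S\<Gamma>: "S \<subseteq> \<Gamma>" unfolding \<Gamma>_def by (auto intro: generate.incl)
  obtain c :: real where c: "0 < c" "c \<le> 1" and \<kappa>_ex: "\<And>\<omega>. set_pmf \<omega> \<subseteq> \<Gamma> \<Longrightarrow> \<exists>\<kappa>. set_pmf \<kappa> = \<Gamma> \<and>
      (\<forall>x. c * pmf \<omega> x \<le> pmf \<kappa> x) \<and> (\<forall>s\<in>S \<union> m_inv G ` S. \<forall>x. c * pmf \<kappa> x \<le> pmf \<kappa> (s \<otimes> x))"
    unfolding \<Gamma>_def by (rule smoothing_pmf[OF S]) blast
  have c1: "1 \<le> 1 / c" using c by simp
  obtain M where M0: "0 < M" and M1: "\<And>t. 1 / (1 / c) \<le> t \<Longrightarrow> t \<le> 1 / c \<Longrightarrow>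
    \<bar>f t\<bar> \<le> M \<and> \<bar>tangent_slope f t\<bar> \<le> M \<and> \<bar>f t - tangent_slope f t * t\<bar> \<le> M"
    by (rule tangents_bounded[OF f(1) c1]) blast
  have M: "0 < M" "\<And>t. c \<le> t \<Longrightarrow> t \<le> 1 / c \<Longrightarrow> \<bar>f t\<bar> \<le> M"
    using M0 M1 by simp_all
  define \<eta> where "\<eta> = min (1 / 2) (\<delta> / M)"
  have \<eta>: "0 < \<eta>" "\<eta> < 1" "\<eta> * M \<le> \<delta>"
  proof -
    show "0 < \<eta>" "\<eta> < 1" using M \<delta> by (auto simp: \<eta>_def)
    have "\<eta> * M \<le> \<delta> / M * M" using M by (intro mult_right_mono) (auto simp: \<eta>_def)
    then show "\<eta> * M \<le> \<delta>" using M by simp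
  qed
  define C where "C = 1 / (\<eta> * c * c)"
  have \<eta>c: "0 < \<eta> * c * c" "\<eta> * c * c \<le> 1"
    using \<eta> c by (auto intro!: mult_le_one)
  then have C: "1 \<le> C" by (simp add: C_def)
  obtain L where L: "0 < L" "\<And>u. 1 / C \<le> u \<Longrightarrow> u \<le> C \<Longrightarrow>
    \<bar>f u\<bar> \<le> L \<and> \<bar>tangent_slope f u\<bar> \<le> L \<and> \<bar>f u - tangent_slope f u * u\<bar> \<le> L"
    by (rule tangents_bounded[OF f(1) C]) blast
  show thesis
  proof (rule that[OF L(1) \<eta>(1,2)], fold \<Gamma>_def)
    fix \<omega>' :: "'a pmf" assume \<omega>': "set_pmf \<omega>' \<subseteq> \<Gamma>"
    from \<kappa>_ex[OF this] obtain \<kappa> where \<kappa>: "set_pmf \<kappa> = \<Gamma>" "\<And>x. c * pmf \<omega>' x \<le> pmf \<kappa> x"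
      "\<And>s x. s \<in> S \<union> m_inv G ` S \<Longrightarrow> c * pmf \<kappa> x \<le> pmf \<kappa> (s \<otimes> x)" by blast
    define \<omega> where "\<omega> = bind_pmf (bernoulli_pmf \<eta>) (\<lambda>b. if b then \<kappa> else \<omega>')"
    have pmf_\<omega>: "pmf \<omega> x = \<eta> * pmf \<kappa> x + (1 - \<eta>) * pmf \<omega>' x" for x
      using \<eta> by (simp add: \<omega>_def pmf_bind)
    have E_\<omega>: "?E \<omega> \<phi> = \<eta> * ?E \<kappa> \<phi> + (1 - \<eta>) * ?E \<omega>' \<phi>" if "\<And>x. \<bar>\<phi> x\<bar> \<le> K" for \<phi> :: "'a \<Rightarrow> real" and K
      using \<eta> by (simp add: \<omega>_def expectation_bind_pmf[of \<phi>, OF that])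
    have set_\<omega>: "set_pmf \<omega> = \<Gamma>" using \<eta> \<kappa>(1) \<omega>' by (auto simp: \<omega>_def set_pmf_bernoulli UNIV_bool)
    have lower: "\<eta> * pmf \<kappa> x \<le> pmf \<omega> x" for x using \<eta> by (simp add: pmf_\<omega>)
    have upper: "c * pmf \<omega> x \<le> pmf \<kappa> x" for x
    proof -
      have "c * pmf \<omega> x = \<eta> * (c * pmf \<kappa> x) + (1 - \<eta>) * (c * pmf \<omega>' x)" by (simp add: pmf_\<omega> algebra_simps)
      also have "\<dots> \<le> \<eta> * pmf \<kappa> x + (1 - \<eta>) * pmf \<kappa> x"
        using \<eta> \<kappa>(2) c by (intro add_mono mult_left_mono mult_left_le_one_le) auto
      finally show ?thesis by (simp add: algebra_simps)
    qed
    show "\<exists>\<omega>. set_pmf \<omega> = \<Gamma> \<and> (\<forall>s\<in>S. \<exists>\<alpha> \<beta>.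
      bounded_minorants f L \<alpha> \<beta> \<and>
      f_divergence f (measure_on \<Gamma> \<one> (map_pmf (\<lambda>x. s \<otimes> x) \<omega>)) (measure_on \<Gamma> \<one> \<omega>) \<le>
        ennreal ((1 - \<eta>) * (?E (map_pmf (\<lambda>x. s \<otimes> x) \<omega>') \<alpha> + ?E \<omega>' \<beta>) + \<delta>))"
    proof (intro exI[of _ \<omega>] conjI set_\<omega> ballI)
      fix s assume s: "s \<in> S"
      have sc: "s \<in> carrier G" "s \<in> \<Gamma>" using s S S\<Gamma> by auto
      let ?s = "map_pmf (\<lambda>x. s \<otimes> x)"
      have shift_mem: "inv s \<otimes> x \<in> \<Gamma>" "s \<otimes> (inv s \<otimes> x) = x" if "x \<in> \<Gamma>" for x
      proof -
        show "inv s \<otimes> x \<in> \<Gamma>" using that sc gen by (simp add: subgroup.m_closed subgroup.m_inv_closed)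
        show "s \<otimes> (inv s \<otimes> x) = x" using that sc \<Gamma>c by (auto simp: m_assoc[symmetric])
      qed
      have pmf_s: "pmf (?s \<mu>) x = pmf \<mu> (inv s \<otimes> x)" if "x \<in> \<Gamma>" "set_pmf \<mu> = \<Gamma>" for \<mu> x
      proof -
        have "inj_on (\<lambda>x. s \<otimes> x) (set_pmf \<mu>)" using that(2) sc \<Gamma>c by (auto intro!: inj_onI simp: subset_iff)
        from pmf_map_inj[OF this, of "inv s \<otimes> x"] show ?thesis using that shift_mem[OF that(1)] by simp
      qed
      have set_s: "set_pmf (?s \<mu>) = \<Gamma>" if "set_pmf \<mu> = \<Gamma>" for \<mu>
      proof -
        have "(\<lambda>x. s \<otimes> x) ` \<Gamma> = \<Gamma>"
        proof (intro equalityI subsetI)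
          fix x assume "x \<in> \<Gamma>"
          then show "x \<in> (\<lambda>x. s \<otimes> x) ` \<Gamma>" using shift_mem[of x] by (metis image_eqI)
        qed (use sc gen in \<open>auto simp: subgroup.m_closed\<close>)
        then show ?thesis using that by simp
      qed
      have \<kappa>_down: "c * pmf \<kappa> (inv s \<otimes> x) \<le> pmf \<kappa> x" and \<kappa>_up: "c * pmf \<kappa> x \<le> pmf \<kappa> (inv s \<otimes> x)"
        if "x \<in> \<Gamma>" for x
        using \<kappa>(3)[of s "inv s \<otimes> x"] \<kappa>(3)[of "inv s" x] s shift_mem[OF that] by auto
      have pos: "0 < pmf \<omega> x" "0 < pmf \<kappa> x" if "x \<in> \<Gamma>" for x
        using that set_\<omega> \<kappa>(1) by (auto simp: pmf_positive)
      have ratio: "\<eta> * c * c * pmf \<omega> (inv s \<otimes> x) \<le> pmf \<omega> x" "\<eta> * c * c * pmf \<omega> x \<le> pmf \<omega> (inv s \<otimes> x)"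
        if x: "x \<in> \<Gamma>" for x
      proof -
        have "\<eta> * c * c * pmf \<omega> (inv s \<otimes> x) \<le> \<eta> * c * pmf \<kappa> (inv s \<otimes> x)"
          using mult_left_mono[OF upper[of "inv s \<otimes> x"], of "\<eta> * c"] \<eta> c by (simp add: mult.assoc)
        also have "\<dots> \<le> \<eta> * pmf \<kappa> x"
          using mult_left_mono[OF \<kappa>_down[OF x], of \<eta>] \<eta> by (simp add: mult.assoc)
        finally show "\<eta> * c * c * pmf \<omega> (inv s \<otimes> x) \<le> pmf \<omega> x" using lower[of x] by simp
        have "\<eta> * c * c * pmf \<omega> x \<le> \<eta> * c * pmf \<kappa> x"
          using mult_left_mono[OF upper[of x], of "\<eta> * c"] \<eta> c by (simp add: mult.assoc)
        also have "\<dots> \<le> \<eta> * pmf \<kappa> (inv s \<otimes> x)"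
          using mult_left_mono[OF \<kappa>_up[OF x], of \<eta>] \<eta> by (simp add: mult.assoc)
        finally show "\<eta> * c * c * pmf \<omega> x \<le> pmf \<omega> (inv s \<otimes> x)" using lower[of "inv s \<otimes> x"] by simp
      qed
      define \<rho> where "\<rho> = (\<lambda>x. if x \<in> \<Gamma> then pmf (?s \<omega>) x / pmf \<omega> x else 1)"
      have \<rho>: "1 / C \<le> \<rho> x" "\<rho> x \<le> C" for x
      proof -
        show "1 / C \<le> \<rho> x"
          using ratio(2)[of x] pos(1)[of x] C \<eta>c by (auto simp: \<rho>_def pmf_s set_\<omega> C_def le_divide_eq)
        show "\<rho> x \<le> C"
          using ratio(1)[of x] pos(1)[of x] C \<eta>c by (auto simp: \<rho>_def pmf_s set_\<omega> C_def field_simps)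
      qed
      have \<rho>_pos: "0 < \<rho> x" for x
      proof -
        have "0 < 1 / C" using C by simp
        then show ?thesis using \<rho>(1)[of x] by linarith
      qed
      define \<alpha> where "\<alpha> = (\<lambda>x. tangent_slope f (\<rho> x))"
      define \<beta> where "\<beta> = (\<lambda>x. f (\<rho> x) - tangent_slope f (\<rho> x) * \<rho> x)"
      have minorant: "affine_minorant f (\<alpha> x) (\<beta> x)" for x
        unfolding \<alpha>_def \<beta>_def by (rule affine_minorant_tangent[OF f(1) \<rho>_pos])
      have bounded: "\<bar>\<alpha> x\<bar> \<le> L" "\<bar>\<beta> x\<bar> \<le> L" for x
        using L(2)[OF \<rho>] by (auto simp: \<alpha>_def \<beta>_def)
      have "f_divergence f (measure_on \<Gamma> \<one> (?s \<omega>)) (measure_on \<Gamma> \<one> \<omega>) \<le> ennreal (?E (?s \<omega>) \<alpha> + ?E \<omega> \<beta>)"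
      proof (rule f_divergence_measure_on_le[OF f subgroup.one_closed[OF gen] set_s[OF set_\<omega>] set_\<omega>])
        fix x assume x: "x \<in> \<Gamma>"
        have "\<rho> x \<le> C" by (rule \<rho>(2))
        then show "pmf (?s \<omega>) x \<le> C * pmf \<omega> x" using x pos(1)[OF x] by (simp add: \<rho>_def divide_le_eq)
        show "\<alpha> x * (pmf (?s \<omega>) x / pmf \<omega> x) + \<beta> x = f (pmf (?s \<omega>) x / pmf \<omega> x)"
          using x by (simp add: \<alpha>_def \<beta>_def \<rho>_def)
      qed (rule bounded)+
      also have "?E (?s \<omega>) \<alpha> + ?E \<omega> \<beta> =
          (1 - \<eta>) * (?E (?s \<omega>') \<alpha> + ?E \<omega>' \<beta>) + \<eta> * (?E (?s \<kappa>) \<alpha> + ?E \<kappa> \<beta>)"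
        using E_\<omega>[of "\<lambda>x. \<alpha> (s \<otimes> x)", OF bounded(1)] E_\<omega>[of \<beta>, OF bounded(2)] by (simp add: algebra_simps)
      also have "?E (?s \<kappa>) \<alpha> + ?E \<kappa> \<beta> \<le> M"
      proof -
        let ?r = "\<lambda>x. pmf (?s \<kappa>) x / pmf \<kappa> x"
        have sub: "set_pmf (?s \<kappa>) \<subseteq> set_pmf \<kappa>" using set_s[OF \<kappa>(1)] \<kappa>(1) by simp
        have r: "c \<le> ?r x" "?r x \<le> 1 / c" if x: "x \<in> \<Gamma>" for x
        proof -
          show "c \<le> ?r x" using \<kappa>_up[OF x] pos(2)[OF x] x by (simp add: pmf_s \<kappa>(1) le_divide_eq)
          show "?r x \<le> 1 / c" using \<kappa>_down[OF x] pos(2)[OF x] x c by (simp add: pmf_s \<kappa>(1) field_simps)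
        qed
        have le: "\<forall>x\<in>set_pmf \<kappa>. pmf (?s \<kappa>) x \<le> 1 / c * pmf \<kappa> x"
        proof
          fix x assume "x \<in> set_pmf \<kappa>"
          then have "x \<in> \<Gamma>" using \<kappa>(1) by simp
          from r(2)[OF this] pos(2)[OF this] show "pmf (?s \<kappa>) x \<le> 1 / c * pmf \<kappa> x" by (simp only: pos_divide_le_eq)
        qed
        note rw = expectation_pair_reweight[OF sub le bounded]
        have "?E (?s \<kappa>) \<alpha> + ?E \<kappa> \<beta> = ?E \<kappa> (\<lambda>x. ?r x * \<alpha> x + \<beta> x)" by (rule rw(2))
        also have "\<dots> \<le> M"
        proof (rule measure_pmf.integral_le_const[OF rw(1)], rule AE_pmfI)
          fix x assume "x \<in> set_pmf \<kappa>"
          then have x: "x \<in> \<Gamma>" using \<kappa>(1) by simp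
          have "0 < ?r x" using r(1)[OF x] c by linarith
          then have "\<alpha> x * ?r x + \<beta> x \<le> f (?r x)" using minorant[of x] unfolding affine_minorant_def by blast
          also have "\<dots> \<le> M" using M(2)[OF r[OF x]] by linarith
          finally show "?r x * \<alpha> x + \<beta> x \<le> M" by (simp only: mult.commute)
        qed
        finally show ?thesis .
      qed
      then have "ennreal ((1 - \<eta>) * (?E (?s \<omega>') \<alpha> + ?E \<omega>' \<beta>) + \<eta> * (?E (?s \<kappa>) \<alpha> + ?E \<kappa> \<beta>)) \<le>
          ennreal ((1 - \<eta>) * (?E (?s \<omega>') \<alpha> + ?E \<omega>' \<beta>) + \<delta>)"
        using \<eta> by (intro ennreal_leI add_left_mono order_trans[OF mult_left_mono \<eta>(3)]) auto
      finally show "\<exists>\<alpha> \<beta>. bounded_minorants f L \<alpha> \<beta> \<and>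
          f_divergence f (measure_on \<Gamma> \<one> (?s \<omega>)) (measure_on \<Gamma> \<one> \<omega>) \<le>
          ennreal ((1 - \<eta>) * (?E (?s \<omega>') \<alpha> + ?E \<omega>' \<beta>) + \<delta>)"
        using minorant bounded by (intro exI[of _ \<alpha>] exI[of _ \<beta>]) blast
    qed
  qed
qed

end

section \<open>The flag space and the two inequalities\<close>

lemma entropy_eq_sum:
  assumes "finite (set_pmf l)" "set_pmf l \<subseteq> \<Gamma>"
  shows "entropy \<Gamma> l f act \<nu> = (\<Sum>g\<in>set_pmf l. ennreal (pmf l g) * f_divergence f (distr \<nu> \<nu> (act g)) \<nu>)"
proof -
  have "entropy \<Gamma> l f act \<nu> = (\<Sum>\<^sub>\<infinity>g\<in>set_pmf l. ennreal (pmf l g) * f_divergence f (distr \<nu> \<nu> (act g)) \<nu>)"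
    unfolding entropy_def using assms(2) by (intro infsum_cong_neutral) (auto simp: set_pmf_iff)
  then show ?thesis using assms(1) by simp
qed

lemma borel_probability_facts:
  assumes "\<nu> \<in> borel_probabilities X"
  shows "prob_space \<nu>" "space \<nu> = topspace X" "openin X U \<Longrightarrow> U \<in> sets \<nu>"
    "sets \<nu> = sets (sigma (topspace X) {U. openin X U})"
proof -
  show "prob_space \<nu>" and s: "sets \<nu> = sets (sigma (topspace X) {U. openin X U})"
    using assms by (auto simp: borel_probabilities_def)
  have sub: "{U. openin X U} \<subseteq> Pow (topspace X)" using openin_subset by blast
  show "space \<nu> = topspace X" using sets_eq_imp_space_eq[OF s] sub by simp
  show "U \<in> sets \<nu>" if "openin X U" unfolding s using that sub by (simp add: sigma_sets.Basic)
qed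

context topological_group
begin

lemma topspace_flag_space: "topspace (flag_space G T B) = (\<lambda>x. x <# B) ` carrier G"
proof
  show "topspace (flag_space G T B) \<subseteq> (\<lambda>x. x <# B) ` carrier G"
    using openin_topspace[of "flag_space G T B"]
    unfolding flag_space_def openin_quotient_topology topspace_eq by blast
  have "{x \<in> carrier G. x <# B \<in> (\<lambda>x. x <# B) ` carrier G} = carrier G" by auto
  then have "openin (flag_space G T B) ((\<lambda>x. x <# B) ` carrier G)"
    using openin_topspace[of T] by (simp add: flag_space_def openin_quotient_topology topspace_eq)
  then show "(\<lambda>x. x <# B) ` carrier G \<subseteq> topspace (flag_space G T B)" by (rule openin_subset)
qed

lemma coset_in_image_iff:
  assumes B: "subgroup B G" and U: "U \<subseteq> carrier G" "U <#> B \<subseteq> U" and x: "x \<in> carrier G"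
  shows "x <# B \<in> (\<lambda>x. x <# B) ` U \<longleftrightarrow> x \<in> U"
proof
  assume "x <# B \<in> (\<lambda>x. x <# B) ` U"
  then obtain u where u: "u \<in> U" "x <# B = u <# B" by blast
  have "x \<in> x <# B" using x subgroup.one_closed[OF B] unfolding l_coset_def by force
  then have "x \<in> U <#> B" using u unfolding l_coset_def set_mult_def by blast
  then show "x \<in> U" using U by blast
qed auto

lemma openin_flag_space_image:
  assumes B: "subgroup B G" and U: "openin T U" "U <#> B \<subseteq> U"
  shows "openin (flag_space G T B) ((\<lambda>x. x <# B) ` U)"
proof -
  have Uc: "U \<subseteq> carrier G" by (rule open_subset_carrier[OF U(1)])
  have "{x \<in> carrier G. x <# B \<in> (\<lambda>x. x <# B) ` U} = U"
    using coset_in_image_iff[OF B Uc U(2)] Uc by blast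
  then show ?thesis
    using U(1) Uc by (simp add: flag_space_def openin_quotient_topology topspace_eq image_mono)
qed

lemma coset_action:
  assumes "B \<subseteq> carrier G" "g \<in> carrier G" "x \<in> carrier G"
  shows "g <# (x <# B) = (g \<otimes> x) <# B"
  using lcos_m_assoc[OF assms] .

lemma measurable_coset_action:
  assumes B: "subgroup B G" and g: "g \<in> carrier G"
    and \<nu>: "sets \<nu> = sets (sigma (topspace (flag_space G T B)) {U. openin (flag_space G T B) U})"
  shows "(\<lambda>C. g <# C) \<in> measurable \<nu> \<nu>"
proof -
  let ?X = "flag_space G T B"
  have Bc: "B \<subseteq> carrier G" by (rule subgroup.subset[OF B])
  have sub: "{U. openin ?X U} \<subseteq> Pow (topspace ?X)" using openin_subset by blast
  have "(\<lambda>C. g <# C) \<in> measurable (sigma (topspace ?X) {U. openin ?X U}) (sigma (topspace ?X) {U. openin ?X U})"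
  proof (rule measurable_measure_of[OF sub])
    show "(\<lambda>C. g <# C) \<in> space (sigma (topspace ?X) {U. openin ?X U}) \<rightarrow> topspace ?X"
      using sub coset_action[OF Bc g] g by (auto simp: topspace_flag_space)
    fix V assume "V \<in> {U. openin ?X U}"
    then have V: "openin T {x \<in> carrier G. x <# B \<in> V}"
      by (simp add: flag_space_def openin_quotient_topology topspace_eq)
    let ?W = "{C \<in> topspace ?X. g <# C \<in> V}"
    have "{x \<in> carrier G. x <# B \<in> ?W} = inv g <# {x \<in> carrier G. x <# B \<in> V}"
      using g coset_action[OF Bc g] by (subst l_coset_eq_preimage) (auto simp: topspace_flag_space)
    then have "openin T {x \<in> carrier G. x <# B \<in> ?W}" using openin_l_coset[OF _ V] g by simp
    then have "openin ?X ?W"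
      by (simp add: flag_space_def[of G T B, unfolded] openin_quotient_topology topspace_eq
          topspace_flag_space[unfolded flag_space_def])
    moreover have "(\<lambda>C. g <# C) -` V \<inter> space (sigma (topspace ?X) {U. openin ?X U}) = ?W"
      using sub by auto
    ultimately show "(\<lambda>C. g <# C) -` V \<inter> space (sigma (topspace ?X) {U. openin ?X U}) \<in> sets (sigma (topspace ?X) {U. openin ?X U})"
      using sub by (simp add: sigma_sets.Basic)
  qed
  then show ?thesis using measurable_cong_sets[OF \<nu> \<nu>] by blast
qed

lemma I_top_le_I_group:
  assumes f: "convex_on {0<..} f" "f 1 = 0"
    and B: "subgroup B G" and \<Gamma>: "subgroup \<Gamma> G" and l: "finite (set_pmf l)" "set_pmf l \<subseteq> \<Gamma>"
  shows "I_top \<Gamma> l f (\<lambda>g C. g <# C) (flag_space G T B) \<le> I_group G \<Gamma> l f"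
  unfolding I_group_def
proof (rule INF_greatest, clarify)
  fix \<omega> :: "'g measure"
  assume \<omega>: "prob_space \<omega>" "sets \<omega> = sets (count_space \<Gamma>)"
  let ?X = "flag_space G T B"
  let ?N = "sigma (topspace ?X) {U. openin ?X U}"
  let ?\<pi> = "\<lambda>x. x <# B"
  define \<nu> where "\<nu> = distr \<omega> ?N ?\<pi>"
  have Bc: "B \<subseteq> carrier G" by (rule subgroup.subset[OF B])
  have \<Gamma>c: "\<Gamma> \<subseteq> carrier G" by (rule subgroup.subset[OF \<Gamma>])
  have space_\<omega>: "space \<omega> = \<Gamma>" using sets_eq_imp_space_eq[OF \<omega>(2)] by simp
  have space_N: "space ?N = topspace ?X" using openin_subset[of ?X] by (intro space_measure_of) blast
  have \<pi>: "?\<pi> \<in> measurable \<omega> ?N"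
  proof -
    have "?\<pi> \<in> \<Gamma> \<rightarrow> space ?N" unfolding trans[OF space_N topspace_flag_space] using \<Gamma>c by blast
    then have "?\<pi> \<in> measurable (count_space \<Gamma>) ?N" by (simp only: measurable_count_space_eq1)
    then show ?thesis using measurable_cong_sets[OF \<omega>(2) refl, of ?N] by blast
  qed
  have sets_\<nu>: "sets \<nu> = sets ?N" by (simp add: \<nu>_def)
  have "\<nu> \<in> borel_probabilities ?X"
    using prob_space.prob_space_distr[OF \<omega>(1) \<pi>] sets_\<nu> by (simp add: borel_probabilities_def \<nu>_def)
  moreover have "entropy \<Gamma> l f (\<lambda>g C. g <# C) \<nu> \<le> entropy \<Gamma> l f (\<lambda>g x. g \<otimes> x) \<omega>"
    unfolding entropy_eq_sum[OF l]
  proof (intro sum_mono mult_left_mono)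
    fix g assume "g \<in> set_pmf l"
    then have g: "g \<in> \<Gamma>" "g \<in> carrier G" using l \<Gamma>c by auto
    have t: "(\<lambda>x. g \<otimes> x) \<in> measurable \<omega> \<omega>"
    proof -
      have "(\<lambda>x. g \<otimes> x) \<in> measurable (count_space \<Gamma>) (count_space \<Gamma>)" using g \<Gamma> by (simp add: subgroup.m_closed)
      then show ?thesis using measurable_cong_sets[OF \<omega>(2) \<omega>(2)] by blast
    qed
    have act: "(\<lambda>C. g <# C) \<in> measurable ?N ?N" by (rule measurable_coset_action[OF B g(2) refl])
    have "distr \<nu> \<nu> (\<lambda>C. g <# C) = distr \<nu> ?N (\<lambda>C. g <# C)" by (rule distr_cong) (simp_all add: sets_\<nu>)
    also have "\<dots> = distr \<omega> ?N (\<lambda>x. g <# (x <# B))" unfolding \<nu>_def by (subst distr_distr[OF act \<pi>]) (simp add: o_def)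
    also have "\<dots> = distr \<omega> ?N (\<lambda>x. (g \<otimes> x) <# B)"
      using coset_action[OF Bc g(2)] \<Gamma>c by (intro distr_cong) (auto simp: space_\<omega>)
    also have "\<dots> = distr (distr \<omega> \<omega> (\<lambda>x. g \<otimes> x)) ?N ?\<pi>" by (subst distr_distr[OF \<pi> t]) (simp add: o_def)
    finally have eq: "distr \<nu> \<nu> (\<lambda>C. g <# C) = distr (distr \<omega> \<omega> (\<lambda>x. g \<otimes> x)) ?N ?\<pi>" .
    have "probability_pair (distr \<omega> \<omega> (\<lambda>x. g \<otimes> x)) \<omega>"
      using \<omega>(1) prob_space.prob_space_distr[OF \<omega>(1) t] by (simp add: probability_pair_def probability_pair_axioms_def)
    moreover have "?\<pi> \<in> measurable (distr \<omega> \<omega> (\<lambda>x. g \<otimes> x)) ?N" using \<pi> by simp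
    ultimately show "f_divergence f (distr \<nu> \<nu> (\<lambda>C. g <# C)) \<nu> \<le> f_divergence f (distr \<omega> \<omega> (\<lambda>x. g \<otimes> x)) \<omega>"
      unfolding eq unfolding \<nu>_def by (rule f_divergence_distr_le[OF f])
  qed simp
  ultimately show "I_top \<Gamma> l f (\<lambda>g C. g <# C) (flag_space G T B) \<le> entropy \<Gamma> l f (\<lambda>g x. g \<otimes> x) \<omega>"
    unfolding I_top_def by (rule INF_lower2)
qed

end

context locally_compact_group
begin

lemma relatively_compact_exhaustion:
  assumes "second_countable T"
  obtains U K :: "nat \<Rightarrow> 'a set" where "\<And>n. openin T (U n)" "\<And>n. compactin T (K n)" "\<And>n. U n \<subseteq> K n"
    "incseq U" "(\<Union>n. U n) = carrier G"
proof -
  obtain \<B> where \<B>: "countable \<B>" "\<And>V. V \<in> \<B> \<Longrightarrow> openin T V"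
    "\<And>U x. openin T U \<Longrightarrow> x \<in> U \<Longrightarrow> \<exists>V\<in>\<B>. x \<in> V \<and> V \<subseteq> U"
    using assms unfolding second_countable_def by metis
  define \<C> where "\<C> = {V \<in> \<B>. \<exists>K. compactin T K \<and> V \<subseteq> K}"
  have cover: "\<exists>V\<in>\<C>. x \<in> V" if x: "x \<in> carrier G" for x
  proof -
    obtain W K where WK: "openin T W" "compactin T K" "x \<in> W" "W \<subseteq> K"
      using locally_compact x unfolding locally_compact_space_def topspace_eq by blast
    obtain V where "V \<in> \<B>" "x \<in> V" "V \<subseteq> W" using \<B>(3)[OF WK(1,3)] by blast
    then show ?thesis using WK unfolding \<C>_def by blast
  qed
  have \<C>: "countable \<C>" "\<C> \<noteq> {}" using \<B>(1) cover[OF one_closed] by (auto simp: \<C>_def)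
  define V where "V = from_nat_into \<C>"
  have V: "V n \<in> \<C>" for n unfolding V_def by (rule from_nat_into[OF \<C>(2)])
  have "\<forall>n. \<exists>K. compactin T K \<and> V n \<subseteq> K" using V unfolding \<C>_def by blast
  then obtain K where K: "\<And>n. compactin T (K n)" "\<And>n. V n \<subseteq> K n" by metis
  show thesis
  proof (rule that[of "\<lambda>n. \<Union>i\<le>n. V i" "\<lambda>n. \<Union>i\<le>n. K i"])
    show "openin T (\<Union>i\<le>n. V i)" for n using V \<B>(2) by (auto simp: \<C>_def intro!: openin_Union)
    show "compactin T (\<Union>i\<le>n. K i)" for n using K(1) by (intro compactin_Union) auto
    show "(\<Union>i\<le>n. V i) \<subseteq> (\<Union>i\<le>n. K i)" for n using K(2) by blast
    show "incseq (\<lambda>n. \<Union>i\<le>n. V i)" unfolding incseq_def by (intro allI impI UN_mono) auto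
    show "(\<Union>n. \<Union>i\<le>n. V i) = carrier G"
    proof
      show "(\<Union>n. \<Union>i\<le>n. V i) \<subseteq> carrier G" using V \<B>(2) open_subset_carrier by (force simp: \<C>_def)
      show "carrier G \<subseteq> (\<Union>n. \<Union>i\<le>n. V i)"
      proof
        fix x assume "x \<in> carrier G"
        then obtain W where W: "W \<in> \<C>" "x \<in> W" using cover by blast
        then obtain n where "V n = W" using from_nat_into_surj[OF \<C>(1)] unfolding V_def by blast
        then show "x \<in> (\<Union>n. \<Union>i\<le>n. V i)" using W by blast
      qed
    qed
  qed
qed

end

text \<open>Chart domains are homeomorphic to open subsets of a Euclidean space.\<close>

lemma lie_group_locally_compact:
  assumes "lie_group G T A"
  shows "locally_compact_group G T"
proof -
  interpret lie_group G T A by (rule assms)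
  interpret topological_group G T by standard (fact topspace_eq mult_continuous inv_continuous)+
  have "locally_compact_space T"
    unfolding locally_compact_space_def
  proof (intro ballI)
    fix x assume "x \<in> topspace T"
    then obtain U \<phi> where U: "(U, \<phi>) \<in> A" "x \<in> U" using charts_cover by blast
    have op: "openin T U" "open (\<phi> ` U)" using chart_open[OF U(1)] by auto
    have "locally_compact_space (top_of_set (\<phi> ` U))"
      using op(2) by (intro locally_compact_space_open_subset) (auto simp: locally_compact_space_euclidean)
    moreover have "top_of_set (\<phi> ` U) homeomorphic_space subtopology T U"
      using chart_homeomorphic[OF U(1)] homeomorphic_map_imp_homeomorphic_space homeomorphic_space_sym by blast
    ultimately have "locally_compact_space (subtopology T U)"
      using homeomorphic_locally_compact_spaceD by blast
    moreover have "x \<in> topspace (subtopology T U)" using U(2) \<open>x \<in> topspace T\<close> by simp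
    ultimately obtain V K where "openin (subtopology T U) V" "compactin (subtopology T U) K" "x \<in> V" "V \<subseteq> K"
      unfolding locally_compact_space_def by blast
    then show "\<exists>V K. openin T V \<and> compactin T K \<and> x \<in> V \<and> V \<subseteq> K"
      using op(1) by (auto simp: openin_open_subtopology compactin_subtopology)
  qed
  then show ?thesis by unfold_locales (rule Hausdorff)
qed

context locally_compact_group
begin

text \<open>\<open>G\<close> is the union of an increasing sequence of relatively compact open sets; continuity of \<open>\<nu>\<close> along it gives
  tightness, simultaneously for finitely many translates.\<close>

lemma tight_open_image:
  assumes B: "subgroup B G" and \<nu>: "\<nu> \<in> borel_probabilities (flag_space G T B)"
    and countable: "second_countable T" and S: "finite S" "S \<subseteq> carrier G" and d: "0 < d"
  obtains U K where "openin (flag_space G T B) ((\<lambda>x. x <# B) ` U)" "compactin T K" "U \<subseteq> K"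
    "\<And>s. s \<in> S \<Longrightarrow> measure \<nu> {C \<in> space \<nu>. s <# C \<notin> (\<lambda>x. x <# B) ` U} < d"
proof -
  let ?X = "flag_space G T B" and ?\<pi> = "\<lambda>x. x <# B"
  note facts = borel_probability_facts[OF \<nu>]
  interpret \<nu>: prob_space \<nu> by (rule facts(1))
  have Bc: "B \<subseteq> carrier G" by (rule subgroup.subset[OF B])
  obtain U K where UK: "\<And>n. openin T (U n)" "\<And>n. compactin T (K n)" "\<And>n. U n \<subseteq> K n"
    "incseq U" "(\<Union>n. U n) = carrier G"
    using relatively_compact_exhaustion[OF countable] by metis
  have open_image: "openin ?X (?\<pi> ` U n)" for n
  proof -
    have "U n \<subseteq> carrier G" by (rule open_subset_carrier[OF UK(1)])
    have img: "?\<pi> ` (U n <#> B) = ?\<pi> ` U n"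
    proof (intro equalityI subsetI)
      fix C assume "C \<in> ?\<pi> ` (U n <#> B)"
      then obtain x b where xb: "x \<in> U n" "b \<in> B" "C = (x \<otimes> b) <# B" by (auto simp: set_mult_def)
      have "(x \<otimes> b) <# B = x <# (b <# B)"
        using xb \<open>U n \<subseteq> carrier G\<close> Bc by (intro coset_action[symmetric]) auto
      also have "b <# B = B" using xb(2) B coset_join3[of b B] Bc by auto
      finally show "C \<in> ?\<pi> ` U n" using xb by blast
    next
      fix C assume "C \<in> ?\<pi> ` U n"
      then show "C \<in> ?\<pi> ` (U n <#> B)"
        using subset_saturation[OF B \<open>U n \<subseteq> carrier G\<close>] by blast
    qed
    have "(U n <#> B) <#> B \<subseteq> U n <#> B"
      using set_mult_assoc[OF \<open>U n \<subseteq> carrier G\<close> Bc Bc] subgroup_mult_id[OF B] by simp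
    then show ?thesis
      using openin_flag_space_image[OF B openin_set_mult_left[OF UK(1) Bc]] img by metis
  qed
  have lim: "(\<lambda>n. measure \<nu> {C \<in> space \<nu>. s <# C \<notin> ?\<pi> ` U n}) \<longlonglongrightarrow> 0" if s: "s \<in> S" for s
  proof -
    have sc: "s \<in> carrier G" using s S by blast
    have act: "(\<lambda>C. s <# C) \<in> measurable \<nu> \<nu>" by (rule measurable_coset_action[OF B sc facts(4)])
    define E where "E = (\<lambda>n. {C \<in> space \<nu>. s <# C \<notin> ?\<pi> ` U n})"
    have E: "E n \<in> sets \<nu>" for n
    proof -
      have "E n = space \<nu> - ((\<lambda>C. s <# C) -` (?\<pi> ` U n) \<inter> space \<nu>)" by (auto simp: E_def)
      then show ?thesis using measurable_sets[OF act facts(3)[OF open_image]] by (simp add: sets.compl_sets)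
    qed
    have "decseq E" using UK(4) unfolding decseq_def incseq_def E_def by blast
    moreover have "(\<Inter>n. E n) = {}"
    proof (rule ccontr)
      assume "(\<Inter>n. E n) \<noteq> {}"
      then obtain C where C: "\<And>n. C \<in> E n" by blast
      then have "C \<in> topspace ?X" using C[of 0] by (simp add: E_def facts(2))
      then obtain x where x: "x \<in> carrier G" "C = x <# B" by (auto simp: topspace_flag_space)
      then obtain n where "s \<otimes> x \<in> U n" using UK(5) sc by blast
      then have "s <# C \<in> ?\<pi> ` U n" using coset_action[OF Bc sc x(1)] x(2) by simp
      then show False using C[of n] by (simp add: E_def)
    qed
    ultimately show ?thesis using \<nu>.finite_Lim_measure_decseq[of E] E by (auto simp: E_def)
  qed
  have "\<forall>\<^sub>F n in sequentially. \<forall>s\<in>S. measure \<nu> {C \<in> space \<nu>. s <# C \<notin> ?\<pi> ` U n} < d"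
    by (rule eventually_ball_finite[OF S(1)]) (intro ballI order_tendstoD(2)[OF lim d])
  then obtain n where "\<forall>s\<in>S. measure \<nu> {C \<in> space \<nu>. s <# C \<notin> ?\<pi> ` U n} < d"
    using eventually_happens'[OF sequentially_bot] by blast
  then show thesis using that[OF open_image UK(2) UK(3), of n] by blast
qed

theorem I_group_le_I_top:
  assumes f: "convex_on {0<..} f" "f 1 = 0"
    and countable: "second_countable T"
    and \<Gamma>: "discrete_subgroup G T \<Gamma>"
    and B: "subgroup B G" "closedin T B" "boundedly_amenable G T B"
    and l: "finite (set_pmf l)" "generate G (set_pmf l) = \<Gamma>" "set_pmf l \<subseteq> \<Gamma>"
  shows "I_group G \<Gamma> l f \<le> I_top \<Gamma> l f (\<lambda>g C. g <# C) (flag_space G T B)"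
  unfolding I_top_def
proof (rule INF_greatest)
  let ?X = "flag_space G T B" and ?\<pi> = "\<lambda>x. x <# B"
  let ?E = "measure_pmf.expectation"
  fix \<nu> assume \<nu>: "\<nu> \<in> borel_probabilities ?X"
  note facts = borel_probability_facts[OF \<nu>]
  interpret \<nu>: prob_space \<nu> by (rule facts(1))
  define S where "S = set_pmf l"
  have sub: "subgroup \<Gamma> G" "\<Gamma> \<subseteq> carrier G"
    using \<Gamma> subgroup.subset[of \<Gamma> G] by (simp_all add: discrete_subgroup_def)
  have S: "finite S" "S \<noteq> {}" "S \<subseteq> \<Gamma>" "S \<subseteq> carrier G" "generate G S = \<Gamma>"
    using l sub set_pmf_not_empty[of l] by (auto simp: S_def)
  have Bc: "B \<subseteq> carrier G" by (rule subgroup.subset[OF B(1)])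
  have one: "\<one> \<in> \<Gamma>" by (rule subgroup.one_closed[OF sub(1)])
  show "I_group G \<Gamma> l f \<le> entropy \<Gamma> l f (\<lambda>g C. g <# C) \<nu>"
  proof (rule ennreal_le_epsilon)
    fix \<epsilon> :: real assume "0 < \<epsilon>"
    define \<delta> where "\<delta> = \<epsilon> / 2"
    have \<delta>: "0 < \<delta>" using \<open>0 < \<epsilon>\<close> by (simp add: \<delta>_def)
    obtain L \<eta> :: real where L: "0 < L" "0 < \<eta>" "\<eta> < 1"
      and smooth: "\<And>\<omega>'. set_pmf \<omega>' \<subseteq> \<Gamma> \<Longrightarrow> \<exists>\<omega>. set_pmf \<omega> = \<Gamma> \<and> (\<forall>s\<in>S. \<exists>\<alpha> \<beta>.
        bounded_minorants f L \<alpha> \<beta> \<and>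
        f_divergence f (measure_on \<Gamma> \<one> (map_pmf (\<lambda>x. s \<otimes> x) \<omega>)) (measure_on \<Gamma> \<one> \<omega>) \<le>
        ennreal ((1 - \<eta>) * (?E (map_pmf (\<lambda>x. s \<otimes> x) \<omega>') \<alpha> + ?E \<omega>' \<beta>) + \<delta>))"
      by (rule smoothed_approximation[OF f S(1,2,4) \<delta>, unfolded S(5)]) blast
    define e where "e = \<delta> / (2 * L)"
    define d where "d = \<delta> / (8 * L)"
    have ed: "0 < e" "0 < d" "L * (e + 2 * (d + d)) = \<delta>"
      using \<delta> L by (auto simp: e_def d_def field_simps)
    obtain U0 K where open_U0: "openin ?X (?\<pi> ` U0)" and UK: "compactin T K" "U0 \<subseteq> K"
      and tight: "\<And>s. s \<in> insert \<one> S \<Longrightarrow> measure \<nu> {C \<in> space \<nu>. s <# C \<notin> ?\<pi> ` U0} < d"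
      using tight_open_image[OF B(1) \<nu> countable _ _ ed(2), of "insert \<one> S"] S by auto
    obtain n :: nat and U :: "nat \<Rightarrow> 'a set" and m :: "nat \<Rightarrow> 'a pmf" where
      U: "\<And>i. i < n \<Longrightarrow> openin T (U i)" "\<And>i. i < n \<Longrightarrow> U i <#> B \<subseteq> U i" "K \<subseteq> (\<Union>i<n. U i)"
      and m: "\<And>i. i < n \<Longrightarrow> finite (set_pmf (m i)) \<and> set_pmf (m i) \<subseteq> \<Gamma>"
      and close: "\<And>s i j y. s \<in> S \<Longrightarrow> i < n \<Longrightarrow> j < n \<Longrightarrow> y \<in> U i \<Longrightarrow> s \<otimes> y \<in> U j \<Longrightarrow>
        tv_close e (map_pmf (\<lambda>x. s \<otimes> x) (m i)) (m j)"
      by (rule approximately_equivariant_kernels[OF \<Gamma> B UK(1) S(1,3) ed(1)]) blast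
    have Uc: "U i \<subseteq> carrier G" if "i < n" for i by (rule open_subset_carrier[OF U(1)[OF that]])
    define m' where "m' = (\<lambda>i. if i < n then m i else return_pmf \<one>)"
    \<comment> \<open>The index \<open>n\<close> is reserved for the points outside all the sets \<open>U i\<close>.\<close>
    define A where "A = (\<lambda>i. if i < n then ?\<pi> ` U i else {})"
    have A [measurable]: "A i \<in> sets \<nu>" for i
      using facts(3)[OF openin_flag_space_image[OF B(1) U(1,2)]] by (simp add: A_def)
    define \<iota> where "\<iota> = (\<lambda>C. LEAST i. i = n \<or> C \<in> A i)"
    have \<iota>_meas: "\<iota> \<in> measurable \<nu> (count_space UNIV)" unfolding \<iota>_def by measurable
    have \<iota>_le: "\<iota> C \<le> n" for C unfolding \<iota>_def by (rule Least_le) simp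
    have \<iota>_good: "\<iota> C < n \<and> C \<in> ?\<pi> ` U (\<iota> C)" if C: "C \<in> ?\<pi> ` U0" for C
    proof -
      obtain i where i: "i < n" "C \<in> A i" using C UK(2) U(3) by (force simp: A_def)
      then have "\<iota> C \<le> i" unfolding \<iota>_def by (intro Least_le) simp
      moreover have "\<iota> C = n \<or> C \<in> A (\<iota> C)" unfolding \<iota>_def by (rule LeastI_ex) blast
      ultimately show ?thesis using i by (auto simp: A_def split: if_splits)
    qed
    obtain \<theta> where \<theta>: "measure_pmf \<theta> = distr \<nu> (count_space UNIV) \<iota>"
      by (rule pmf_of_distr_exists[OF facts(1) \<iota>_meas])
    define \<omega>' where "\<omega>' = bind_pmf \<theta> m'"
    have "set_pmf (m' i) \<subseteq> \<Gamma>" for i using m[of i] one by (simp add: m'_def)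
    then have "set_pmf \<omega>' \<subseteq> \<Gamma>" by (auto simp: \<omega>'_def)
    from smooth[OF this] obtain \<omega> where \<omega>: "set_pmf \<omega> = \<Gamma>" and smooth_\<omega>: "\<forall>s\<in>S. \<exists>\<alpha> \<beta>.
        bounded_minorants f L \<alpha> \<beta> \<and>
        f_divergence f (measure_on \<Gamma> \<one> (map_pmf (\<lambda>x. s \<otimes> x) \<omega>)) (measure_on \<Gamma> \<one> \<omega>) \<le>
        ennreal ((1 - \<eta>) * (?E (map_pmf (\<lambda>x. s \<otimes> x) \<omega>') \<alpha> + ?E \<omega>' \<beta>) + \<delta>)" by (elim exE conjE)
    define \<Omega> where "\<Omega> = measure_on \<Gamma> \<one> \<omega>"
    have \<Omega>: "prob_space \<Omega>" "sets \<Omega> = sets (count_space \<Gamma>)" "\<forall>g\<in>\<Gamma>. 0 < emeasure \<Omega> {g}"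
      using measure_on_facts[OF one, of \<omega>] \<omega> by (auto simp: \<Omega>_def emeasure_pmf_single pmf_positive)
    have step: "f_divergence f (distr \<Omega> \<Omega> (\<lambda>x. s \<otimes> x)) \<Omega> \<le>
        f_divergence f (distr \<nu> \<nu> (\<lambda>C. s <# C)) \<nu> + ennreal \<epsilon>" if s: "s \<in> S" for s
    proof -
      have sc: "s \<in> carrier G" "s \<in> \<Gamma>" using s S by auto
      have act: "(\<lambda>C. s <# C) \<in> measurable \<nu> \<nu>" by (rule measurable_coset_action[OF B(1) sc(1) facts(4)])
      obtain \<alpha> \<beta> where minorant: "\<And>x. affine_minorant f (\<alpha> x) (\<beta> x)"
        and bounded: "\<And>x. \<bar>\<alpha> x\<bar> \<le> L" "\<And>x. \<bar>\<beta> x\<bar> \<le> L"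
        and D: "f_divergence f (measure_on \<Gamma> \<one> (map_pmf (\<lambda>x. s \<otimes> x) \<omega>)) \<Omega> \<le>
          ennreal ((1 - \<eta>) * (?E (map_pmf (\<lambda>x. s \<otimes> x) \<omega>') \<alpha> + ?E \<omega>' \<beta>) + \<delta>)"
        using bspec[OF smooth_\<omega> s] unfolding \<Omega>_def by blast
      define V where "V = ?E (map_pmf (\<lambda>x. s \<otimes> x) \<omega>') \<alpha> + ?E \<omega>' \<beta>"
      define D1 where "D1 = {C \<in> space \<nu>. \<one> <# C \<notin> ?\<pi> ` U0}"
      define D2 where "D2 = {C \<in> space \<nu>. s <# C \<notin> ?\<pi> ` U0}"
      have V: "ennreal V \<le> f_divergence f (distr \<nu> \<nu> (\<lambda>C. s <# C)) \<nu> + ennreal \<delta>"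
        unfolding V_def \<omega>'_def ed(3)[symmetric]
      proof (rule divergence_transfer[OF f facts(1) act \<iota>_meas, where N = "Suc n" and D = "D1 \<union> D2"])
        show "\<iota> C < Suc n" for C using \<iota>_le[of C] by simp
        have D12: "D1 \<in> sets \<nu>" "D2 \<in> sets \<nu>"
        proof -
          have "{C \<in> space \<nu>. t <# C \<notin> ?\<pi> ` U0} \<in> sets \<nu>" if t: "t \<in> carrier G" for t
          proof -
            have act_t: "(\<lambda>C. t <# C) \<in> measurable \<nu> \<nu>" by (rule measurable_coset_action[OF B(1) t facts(4)])
            have "{C \<in> space \<nu>. t <# C \<notin> ?\<pi> ` U0} = space \<nu> - ((\<lambda>C. t <# C) -` (?\<pi> ` U0) \<inter> space \<nu>)" by auto
            then show ?thesis
              using measurable_sets[OF act_t facts(3)[OF open_U0]] by (simp add: sets.compl_sets)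
          qed
          then show "D1 \<in> sets \<nu>" "D2 \<in> sets \<nu>" unfolding D1_def D2_def using sc by simp_all
        qed
        then show "D1 \<union> D2 \<in> sets \<nu>" by simp
        have "measure \<nu> D1 < d" "measure \<nu> D2 < d"
          unfolding D1_def D2_def using s by (intro tight; simp)+
        moreover have "measure \<nu> (D1 \<union> D2) \<le> measure \<nu> D1 + measure \<nu> D2"
          using D12 by (rule measure_Un_le)
        ultimately show "measure \<nu> (D1 \<union> D2) \<le> d + d" by simp
        fix C assume C: "C \<in> space \<nu> - (D1 \<union> D2)"
        then obtain x where x: "x \<in> carrier G" "C = x <# B" by (auto simp: facts(2) topspace_flag_space)
        have "\<one> <# C = C" using coset_action[OF Bc one_closed x(1)] x by simp
        then have U0_mem: "C \<in> ?\<pi> ` U0" "s <# C \<in> ?\<pi> ` U0" using C by (auto simp: D1_def D2_def)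
        note good = \<iota>_good[OF U0_mem(1)] \<iota>_good[OF U0_mem(2)]
        have sx: "s \<otimes> x \<in> carrier G" "s <# C = (s \<otimes> x) <# B"
          using sc x coset_action[OF Bc sc(1) x(1)] by simp_all
        have "x \<in> U (\<iota> C)"
          using coset_in_image_iff[OF B(1) Uc[OF conjunct1[OF good(1)]] U(2)[OF conjunct1[OF good(1)]] x(1)] good(1) x(2) by simp
        moreover have "s \<otimes> x \<in> U (\<iota> (s <# C))"
          using coset_in_image_iff[OF B(1) Uc[OF conjunct1[OF good(2)]] U(2)[OF conjunct1[OF good(2)]] sx(1)] good(2) sx(2) by simp
        ultimately have "tv_close e (map_pmf (\<lambda>x. s \<otimes> x) (m (\<iota> C))) (m (\<iota> (s <# C)))"
          using good by (intro close[OF s]) auto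
        then show "tv_close e (map_pmf (\<lambda>x. s \<otimes> x) (m' (\<iota> C))) (m' (\<iota> (s <# C)))"
          using good by (simp add: m'_def)
      qed (use ed minorant bounded L \<theta> in auto)
      have "distr \<Omega> \<Omega> (\<lambda>x. s \<otimes> x) = measure_on \<Gamma> \<one> (map_pmf (\<lambda>x. s \<otimes> x) \<omega>)"
        unfolding \<Omega>_def using \<omega> sc sub by (intro distr_measure_on[OF one]) (auto simp: subgroup.m_closed)
      then have "f_divergence f (distr \<Omega> \<Omega> (\<lambda>x. s \<otimes> x)) \<Omega> \<le> ennreal ((1 - \<eta>) * V + \<delta>)"
        using D by (simp only: V_def)
      also have "\<dots> \<le> ennreal ((1 - \<eta>) * V) + ennreal \<delta>" using \<delta> by (intro ennreal_add_le) simp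
      also have "ennreal ((1 - \<eta>) * V) \<le> ennreal V"
      proof (cases "0 \<le> V")
        case True
        then show ?thesis using L by (intro ennreal_leI mult_left_le_one_le) auto
      next
        case False
        then have "(1 - \<eta>) * V \<le> 0" using L by (simp add: mult_le_0_iff)
        then show ?thesis by (simp add: ennreal_neg)
      qed
      also note V
      finally have "f_divergence f (distr \<Omega> \<Omega> (\<lambda>x. s \<otimes> x)) \<Omega> \<le>
          f_divergence f (distr \<nu> \<nu> (\<lambda>C. s <# C)) \<nu> + (ennreal \<delta> + ennreal \<delta>)"
        by (simp add: add.assoc add_right_mono)
      also have "ennreal \<delta> + ennreal \<delta> = ennreal \<epsilon>" using \<delta> by (simp add: \<delta>_def flip: ennreal_plus)
      finally show ?thesis .
    qed
    have "I_group G \<Gamma> l f \<le> entropy \<Gamma> l f (\<lambda>g x. g \<otimes> x) \<Omega>"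
      unfolding I_group_def using \<Omega> by (intro INF_lower) simp
    also have "\<dots> \<le> (\<Sum>g\<in>S. ennreal (pmf l g) * (f_divergence f (distr \<nu> \<nu> (\<lambda>C. g <# C)) \<nu> + ennreal \<epsilon>))"
      unfolding entropy_eq_sum[OF l(1,3)] S_def[symmetric] by (intro sum_mono mult_left_mono step) auto
    also have "\<dots> = entropy \<Gamma> l f (\<lambda>g C. g <# C) \<nu> + (\<Sum>g\<in>S. ennreal (pmf l g)) * ennreal \<epsilon>"
      unfolding entropy_eq_sum[OF l(1,3)] S_def[symmetric] by (simp only: distrib_left sum.distrib sum_distrib_right)
    also have "(\<Sum>g\<in>S. ennreal (pmf l g)) = 1"
      unfolding S_def using sum_pmf_eq_1[OF l(1) order_refl] by (simp add: sum_ennreal)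
    finally show "I_group G \<Gamma> l f \<le> entropy \<Gamma> l f (\<lambda>g C. g <# C) \<nu> + ennreal \<epsilon>" by simp
  qed
qed

end

theorem theorem3:
  fixes G :: "('g, 'm) monoid_scheme"
    and T :: "'g topology"
    and A :: "('g, 'e::euclidean_space) chart set"
    and \<Gamma> B :: "'g set"
    and l :: "'g pmf"
    and f :: "real \<Rightarrow> real"
  assumes "semisimple_lie_group G T A"
    and "discrete_subgroup G T \<Gamma>"
    and "borel_subgroup G T A B"
    and "set_pmf l \<subseteq> \<Gamma>" and "finite (set_pmf l)" and "generate G (set_pmf l) = \<Gamma>"
    and "convex_on {0<..} f" and "f 1 = 0"
  shows "I_top \<Gamma> l f (\<lambda>g C. g <#\<^bsub>G\<^esub> C) (flag_space G T B) = I_group G \<Gamma> l f"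
proof -
  have lie: "lie_group G T A" using assms(1) by (simp add: semisimple_lie_group_def)
  interpret locally_compact_group G T by (rule lie_group_locally_compact[OF lie])
  have countable: "second_countable T"
    using lie by (simp add: lie_group_def smooth_manifold_def)
  have B: "subgroup B G" "closedin T B" "solvable (G\<lparr>carrier := B\<rparr>)"
    using assms(3) by (simp_all add: borel_subgroup_def)
  have \<Gamma>: "subgroup \<Gamma> G" using assms(2) by (simp add: discrete_subgroup_def)
  show ?thesis
  proof (rule antisym)
    show "I_top \<Gamma> l f (\<lambda>g C. g <#\<^bsub>G\<^esub> C) (flag_space G T B) \<le> I_group G \<Gamma> l f"
      by (rule I_top_le_I_group[OF assms(7,8) B(1) \<Gamma> assms(5,4)])
    show "I_group G \<Gamma> l f \<le> I_top \<Gamma> l f (\<lambda>g C. g <#\<^bsub>G\<^esub> C) (flag_space G T B)"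
      by (rule I_group_le_I_top[OF assms(7,8) countable assms(2) B(1,2) boundedly_amenable_solvable[OF B] assms(5,6,4)])
  qed
qed

end
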